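(* Let $G$ be a $2$-connected subcubic graph of order at least $21$. Then $\nu_s(G)=\nu_{ur}(G)$ if and only if $G$ is isomorphic to a graph in $\mathcal{B}$.
   Context: All graphs are finite, simple, and undirected. A graph is subcubic if its maximum degree is at most $3$. For a matching $M$ in a graph $G$, let $V(M)$ be the set of vertices covered by $M$, and let $G(M)$ be the subgraph of $G$ induced by $V(M)$. The matching $M$ is induced if $G(M)$ is $1$-regular, and uniquely restricted if $M$ is the unique perfect matching of $G(M)$. Let $\nu_s(G)$ be the largest size of an induced matching in $G$, and let $\nu_{ur}(G)$ be the largest size of a uniquely restricted matching in $G$. For a positive integer $k$, let $L_k$ be the graph of order $3k$ that arises from $k$ vertices $w_1,\ldots,w_k$ and two disjoint paths $u_1u_2\ldots u_k$ and $v_1v_2\ldots v_k$ by adding the edges $w_iu_i$ and $w_iv_i$ for every $i\in\{1,\ldots,k\}$. Let $L_k'$ arise from $L_k$ by adding two new vertices $w_1'$ and $w_k'$, and the new edges $u_1w_1'$, $v_1w_1'$, $u_1v_1$, $u_kw_k'$, $v_kw_k'$, $u_kv_k$ (for $k=1$, $w_1'$ and $w_k'$ denote two distinct vertices, and $u_1v_1$ and $u_kv_k$ are the same edge). Let $\mathcal{B}_1$ be the set of all $2$-connected subcubic graphs $G$ such that, for some positive integer $k$, $L_k\subseteq G\subseteq L_k'$, that is, $L_k$ is a subgraph of $G$ and $G$ is a subgraph of $L_k'$ (with respect to the specified copy of $L_k$ in $L_k'$; subgraphs need not be induced). Let $\mathcal{B}_2$ be the set of all graphs $G$ such that, for some integer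 $k\geq 3$, $G$ arises from $L_k$ by adding the two new edges $u_1v_k$ and $v_1u_k$ if $k$ is odd, and by adding the two new edges $u_1u_k$ and $v_1v_k$ if $k$ is even. (These graphs are subcubic.) Let $\mathcal{B}=\mathcal{B}_1\cup\mathcal{B}_2$. *)

theory Defs
  imports Main
begin

record 'a ugraph =
  verts :: "'a set"
  edges :: "'a set set"

definition simple_graph :: "'a ugraph \<Rightarrow> bool" where
  "simple_graph G \<longleftrightarrow> finite (verts G) \<and> (\<forall>e\<in>edges G. e \<subseteq> verts G \<and> card e = 2)"

definition degree :: "'a ugraph \<Rightarrow> 'a \<Rightarrow> nat" where
  "degree G v = card {e \<in> edges G. v \<in> e}"

definition subcubic :: "'a ugraph \<Rightarrow> bool" where
  "subcubic G \<longleftrightarrow> (\<forall>v\<in>verts G. degree G v \<le> 3)"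

definition regular :: "nat \<Rightarrow> 'a ugraph \<Rightarrow> bool" where
  "regular r G \<longleftrightarrow> (\<forall>v\<in>verts G. degree G v = r)"

definition subgraph :: "'a ugraph \<Rightarrow> 'a ugraph \<Rightarrow> bool" where
  "subgraph H G \<longleftrightarrow> verts H \<subseteq> verts G \<and> edges H \<subseteq> edges G"

definition induced_on :: "'a ugraph \<Rightarrow> 'a set \<Rightarrow> 'a ugraph" where
  "induced_on G X = \<lparr>verts = verts G \<inter> X, edges = {e \<in> edges G. e \<subseteq> X}\<rparr>"

definition graph_iso :: "'a ugraph \<Rightarrow> 'b ugraph \<Rightarrow> bool" where
  "graph_iso G H \<longleftrightarrow> (\<exists>f. bij_betw f (verts G) (verts H) \<and>
     (\<forall>x\<in>verts G. \<forall>y\<in>verts G. {x, y} \<in> edges G \<longleftrightarrow> {f x, f y} \<in> edges H))"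

definition connected_graph :: "'a ugraph \<Rightarrow> bool" where
  "connected_graph G \<longleftrightarrow> verts G \<noteq> {} \<and>
     (\<forall>x\<in>verts G. \<forall>y\<in>verts G. (x, y) \<in> {(a, b). {a, b} \<in> edges G}\<^sup>*)"

text \<open>Order greater than \<open>k\<close>, and no set of fewer than \<open>k\<close> vertices separates the graph.\<close>

definition k_connected :: "nat \<Rightarrow> 'a ugraph \<Rightarrow> bool" where
  "k_connected k G \<longleftrightarrow> k < card (verts G) \<and>
     (\<forall>X. X \<subseteq> verts G \<and> card X < k \<longrightarrow> connected_graph (induced_on G (verts G - X)))"

definition matching :: "'a ugraph \<Rightarrow> 'a set set \<Rightarrow> bool" where
  "matching G M \<longleftrightarrow> M \<subseteq> edges G \<and> (\<forall>e\<in>M. \<forall>f\<in>M. e \<noteq> f \<longrightarrow> e \<inter> f = {})"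

definition perfect_matching :: "'a ugraph \<Rightarrow> 'a set set \<Rightarrow> bool" where
  "perfect_matching G M \<longleftrightarrow> matching G M \<and> \<Union>M = verts G"

definition induced_matching :: "'a ugraph \<Rightarrow> 'a set set \<Rightarrow> bool" where
  "induced_matching G M \<longleftrightarrow> matching G M \<and> regular 1 (induced_on G (\<Union>M))"

definition uniquely_restricted_matching :: "'a ugraph \<Rightarrow> 'a set set \<Rightarrow> bool" where
  "uniquely_restricted_matching G M \<longleftrightarrow> matching G M \<and>
     (\<forall>N. perfect_matching (induced_on G (\<Union>M)) N \<longleftrightarrow> N = M)"

text \<open>In a finite graph both maxima range over a finite set, which contains the size of the
  empty matching.\<close>

definition nu_s :: "'a ugraph \<Rightarrow> nat" where
  "nu_s G = Max (card ` {M. induced_matching G M})"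

definition nu_ur :: "'a ugraph \<Rightarrow> nat" where
  "nu_ur G = Max (card ` {M. uniquely_restricted_matching G M})"

text \<open>The constructors \<open>W1'\<close> and \<open>Wk'\<close> are the two additional vertices \<open>w\<^sub>1'\<close> and \<open>w\<^sub>k'\<close> of
  \<open>L_prime k\<close>; they are distinct also for \<open>k = 1\<close>.\<close>

datatype lvert = U nat | V nat | W nat | W1' | Wk'

definition L :: "nat \<Rightarrow> lvert ugraph" where
  "L k = \<lparr>verts = U ` {1..k} \<union> V ` {1..k} \<union> W ` {1..k},
          edges = {{U i, U (i + 1)} | i. 1 \<le> i \<and> i < k}
                \<union> {{V i, V (i + 1)} | i. 1 \<le> i \<and> i < k}
                \<union> {{W i, U i} | i. 1 \<le> i \<and> i \<le> k}
                \<union> {{W i, V i} | i. 1 \<le> i \<and> i \<le> k}\<rparr>"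

definition add_edges :: "'a ugraph \<Rightarrow> 'a set set \<Rightarrow> 'a ugraph" where
  "add_edges G F = \<lparr>verts = verts G, edges = edges G \<union> F\<rparr>"

definition L_prime :: "nat \<Rightarrow> lvert ugraph" where
  "L_prime k = \<lparr>verts = verts (L k) \<union> {W1', Wk'},
                edges = edges (L k) \<union> {{U 1, W1'}, {V 1, W1'}, {U 1, V 1},
                                        {U k, Wk'}, {V k, Wk'}, {U k, V k}}\<rparr>"

definition B1 :: "lvert ugraph set" where
  "B1 = {G. simple_graph G \<and> k_connected 2 G \<and> subcubic G \<and>
            (\<exists>k\<ge>1. subgraph (L k) G \<and> subgraph G (L_prime k))}"

definition B2 :: "lvert ugraph set" where
  "B2 = {G. \<exists>k\<ge>3. G = add_edges (L k)
           (if odd k then {{U 1, V k}, {V 1, U k}} else {{U 1, U k}, {V 1, V k}})}"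

definition B :: "lvert ugraph set" where
  "B = B1 \<union> B2"

end

(* Let M be a maximum induced matching with |M| = nu_s(G) = nu_ur(G), and let I be the set of
   vertices it leaves uncovered.  As M is induced, an augmenting path of M is either an edge uv inside I
   or a path u-p-q-v with pq in M; call both "links" between u and v.  The perfect matchings of
   G[V(M) + u + v] correspond to the links between u and v, so the maximality of |M| among the uniquely
   restricted matchings says exactly that no two vertices of I are joined by precisely one link.
   As G is subcubic, each vertex of I is then linked to at most three others.  If some vertex is linked
   to three, the structure closes up around it (the cube is the extremal case) and n <= 8 + 12 = 20.
   Otherwise the link graph is a path or a cycle, and reading off the neighbourhoods along it gives
   the columns of a ladder.
   Conversely, in a ladder with k columns the alternating matching shows nu_s >= k.  A graph with a
   unique perfect matching has a nonsingular adjacency matrix over GF(2), while that of a ladder has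
   rank at most 2k, whence nu_ur <= k. *)

theory Submission
  imports Defs
begin

section \<open>Links with respect to a matching\<close>

text \<open>A vertex u linked to exactly two others l, r has one neighbour, its hub w, through which
  both are reached. The hub has degree 2, and its mate b is adjacent to l and r. So x, w, b form a
  column, and inside the link path each x_i is adjacent to b_(i-1) and b_(i+1), never to x_(i+1):
  the rails alternate between uncovered vertices and mates of hubs. Closing a cycle of k columns
  therefore crosses the rails exactly when k is odd, which is the case distinction in
  \<open>B2\<close>. The delicate places are the ends of a link path: an end vertex either heads a
  column of its own, possibly with the edge between its two rail vertices, or is one of
  \<open>W1'\<close>, \<open>Wk'\<close>. The bound 21 acts twice. It contradicts the count around a
  vertex with three links, and since the order is at most 4 |I| it gives |I| >= 6, which kills every
  small configuration closed under links. Nonsingularity over GF(2) is proved without determinants: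
  the parity of the number of perfect matchings is a Pfaffian, and the expansion formulas needed
  become two counting arguments.\<close>

definition branch :: "'a set \<Rightarrow> ('a \<Rightarrow> 'a set) \<Rightarrow> ('a \<Rightarrow> 'a) \<Rightarrow> 'a \<Rightarrow> 'a \<Rightarrow> 'a set" where
  "branch I nb mate u p = (if p \<in> I then {p} else nb (mate p) - {p, u})"

text \<open>\<open>I\<close> is the uncovered and \<open>J\<close> the covered part.
  \<open>no_cut\<close> expresses 2-connectedness: otherwise \<open>x\<close> would separate
  \<open>p\<close> and \<open>q\<close> from the rest. \<open>two_links\<close> asks for a different
  first step \<open>p'\<close>, which is the same as a different link, because the two ends and the
  first step determine a link.\<close>

locale linked_graph =
  fixes Vs I J :: "'a set" and nb :: "'a \<Rightarrow> 'a set" and mate :: "'a \<Rightarrow> 'a"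
  assumes fin: "finite Vs"
    and Vs_eq: "Vs = I \<union> J" and disj: "I \<inter> J = {}"
    and nb_V: "u \<in> nb v \<Longrightarrow> u \<in> Vs"
    and nb_sym: "u \<in> nb v \<Longrightarrow> v \<in> nb u"
    and nb_irrefl: "v \<notin> nb v"
    and deg_le: "card (nb v) \<le> 3"
    and deg_ge: "v \<in> Vs \<Longrightarrow> 2 \<le> card (nb v)"
    and conn: "D \<subseteq> Vs \<Longrightarrow> D \<noteq> {} \<Longrightarrow> (\<And>v u. v \<in> D \<Longrightarrow> u \<in> nb v \<Longrightarrow> u \<in> D) \<Longrightarrow> D = Vs"
    and no_cut: "p \<in> Vs \<Longrightarrow> nb p \<subseteq> {q, x} \<Longrightarrow> nb q \<subseteq> {p, x} \<Longrightarrow> False"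
    and mate_J: "p \<in> J \<Longrightarrow> mate p \<in> J"
    and mate_mate: "p \<in> J \<Longrightarrow> mate (mate p) = p"
    and mate_nb: "p \<in> J \<Longrightarrow> mate p \<in> nb p"
    and J_nb: "p \<in> J \<Longrightarrow> u \<in> nb p \<Longrightarrow> u \<noteq> mate p \<Longrightarrow> u \<in> I"
    and two_links: "u \<in> I \<Longrightarrow> p \<in> nb u \<Longrightarrow> v \<in> branch I nb mate u p \<Longrightarrow>
      \<exists>p'\<in>nb u. p' \<noteq> p \<and> v \<in> branch I nb mate u p'"
    and order: "card Vs \<ge> 21"
begin

text \<open>Links leaving \<open>u\<close> are sorted by their first step \<open>p\<close>;
  \<open>S u p\<close> collects their other ends.\<close>

abbreviation S :: "'a \<Rightarrow> 'a \<Rightarrow> 'a set" where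
  "S \<equiv> branch I nb mate"

lemma finite_nb: "finite (nb v)"
  using nb_V fin by (meson finite_subset subsetI)

lemma S_I: "p \<in> I \<Longrightarrow> S u p = {p}"
  by (simp add: branch_def)

lemma S_J: "p \<in> J \<Longrightarrow> S u p = nb (mate p) - {p, u}"
  using disj by (auto simp: branch_def)

lemma nb_cases: "p \<in> nb u \<Longrightarrow> (p \<in> I \<Longrightarrow> P) \<Longrightarrow> (p \<in> J \<Longrightarrow> P) \<Longrightarrow> P"
  using nb_V Vs_eq by blast

lemma S_subset: "p \<in> nb u \<Longrightarrow> S u p \<subseteq> I - {u}"
proof -
  assume p: "p \<in> nb u"
  show ?thesis
  proof (rule nb_cases[OF p])
    assume "p \<in> I" then show ?thesis using p nb_irrefl by (auto simp: S_I)
  next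
    assume "p \<in> J" then show ?thesis
      using J_nb[OF mate_J] mate_mate by (auto simp: S_J)
  qed
qed

lemma mate_neq: "p \<in> J \<Longrightarrow> mate p \<noteq> p"
  using mate_nb nb_irrefl by metis

lemma nb_mate: "p \<in> J \<Longrightarrow> p \<in> nb (mate p)"
  using mate_nb nb_sym by blast

lemma card_S: "p \<in> nb u \<Longrightarrow> finite (S u p) \<and> card (S u p) \<le> 2"
proof -
  assume p: "p \<in> nb u"
  show ?thesis
  proof (rule nb_cases[OF p])
    assume "p \<in> I" then show ?thesis by (simp add: S_I)
  next
    assume J: "p \<in> J"
    have "card (nb (mate p) - {p}) \<le> 2"
      using deg_le[of "mate p"] nb_mate[OF J] by (simp add: finite_nb)
    moreover have "card (S u p) \<le> card (nb (mate p) - {p})"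
      unfolding S_J[OF J] by (rule card_mono) (auto simp: finite_nb)
    ultimately show ?thesis using finite_nb J by (simp add: S_J)
  qed
qed

definition Q :: "'a \<Rightarrow> 'a set" where
  "Q u = (\<Union>p\<in>nb u. S u p)"

lemma Q_subset: "Q u \<subseteq> I - {u}"
  using S_subset by (auto simp: Q_def)

lemma Q_sym:
  assumes "u \<in> I" "v \<in> Q u" shows "u \<in> Q v"
proof -
  obtain p where p: "p \<in> nb u" "v \<in> S u p" using assms by (auto simp: Q_def)
  show ?thesis
  proof (rule nb_cases[OF p(1)])
    assume "p \<in> I"
    then show ?thesis using p assms nb_sym S_I by (force simp: Q_def)
  next
    assume J: "p \<in> J"
    then have "mate p \<in> nb v" using p nb_sym by (auto simp: S_J)
    moreover have "u \<in> S v (mate p)"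
      using J p nb_sym mate_J mate_mate assms disj by (auto simp: S_J)
    ultimately show ?thesis by (auto simp: Q_def)
  qed
qed

lemma Q_I: "u \<in> I \<Longrightarrow> v \<in> Q u \<Longrightarrow> v \<in> I"
  using Q_subset by blast

lemma Q_link:
  assumes "p \<in> J" "u \<in> nb p" "u \<in> I" "v \<in> nb (mate p)" "v \<noteq> u" "v \<in> I"
  shows "v \<in> S u p" "v \<in> Q u"
proof -
  show "v \<in> S u p" using assms disj by (auto simp: S_J)
  then show "v \<in> Q u" using assms(2) nb_sym by (auto simp: Q_def)
qed

lemma Q_direct: "p \<in> I \<Longrightarrow> p \<in> nb u \<Longrightarrow> p \<in> Q u"
  using S_I by (force simp: Q_def)

lemma J_other_nb:
  assumes "p \<in> J" obtains u where "u \<in> nb p" "u \<noteq> mate p" "u \<in> I"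
proof -
  have "p \<in> Vs" using assms Vs_eq by auto
  then have "card (nb p) \<ge> 2" by (rule deg_ge)
  then have "\<not> nb p \<subseteq> {mate p}"
    by (metis card.empty card_1_singleton_iff not_numeral_le_zero numeral_le_one_iff semiring_norm(69) subset_singletonD One_nat_def)
  then show ?thesis using that J_nb[OF assms] by blast
qed

text \<open>The link graph inherits connectedness. The point is that a matching edge touching
  \<open>C\<close> has all its uncovered neighbours in \<open>C\<close>, even two on the same side:
  both are linked to any further uncovered neighbour of the other side.\<close>

lemma Q_conn:
  assumes "C \<subseteq> I" "C \<noteq> {}" and cl: "\<And>u. u \<in> C \<Longrightarrow> Q u \<subseteq> C"
  shows "C = I"
proof -
  define D where "D = C \<union> {a \<in> J. (nb a \<union> nb (mate a)) \<inter> C \<noteq> {}}"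
  have "D = Vs"
  proof (rule conn)
    show "D \<subseteq> Vs" using assms(1) Vs_eq by (auto simp: D_def)
    show "D \<noteq> {}" using assms(2) by (auto simp: D_def)
    fix v u assume v: "v \<in> D" and u: "u \<in> nb v"
    show "u \<in> D"
    proof (cases "v \<in> C")
      case True
      show ?thesis
      proof (rule nb_cases[OF u])
        assume "u \<in> I" then show ?thesis using Q_direct u True cl by (auto simp: D_def)
      next
        assume "u \<in> J" then show ?thesis using u True nb_sym by (auto simp: D_def)
      qed
    next
      case False
      then have vJ: "v \<in> J" and "(nb v \<union> nb (mate v)) \<inter> C \<noteq> {}" using v by (auto simp: D_def)
      then obtain c where c: "c \<in> C" "c \<in> nb v \<or> c \<in> nb (mate v)" by auto
      have cI: "c \<in> I" using c assms(1) by auto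
      have mv: "mate v \<in> J" "mate (mate v) = v" using vJ mate_J mate_mate by auto
      show ?thesis
      proof (cases "u = mate v")
        case True
        then show ?thesis using mv c by (auto simp: D_def)
      next
        case False
        then have uI: "u \<in> I" using J_nb vJ u by blast
        have *: "u \<in> C" if "c' \<in> C" "c' \<in> nb (mate v)" for c'
        proof (cases "u = c'")
          case False
          then show ?thesis using Q_link(2)[of "mate v" c' u] mv that u uI assms(1) cl by auto
        qed (use that in auto)
        have "u \<in> C"
        proof (cases "c \<in> nb (mate v)")
          case True then show ?thesis using * c by blast
        next
          case False
          then have cv: "c \<in> nb v" using c by auto
          obtain v' where v': "v' \<in> nb (mate v)" "v' \<noteq> v" "v' \<in> I"
            using J_other_nb[OF mv(1)] mv by metis
          then have "v' \<in> Q c" using Q_link(2)[OF vJ cv cI] False by blast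
          then show ?thesis using * v' cl c by blast
        qed
        then show ?thesis by (auto simp: D_def)
      qed
    qed
  qed
  then show ?thesis using assms(1) Vs_eq disj by (auto simp: D_def)
qed

text \<open>Otherwise both ends of the matching edge see the same single uncovered vertex, which
  would be a cut vertex.\<close>

lemma link_exists:
  assumes "p \<in> J"
  obtains u v where "u \<in> nb p" "v \<in> nb (mate p)" "u \<noteq> v" "u \<in> I" "v \<in> I" "v \<in> Q u" "u \<in> Q v"
proof -
  have mp: "mate p \<in> J" "mate (mate p) = p" using assms mate_J mate_mate by auto
  obtain u where u: "u \<in> nb p" "u \<noteq> mate p" "u \<in> I" using J_other_nb[OF assms] by metis
  obtain v where v: "v \<in> nb (mate p)" "v \<noteq> p" "v \<in> I" using J_other_nb[OF mp(1)] mp by metis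
  have "\<exists>u v. u \<in> nb p \<and> v \<in> nb (mate p) \<and> u \<noteq> v \<and> u \<in> I \<and> v \<in> I"
  proof (rule ccontr)
    assume a: "\<not> ?thesis"
    have "nb p \<subseteq> {mate p, u}" using a u v J_nb[OF assms] by blast
    moreover have "nb (mate p) \<subseteq> {p, u}" using a u v J_nb[OF mp(1)] mp by auto
    moreover have "p \<in> Vs" using assms Vs_eq by auto
    ultimately show False using no_cut by blast
  qed
  then show ?thesis using that Q_link(2)[OF assms] Q_sym by metis
qed

text \<open>Every covered vertex has an uncovered neighbour and every uncovered vertex has at most
  three neighbours, so the order is at most 4 |I|. This turns 21 into 6.\<close>

lemma order_le: "card Vs = card I + card J" "card J \<le> 3 * card I" "6 \<le> card I"
proof -
  have f: "finite I" "finite J" using fin Vs_eq by auto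
  show 1: "card Vs = card I + card J" using f disj Vs_eq by (simp add: card_Un_disjoint)
  have "J \<subseteq> (\<Union>u\<in>I. nb u)"
  proof
    fix p assume "p \<in> J"
    then obtain u where "u \<in> nb p" "u \<in> I" using J_other_nb by metis
    then show "p \<in> (\<Union>u\<in>I. nb u)" using nb_sym by blast
  qed
  then have "card J \<le> card (\<Union>u\<in>I. nb u)" using f finite_nb by (intro card_mono) auto
  also have "\<dots> \<le> (\<Sum>u\<in>I. card (nb u))" by (rule card_UN_le[OF f(1)])
  also have "\<dots> \<le> (\<Sum>u\<in>I. 3)" using deg_le by (intro sum_mono) auto
  finally show 2: "card J \<le> 3 * card I" by simp
  show "6 \<le> card I" using 1 2 order by simp
qed

lemma two_branches:
  assumes "u \<in> I" "v \<in> Q u"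
  obtains p p' where "p \<in> nb u" "p' \<in> nb u" "p \<noteq> p'" "v \<in> S u p" "v \<in> S u p'"
  using assms two_links unfolding Q_def by blast

end

section \<open>No vertex is linked to three others\<close>

context linked_graph
begin

lemma four_nbs:
  assumes "distinct [a, b, c, d]" "a \<in> nb v" "b \<in> nb v" "c \<in> nb v" "d \<in> nb v"
  shows False
proof -
  have "card {a, b, c, d} \<le> card (nb v)" using assms by (intro card_mono finite_nb) auto
  moreover have "card {a, b, c, d} = 4" using assms(1) distinct_card[of "[a, b, c, d]"] by simp
  ultimately show False using deg_le[of v] by simp
qed

text \<open>Double counting without slack: each of the three vertices of \<open>Y\<close> lies in at
  least two branches, there are at most three branches, and each holds at most two vertices. Hence
  there are three branches of size two, each missing exactly one vertex; \<open>a y\<close> is the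
  one that misses \<open>y\<close>.\<close>

lemma three_nbs:
  assumes x: "x \<in> I" and Y: "Y \<subseteq> Q x" "card Y = 3"
  shows "\<exists>a. inj_on a Y \<and> a ` Y = nb x \<and> Q x = Y \<and>
    (\<forall>y\<in>Y. a y \<in> J \<and> S x (a y) = Y - {y} \<and> nb (mate (a y)) = insert (a y) (Y - {y}))"
proof -
  have finY: "finite Y" using Y(2) card.infinite by fastforce
  have miss: False if asm: "y \<in> Y" "c \<in> nb x" "c' \<in> nb x" "c \<noteq> c'" "y \<notin> S x c" "y \<notin> S x c'" for y c c'
  proof -
    obtain p p' where p: "p \<in> nb x" "p' \<in> nb x" "p \<noteq> p'" "y \<in> S x p" "y \<in> S x p'"
      using two_branches[OF x, of y] asm Y by blast
    have "distinct [c, c', p, p']" using asm(4-6) p(3-5) by auto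
    then show False using four_nbs asm(2,3) p(1,2) by blast
  qed
  have "\<exists>y\<in>Y. y \<notin> S x c" if "c \<in> nb x" for c
  proof (rule ccontr)
    assume "\<not> ?thesis"
    then have "Y \<subseteq> S x c" by auto
    then have "card Y \<le> card (S x c)" using card_S[OF that] by (auto intro: card_mono)
    then show False using card_S[OF that] Y(2) by simp
  qed
  then obtain f where f: "\<And>c. c \<in> nb x \<Longrightarrow> f c \<in> Y \<and> f c \<notin> S x c" by metis
  have inj: "inj_on f (nb x)"
    by (rule inj_onI) (metis f miss)
  have c3: "card (nb x) = 3"
  proof (rule ccontr)
    assume "card (nb x) \<noteq> 3"
    then have c2: "card (nb x) \<le> 2" using deg_le[of x] by simp
    have all: "y \<in> S x c" if asm: "y \<in> Y" "c \<in> nb x" for y c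
    proof -
      obtain p p' where p: "p \<in> nb x" "p' \<in> nb x" "p \<noteq> p'" "y \<in> S x p" "y \<in> S x p'"
        using two_branches[OF x, of y] asm Y by blast
      have "{p, p'} = nb x"
        using p c2 by (intro card_seteq) (auto simp: finite_nb)
      then show ?thesis using p that by auto
    qed
    obtain c where c: "c \<in> nb x" using Y unfolding Q_def by fastforce
    then show False using f all by blast
  qed
  have "f ` nb x = Y"
    using inj c3 Y(2) f finY by (intro card_subset_eq) (auto simp: card_image)
  then have bij: "bij_betw f (nb x) Y" using inj by (simp add: bij_betw_def)
  define a where "a = inv_into (nb x) f"
  have bija: "bij_betw a Y (nb x)" unfolding a_def by (rule bij_betw_inv_into[OF bij])
  have fa: "f (a y) = y" "a y \<in> nb x" if "y \<in> Y" for y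
    using that bij_betw_inv_into_right[OF bij that] bija by (auto simp: a_def bij_betw_def)
  have Sa: "S x (a y) = Y - {y}" if y: "y \<in> Y" for y
  proof -
    have sub: "Y - {y} \<subseteq> S x (a y)"
    proof
      fix y' assume y': "y' \<in> Y - {y}"
      then have "a y' \<noteq> a y" "a y' \<in> nb x" "y' \<notin> S x (a y')" using fa y f by (metis DiffD1 DiffD2 singletonI)+
      then show "y' \<in> S x (a y)" using miss[of y' "a y'" "a y"] fa y y' by blast
    qed
    have "card (Y - {y}) = 2" using Y(2) y finY by simp
    then have "Y - {y} = S x (a y)" using sub card_S[of "a y" x] fa y by (intro card_seteq) auto
    then show ?thesis by simp
  qed
  have aJ: "a y \<in> J" if y: "y \<in> Y" for y
  proof (rule nb_cases[OF fa(2)[OF y]])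
    assume "a y \<in> I"
    then have "S x (a y) = {a y}" by (rule S_I)
    moreover have "card (S x (a y)) = 2" using Sa[OF y] Y(2) y finY by simp
    ultimately show ?thesis by simp
  qed
  have nbm: "nb (mate (a y)) = insert (a y) (Y - {y})" if y: "y \<in> Y" for y
  proof -
    have "Y - {y} = nb (mate (a y)) - {a y, x}" using Sa[OF y] S_J[OF aJ[OF y]] by simp
    moreover have "a y \<in> nb (mate (a y))" using nb_mate aJ y by blast
    ultimately have "insert (a y) (Y - {y}) \<subseteq> nb (mate (a y))" by blast
    moreover have "a y \<notin> Y" using aJ[OF y] Y(1) Q_subset[of x] disj by blast
    then have "card (insert (a y) (Y - {y})) = 3" using Y(2) y finY by simp
    ultimately have "insert (a y) (Y - {y}) = nb (mate (a y))"
      using deg_le finite_nb by (intro card_seteq) auto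
    then show ?thesis by simp
  qed
  have "Q x = Y"
  proof
    show "Q x \<subseteq> Y"
    proof
      fix v assume "v \<in> Q x"
      then obtain c where c: "c \<in> nb x" "v \<in> S x c" by (auto simp: Q_def)
      then obtain y where "y \<in> Y" "c = a y" using bija by (auto simp: bij_betw_def)
      then show "v \<in> Y" using Sa c by auto
    qed
  qed (rule Y(1))
  moreover have "inj_on a Y" "a ` Y = nb x" using bija by (auto simp: bij_betw_def)
  ultimately show ?thesis using Sa aJ nbm by (intro exI[of _ a] conjI ballI) auto
qed

text \<open>The picture is the cube: \<open>x\<close>, its three neighbours \<open>Y\<close>, the
  vertices \<open>Z\<close> at distance two and at most one antipode are the uncovered vertices, and
  matching edges play the role of faces, each end being adjacent to one diagonal pair of the face.
  This gives at most 1 + 3 + 3 + 1 uncovered and 2 * 6 covered vertices, too few for the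
  order.\<close>

lemma card_Q_le_2:
  assumes x: "x \<in> I"
  shows "card (Q x) \<le> 2"
proof (rule ccontr)
  assume "\<not> card (Q x) \<le> 2"
  then obtain Y where Y: "Y \<subseteq> Q x" "card Y = 3"
    by (metis linorder_not_less not_less_eq_eq numeral_2_eq_2 numeral_3_eq_3 obtain_subset_with_card_n)
  from three_nbs[OF x Y] obtain a where a0: "inj_on a Y \<and> a ` Y = nb x \<and> Q x = Y \<and>
    (\<forall>y\<in>Y. a y \<in> J \<and> S x (a y) = Y - {y} \<and> nb (mate (a y)) = insert (a y) (Y - {y}))" ..
  then have a: "inj_on a Y" "a ` Y = nb x" "Q x = Y" by simp_all
  have aJ: "a y \<in> J" and Sa: "S x (a y) = Y - {y}" and nbm: "nb (mate (a y)) = insert (a y) (Y - {y})"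
    if "y \<in> Y" for y using a0 that by simp_all
  have finY: "finite Y" using Y(2) card.infinite by fastforce
  have YI: "Y \<subseteq> I" "x \<notin> Y" using Y(1) Q_subset by blast+
  \<comment> \<open>The matching edge \<open>a y\<close>, \<open>mate (a y)\<close> is a face
    through \<open>x\<close>. Its end in \<open>Bs\<close> sees the two vertices of \<open>Y\<close>
    on that face, and \<open>Zf y\<close> contains at most the corner opposite to
    \<open>x\<close>.\<close>
  define Bs where "Bs = (\<lambda>y. mate (a y)) ` Y"
  define Zf where "Zf y = nb (a y) - {mate (a y), x}" for y
  define Z where "Z = \<Union> (Zf ` Y)"
  have xa: "x \<in> nb (a y)" if "y \<in> Y" for y using a(2) that nb_sym by blast
  have cardZf: "card (Zf y) \<le> 1" if y: "y \<in> Y" for y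
  proof -
    have "mate (a y) \<noteq> x" using mate_J[OF aJ[OF y]] x disj by blast
    then have "card {mate (a y), x} = 2" by simp
    moreover have "{mate (a y), x} \<subseteq> nb (a y)" using xa[OF y] mate_nb[OF aJ[OF y]] by auto
    ultimately show ?thesis using deg_le[of "a y"] finite_nb
      by (simp add: Zf_def card_Diff_subset)
  qed
  have cardZ: "card Z \<le> 3"
  proof -
    have "card Z \<le> (\<Sum>y\<in>Y. card (Zf y))" unfolding Z_def by (rule card_UN_le[OF finY])
    also have "\<dots> \<le> (\<Sum>y\<in>Y. 1)" using cardZf by (intro sum_mono) auto
    finally show ?thesis using Y(2) by simp
  qed
  have ZI: "Z \<subseteq> I" using J_nb aJ by (fastforce simp: Z_def Zf_def)
  have injB: "inj_on (\<lambda>y. mate (a y)) Y"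
    by (rule inj_onI) (metis a(1) aJ mate_mate inj_onD)
  have cardB: "card Bs = 3" using card_image[OF injB] Y(2) by (simp add: Bs_def)
  have B_nb: "mate (a y') \<in> nb y" if "y \<in> Y" "y' \<in> Y" "y \<noteq> y'" for y y'
    using nbm[OF that(2)] that nb_sym by blast
  have card_out: "card (nb y - Bs) \<le> 1" if y: "y \<in> Y" for y
  proof -
    have sub: "(\<lambda>y. mate (a y)) ` (Y - {y}) \<subseteq> nb y" using B_nb y by auto
    have "card ((\<lambda>y. mate (a y)) ` (Y - {y})) = 2"
      using card_image[OF inj_on_subset[OF injB]] Y(2) y finY by simp
    then have "card (nb y - (\<lambda>y. mate (a y)) ` (Y - {y})) \<le> 1"
      using sub deg_le[of y] finite_nb finY by (simp add: card_Diff_subset)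
    moreover have "card (nb y - Bs) \<le> card (nb y - (\<lambda>y. mate (a y)) ` (Y - {y}))"
      by (rule card_mono) (auto simp: Bs_def finite_nb)
    ultimately show ?thesis by simp
  qed
  \<comment> \<open>Each \<open>y\<close> has two neighbours in \<open>Bs\<close> and thus at most
    one outside, so one of its two links to \<open>v\<close> starts in \<open>Bs\<close>. Such a
    link continues through some \<open>a y'\<close> and ends in \<open>x\<close> or
    \<open>Z\<close>.\<close>
  have QY: "Q y \<subseteq> insert x Z" if y: "y \<in> Y" for y
  proof
    fix v assume "v \<in> Q y"
    then obtain p p' where p: "p \<in> nb y" "p' \<in> nb y" "p \<noteq> p'" "v \<in> S y p" "v \<in> S y p'"
      using two_branches[of y v] y YI by blast
    have "p \<in> Bs \<or> p' \<in> Bs"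
    proof (rule ccontr)
      assume "\<not> ?thesis"
      then have "{p, p'} \<subseteq> nb y - Bs" using p by auto
      then have "card {p, p'} \<le> card (nb y - Bs)" by (intro card_mono) (auto simp: finite_nb)
      then show False using card_out[OF y] p(3) by simp
    qed
    then obtain y' where y': "y' \<in> Y" "v \<in> S y (mate (a y'))" using p by (auto simp: Bs_def)
    then have "v \<in> nb (a y') - {mate (a y')}"
      using S_J[OF mate_J[OF aJ]] mate_mate[OF aJ] by auto
    then show "v \<in> insert x Z" using y' by (auto simp: Z_def Zf_def)
  qed
  define R where "R = insert x (Y \<union> Z)"
  text \<open>A vertex of \<open>Z\<close> with a link leaving \<open>Y\<close> is itself linked to three vertices.\<close>
  have exposed: "nb z \<subseteq> J \<and> (\<forall>p\<in>nb z. nb (mate p) \<inter> Y \<noteq> {}) \<and> (v \<notin> R \<longrightarrow> Q v \<subseteq> R)"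
    if z: "z \<in> Z" "z \<notin> Y" and v: "v \<in> Q z" "v \<notin> Y" for z v
  proof -
    obtain y where y: "y \<in> Y" "z \<in> nb (a y)" "z \<noteq> mate (a y)" using z by (auto simp: Z_def Zf_def)
    have zI: "z \<in> I" using z ZI by auto
    have vI: "v \<in> I" using Q_I v zI by blast
    have ay: "a y \<notin> Y" using aJ[OF y(1)] YI disj by blast
    have "S z (a y) = Y - {y}" using S_J[OF aJ[OF y(1)]] nbm[OF y(1)] z ay by auto
    moreover have "a y \<in> nb z" using y nb_sym by blast
    ultimately have "Y - {y} \<subseteq> Q z" by (auto simp: Q_def)
    then have sub: "insert v (Y - {y}) \<subseteq> Q z" using v by auto
    define Y' where "Y' = insert v (Y - {y})"
    have sub': "Y' \<subseteq> Q z" and c3: "card Y' = 3"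
      using sub v y finY Y(2) by (simp_all add: Y'_def)
    from three_nbs[OF zI sub' c3] obtain a' where a': "inj_on a' Y' \<and> a' ` Y' = nb z \<and> Q z = Y' \<and>
      (\<forall>y'\<in>Y'. a' y' \<in> J \<and> S z (a' y') = Y' - {y'} \<and> nb (mate (a' y')) = insert (a' y') (Y' - {y'}))" ..
    then have inj': "inj_on a' Y'" and im': "a' ` Y' = nb z" by simp_all
    have a'J: "a' y' \<in> J" and nbm': "nb (mate (a' y')) = insert (a' y') (Y' - {y'})"
      if "y' \<in> Y'" for y' using a' that by simp_all
    have "card (Y - {y}) = 2" using Y(2) y finY by simp
    then obtain y1 y2 where y12: "Y - {y} = {y1, y2}" "y1 \<noteq> y2" by (auto simp: card_2_iff)
    have y12in: "y1 \<in> Y'" "y2 \<in> Y'" "y1 \<noteq> v" "y2 \<noteq> v" "y1 \<in> Y" "y2 \<in> Y"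
      using y12 v by (auto simp: Y'_def)
    have "nb z \<subseteq> J" unfolding im'[symmetric] using a'J by (rule image_subsetI)
    moreover have "nb (mate p) \<inter> Y \<noteq> {}" if p: "p \<in> nb z" for p
    proof -
      from p have "p \<in> a' ` Y'" by (simp add: im')
      then obtain y' where y': "y' \<in> Y'" "p = a' y'" by (elim imageE)
      have "y1 \<in> nb (mate p) \<or> y2 \<in> nb (mate p)"
        unfolding y'(2) nbm'[OF y'(1)] using y12in y12(2) by (cases "y' = y1") simp_all
      then show ?thesis using y12in by auto
    qed
    moreover have "Q v \<subseteq> R" if vR: "v \<notin> R"
    proof
      fix w assume w: "w \<in> Q v"
      obtain p p' where p: "p \<in> nb v" "p' \<in> nb v" "p \<noteq> p'" "w \<in> S v p" "w \<in> S v p'"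
        using two_branches[OF vI w] by blast
      define b where "b y' = mate (a' y')" for y'
      have bn: "b y1 \<noteq> b y2"
      proof
        assume "b y1 = b y2"
        then have "a' y1 = a' y2"
          using mate_mate[OF a'J[OF y12in(1)]] mate_mate[OF a'J[OF y12in(2)]] unfolding b_def by metis
        then show False using inj_onD[OF inj' _ y12in(1,2)] y12(2) by simp
      qed
      have vY': "v \<in> Y'" by (simp add: Y'_def)
      have "v \<in> nb (b y1)" "v \<in> nb (b y2)"
        unfolding b_def nbm'[OF y12in(1)] nbm'[OF y12in(2)] using y12in(3,4) vY' by auto
      then have bv: "b y1 \<in> nb v" "b y2 \<in> nb v" using nb_sym by blast+
      \<comment> \<open>Two of the at most three neighbours of \<open>v\<close> are
        \<open>b y1\<close> and \<open>b y2\<close>, so two different links from \<open>v\<close> to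
        \<open>w\<close> cannot both avoid them.\<close>
      have "\<exists>y'\<in>{y1, y2}. w \<in> S v (b y')"
      proof (rule ccontr)
        assume a: "\<not> ?thesis"
        then have "distinct [b y1, b y2, p, p']" using p(3-5) bn by auto
        then show False using four_nbs[OF _ bv p(1,2)] by blast
      qed
      then obtain y' y'' where y': "y' = y1 \<and> y'' = y2 \<or> y' = y2 \<and> y'' = y1" "y' \<noteq> y''" "w \<in> S v (b y')"
        using y12(2) by auto
      have y'in: "y' \<in> Y'" "y'' \<in> Y" "y'' \<in> Y'" "y'' \<noteq> y'" using y'(1,2) y12in by auto
      have bJ: "b y' \<in> J" using a'J[OF y'in(1)] mate_J by (simp add: b_def)
      have y''b: "y'' \<in> nb (b y')"
        using nbm'[OF y'in(1)] y'in by (simp add: b_def)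
      have "w \<in> nb (mate (b y'))" using y'(3) S_J[OF bJ] by auto
      then have "w = y'' \<or> w \<in> Q y''"
        using Q_link(2)[OF bJ y''b, of w] y'in YI Q_I[OF vI w] by blast
      then show "w \<in> R" using QY y'in by (auto simp: R_def)
    qed
    ultimately show ?thesis by blast
  qed
  have RI: "R \<subseteq> I" using x YI ZI by (auto simp: R_def)
  \<comment> \<open>The set is closed under links: those of \<open>x\<close> and \<open>Y\<close>
    stay in \<open>R\<close>, those of \<open>Z\<close> are included by definition, and a vertex
    outside \<open>R\<close> has all its links back into \<open>R\<close> by
    \<open>exposed\<close>.\<close>
  have I_eq: "R \<union> (\<Union>z\<in>Z - Y. Q z) = I"
  proof (rule Q_conn)
    show "R \<union> (\<Union>z\<in>Z - Y. Q z) \<subseteq> I" using RI ZI Q_I by blast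
    fix u assume u: "u \<in> R \<union> (\<Union>z\<in>Z - Y. Q z)"
    show "Q u \<subseteq> R \<union> (\<Union>z\<in>Z - Y. Q z)"
    proof (cases "u \<in> R")
      case True
      then show ?thesis using a(3) QY by (auto simp: R_def)
    next
      case False
      then obtain z where "z \<in> Z" "z \<notin> Y" "u \<in> Q z" "u \<notin> Y" using u by (auto simp: R_def)
      then show ?thesis using exposed[of z u] False by blast
    qed
  qed (auto simp: R_def)
  have Q_T: "Q t \<subseteq> Z - Y - {x}" if t: "t \<in> I" "t \<notin> R" for t
  proof -
    obtain z where "z \<in> Z" "z \<notin> Y" "t \<in> Q z" "t \<notin> Y" using t I_eq by (auto simp: R_def)
    then have "Q t \<subseteq> R" using exposed t by blast
    moreover have "w \<notin> Y" if "w \<in> Q t" for w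
      using Q_sym[OF t(1) that] QY[of w] t by (auto simp: R_def)
    moreover have "x \<notin> Q t" using Q_sym[OF t(1)] a(3) t by (auto simp: R_def)
    ultimately show ?thesis by (auto simp: R_def)
  qed
  have touch1: "nb (mate p) \<inter> Y \<noteq> {}"
    if "u \<in> nb p" "v \<in> Q u" "u \<in> insert x (Z - Y)" "v \<notin> Y" for p u v
  proof -
    have pu: "p \<in> nb u" using that nb_sym by blast
    show ?thesis
    proof (cases "u = x")
      case True then show ?thesis using that a(3) by auto
    next
      case False then show ?thesis using that exposed pu by blast
    qed
  qed
  \<comment> \<open>A matching edge avoiding the neighbourhood of \<open>Y\<close> carries a link
    with both ends outside \<open>Y\<close>. One of these ends is \<open>x\<close> or an exposed
    vertex of \<open>Z\<close>, and every branch there touches \<open>Y\<close>. Consequently the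
    covered vertices lie in \<open>N\<close> and its mates, where \<open>N\<close> has the three
    elements of \<open>Bs\<close> and at most one more for each vertex of \<open>Y\<close>.\<close>
  have touch: "(nb p \<union> nb (mate p)) \<inter> Y \<noteq> {}" if p: "p \<in> J" for p
  proof (rule ccontr)
    assume no: "\<not> ?thesis"
    obtain u v where uv: "u \<in> nb p" "v \<in> nb (mate p)" "u \<noteq> v" "u \<in> I" "v \<in> I" "v \<in> Q u" "u \<in> Q v"
      using link_exists[OF p] by metis
    have nY: "u \<notin> Y" "v \<notin> Y" using uv no by auto
    have "u \<in> insert x (Z - Y) \<or> v \<in> insert x (Z - Y)"
      using Q_T[of u] uv nY by (auto simp: R_def)
    then show False
    proof
      assume "u \<in> insert x (Z - Y)"
      then show False using touch1[OF uv(1) uv(6)] nY no by blast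
    next
      assume "v \<in> insert x (Z - Y)"
      then show False using touch1[OF uv(2) uv(7)] nY no mate_mate[OF p] by auto
    qed
  qed
  define N where "N = \<Union> (nb ` Y)"
  have finN: "finite N" using finY finite_nb by (auto simp: N_def)
  have cardNB: "card (N - Bs) \<le> 3"
  proof -
    have "N - Bs = (\<Union>y\<in>Y. nb y - Bs)" by (auto simp: N_def)
    then have "card (N - Bs) \<le> (\<Sum>y\<in>Y. card (nb y - Bs))" using card_UN_le[OF finY] by metis
    also have "\<dots> \<le> (\<Sum>y\<in>Y. 1)" using card_out by (intro sum_mono) auto
    finally show ?thesis using Y(2) by simp
  qed
  have finB: "finite Bs" using finY by (auto simp: Bs_def)
  have "card N \<le> card (Bs \<union> (N - Bs))" using finN finB by (intro card_mono) auto
  then have cardN: "card N \<le> 6" using card_Un_le[of Bs "N - Bs"] cardB cardNB by linarith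
  have "J \<subseteq> N \<union> mate ` N"
  proof
    fix p assume p: "p \<in> J"
    then have "p \<in> N \<or> mate p \<in> N" using touch[OF p] nb_sym by (fastforce simp: N_def)
    then show "p \<in> N \<union> mate ` N" using mate_mate[OF p] by (metis UnI1 UnI2 imageI)
  qed
  then have "card J \<le> card (N \<union> mate ` N)" using finN by (intro card_mono) auto
  also have "\<dots> \<le> 12" using card_Un_le[of N "mate ` N"] card_image_le[OF finN, of mate] cardN by linarith
  finally have cardJ: "card J \<le> 12" .
  have T_nb: "nb t \<subseteq> N - Bs \<and> (\<forall>p\<in>nb t. p \<in> J \<and> nb p \<inter> Y \<noteq> {})" if t: "t \<in> I" "t \<notin> R" for t
  proof -
    have *: "p \<in> J \<and> nb p \<inter> Y \<noteq> {} \<and> p \<notin> Bs" if p: "p \<in> nb t" for p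
    proof -
      have pJ: "p \<in> J"
      proof (rule nb_cases[OF p])
        assume pI: "p \<in> I"
        then have "p \<in> Q t" using Q_direct p by blast
        then have "p \<in> Z" "p \<notin> Y" "t \<in> Q p" using Q_T t Q_sym by blast+
        then have "nb p \<subseteq> J" using exposed t by (auto simp: R_def)
        then show ?thesis using p nb_sym t disj by blast
      qed
      have "nb (mate p) \<inter> Y = {}"
      proof (rule ccontr)
        assume "\<not> ?thesis"
        then obtain y where y: "y \<in> nb (mate p)" "y \<in> Y" by auto
        then have "y \<in> Q t" using Q_link(2)[OF pJ, of t y] nb_sym p t YI by (auto simp: R_def)
        then show False using Q_T t y by blast
      qed
      moreover have "p \<notin> Bs"
      proof
        assume "p \<in> Bs"
        then obtain y where y: "y \<in> Y" "p = mate (a y)" by (auto simp: Bs_def)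
        have "t \<in> nb p" using p nb_sym by blast
        then have "t \<in> Y \<or> t = a y" using nbm[OF y(1)] y by auto
        then show False using t aJ[OF y(1)] disj by (auto simp: R_def)
      qed
      ultimately show ?thesis using touch[OF pJ] pJ by blast
    qed
    then show ?thesis using nb_sym by (fastforce simp: N_def)
  qed
  \<comment> \<open>Two vertices outside \<open>R\<close> would have disjoint neighbourhoods of size
    at least 2 in \<open>N - Bs\<close>, which has at most 3 elements. They are disjoint because a
    common neighbour would also be adjacent to its mate and to a vertex of \<open>Y\<close>.\<close>
  have "card (I - R) \<le> 1"
  proof (rule ccontr)
    assume "\<not> ?thesis"
    then have "\<not> card (I - R) \<le> Suc 0" by simp
    then obtain t t' where t: "t \<in> I - R" "t' \<in> I - R" "t \<noteq> t'"
      using card_le_Suc0_iff_eq[of "I - R"] fin Vs_eq by auto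
    have "nb t \<inter> nb t' = {}"
    proof (rule ccontr)
      assume "\<not> ?thesis"
      then obtain p where p: "p \<in> nb t" "p \<in> nb t'" by auto
      then obtain y where y: "y \<in> nb p" "y \<in> Y" "p \<in> J" using T_nb[of t] t by blast
      have mp: "mate p \<in> J" "mate p \<in> nb p" using mate_J mate_nb y by auto
      have "distinct [mate p, y, t, t']" using mp disj y YI t by (auto simp: R_def)
      moreover have "t \<in> nb p" "t' \<in> nb p" using p nb_sym by blast+
      ultimately show False using four_nbs mp(2) y(1) by blast
    qed
    then have "card (nb t \<union> nb t') = card (nb t) + card (nb t')"
      by (intro card_Un_disjoint finite_nb)
    moreover have "card (nb t \<union> nb t') \<le> card (N - Bs)"
      using T_nb t finN by (intro card_mono) auto
    moreover have "2 \<le> card (nb t)" "2 \<le> card (nb t')" using deg_ge t Vs_eq by auto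
    ultimately show False using cardNB by linarith
  qed
  moreover have "card R \<le> 7"
  proof -
    have "finite R" using RI fin Vs_eq finite_subset by auto
    moreover have "card (Y \<union> Z) \<le> 6" using card_Un_le[of Y Z] Y(2) cardZ by linarith
    ultimately show ?thesis by (simp add: R_def card_insert_if)
  qed
  moreover have "card I \<le> card R + card (I - R)"
    using card_Un_le[of R "I - R"] RI by (simp add: Un_absorb1)
  ultimately show False using order order_le(1) cardJ by linarith
qed

end

section \<open>Vertices linked to exactly two others\<close>

context linked_graph
begin

lemma Q_eq:
  assumes "u \<in> I" "a \<in> Q u" "b \<in> Q u" "a \<noteq> b"
  shows "Q u = {a, b}"
proof -
  have "finite (Q u)" using Q_subset fin Vs_eq by (meson finite_Diff finite_Un finite_subset)
  moreover have "card (Q u) \<le> card {a, b}" using card_Q_le_2[OF assms(1)] assms(4) by simp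
  ultimately have "{a, b} = Q u" using assms by (intro card_seteq) auto
  then show ?thesis by simp
qed

text \<open>The link graph is connected on at least six vertices; the degenerate cases below all
  produce a closed set of at most four.\<close>

lemma small_closed:
  assumes "u \<in> I" "l \<in> I" "r \<in> I" "z \<in> I"
    and "\<And>v. v \<in> {u, l, r, z} \<Longrightarrow> Q v \<subseteq> {u, l, r, z}"
  shows False
proof -
  have "{u, l, r, z} = I" by (rule Q_conn) (use assms in auto)
  then have "card I \<le> 4" using card_length[of "[u, l, r, z]"] by simp
  then show False using order_le(3) by simp
qed

text \<open>The neighbour through which all links of \<open>u\<close> pass; it becomes the vertex
  \<open>W i\<close> of the column of \<open>u\<close>. For a vertex with two links it exists and is
  unique by \<open>interior\<close> and \<open>full_unique\<close>.\<close>

definition hub :: "'a \<Rightarrow> 'a" where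
  "hub u = (SOME w. w \<in> nb u \<and> S u w = Q u)"

abbreviation far :: "'a \<Rightarrow> 'a" where
  "far u \<equiv> mate (hub u)"

context
  fixes u l r
  assumes u: "u \<in> I" and Qu: "Q u = {l, r}" and lr: "l \<noteq> r"
begin

lemma lr_facts: "l \<in> I" "r \<in> I" "l \<noteq> u" "r \<noteq> u" "u \<in> Q l" "u \<in> Q r"
  using Qu Q_subset[of u] Q_sym[OF u] by auto

text \<open>A further neighbour \<open>z\<close> of \<open>w\<close> would be linked to
  \<open>l\<close> and \<open>r\<close> through the same matching edge. Since each vertex has at
  most two links, this closes the set of \<open>u\<close>, \<open>l\<close>, \<open>r\<close>,
  \<open>z\<close>, contradicting \<open>small_closed\<close>.\<close>

lemma full_branch:
  assumes w: "w \<in> nb u" "S u w = {l, r}"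
  shows "w \<in> J" "nb w = {u, mate w}" "nb (mate w) = {w, l, r}"
proof -
  show wJ: "w \<in> J"
  proof (rule nb_cases[OF w(1)])
    assume "w \<in> I"
    then have "{l, r} = {w}" using S_I[of w u] unfolding w(2) by blast
    then have "l = w" "r = w" by blast+
    then show ?thesis using lr by simp
  qed
  have eq: "nb (mate w) - {w, u} = {l, r}" using S_J[OF wJ, of u] w(2) by simp
  have ww: "w \<in> nb (mate w)" using nb_mate[OF wJ] .
  have wI: "w \<notin> I" using wJ disj by auto
  have un: "u \<notin> nb (mate w)"
  proof
    assume a: "u \<in> nb (mate w)"
    have "distinct [w, u, l, r]" using wI u lr_facts(1-4) lr by auto
    moreover have "l \<in> nb (mate w)" "r \<in> nb (mate w)" using eq by blast+
    ultimately show False using four_nbs[OF _ ww a] by blast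
  qed
  have "nb (mate w) = insert w (nb (mate w) - {w, u})" using ww un by blast
  then show nbm: "nb (mate w) = {w, l, r}" unfolding eq .
  have "z \<in> {u, mate w}" if z: "z \<in> nb w" for z
  proof (rule ccontr)
    assume nz: "z \<notin> {u, mate w}"
    then have zI: "z \<in> I" using J_nb[OF wJ z] by simp
    have lnk: "v \<in> Q z" if v: "v \<in> {l, r}" "v \<noteq> z" for v
    proof -
      have "v \<in> nb (mate w)" "v \<in> I" using v(1) lr_facts(1,2) nbm by auto
      then show ?thesis using Q_link(2)[OF wJ z zI _ v(2)] by simp
    qed
    show False
    proof (cases "z \<in> {l, r}")
      case True
      have rl: "r \<in> Q l"
      proof (cases "z = l")
        case True then show ?thesis using lnk[of r] lr by simp
      next
        case False
        then have "z = r" using \<open>z \<in> {l, r}\<close> by simp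
        then show ?thesis using lnk[of l] lr Q_sym[OF lr_facts(2)] by simp
      qed
      have "Q l = {u, r}" using Q_eq[OF lr_facts(1,5) rl] lr_facts(4) by simp
      moreover have "Q r = {u, l}"
        using Q_eq[OF lr_facts(2,6) Q_sym[OF lr_facts(1) rl]] lr_facts(3) by simp
      ultimately show False by (intro small_closed[of u l r r]) (use u lr_facts(1,2) Qu in auto)
    next
      case False
      then have z: "l \<in> Q z" "r \<in> Q z" using lnk[of l] lnk[of r] by auto
      have "Q z = {l, r}" using Q_eq[OF zI z lr] .
      moreover have "Q l = {u, z}" using Q_eq[OF lr_facts(1,5) Q_sym[OF zI z(1)]] nz by blast
      moreover have "Q r = {u, z}" using Q_eq[OF lr_facts(2,6) Q_sym[OF zI z(2)]] nz by blast
      ultimately show False by (intro small_closed[of u l r z]) (use u lr_facts(1,2) zI Qu in auto)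
    qed
  qed
  moreover have "u \<in> nb w" "mate w \<in> nb w" using nb_sym[OF w(1)] mate_nb[OF wJ] by simp_all
  ultimately show "nb w = {u, mate w}" by blast
qed

text \<open>With two such neighbours of \<open>u\<close>, both their mates are adjacent to
  \<open>l\<close> and to \<open>r\<close>, and from there they lead back to \<open>u\<close> only.
  At most one neighbour of \<open>l\<close> remains, so every double link of \<open>l\<close> uses
  one of these mates and ends in \<open>u\<close>; the same holds for \<open>r\<close>, and
  \<open>u\<close>, \<open>l\<close>, \<open>r\<close> are closed under links.\<close>

lemma full_unique:
  assumes w: "w \<in> nb u" "S u w = {l, r}" and w': "w' \<in> nb u" "S u w' = {l, r}"
  shows "w = w'"
proof (rule ccontr)
  assume ne: "w \<noteq> w'"
  note f = full_branch[OF w] full_branch[OF w']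
  have bn: "mate w \<noteq> mate w'" using ne mate_mate[OF f(1)] mate_mate[OF f(4)] by metis
  have Qv: "Q v = {u}" if v: "v \<in> {l, r}" for v
  proof -
    have vI: "v \<in> I" "v \<noteq> u" using v lr_facts by auto
    have "v \<in> nb (mate w)" "v \<in> nb (mate w')" using f(3,6) v by auto
    then have bv: "mate w \<in> nb v" "mate w' \<in> nb v" using nb_sym by blast+
    have Sb: "S v (mate w) = {u}" if w: "w \<in> nb u" "S u w = {l, r}" for w
    proof -
      note f = full_branch[OF w]
      have mJ: "mate w \<in> J" by (rule mate_J[OF f(1)])
      have "S v (mate w) = {u, mate w} - {mate w, v}"
        unfolding S_J[OF mJ] mate_mate[OF f(1)] f(2) ..
      also have "\<dots> = {u}" using vI(2) u mJ disj by blast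
      finally show ?thesis .
    qed
    note Sb = Sb[OF w] Sb[OF w']
    have "x = u" if xQ: "x \<in> Q v" for x
    proof -
      obtain p p' where p: "p \<in> nb v" "p' \<in> nb v" "p \<noteq> p'" "x \<in> S v p" "x \<in> S v p'"
        using two_branches[OF vI(1) xQ] by blast
      have "mate w \<in> {p, p'} \<or> mate w' \<in> {p, p'}"
      proof (rule ccontr)
        assume "\<not> ?thesis"
        then have "distinct [mate w, mate w', p, p']" using bn p(3) by simp
        then show False by (rule four_nbs[OF _ bv p(1,2)])
      qed
      then have "x \<in> S v (mate w) \<or> x \<in> S v (mate w')" using p(4,5) by blast
      then show ?thesis unfolding Sb by blast
    qed
    moreover have "u \<in> Q v" using v lr_facts(5,6) by auto
    ultimately show ?thesis by blast
  qed
  show False by (rule small_closed[of u l r r]) (use u lr_facts(1,2) Qu Qv[of l] Qv[of r] in auto)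
qed

text \<open>Both \<open>l\<close> and \<open>r\<close> need two of the at most three branches at
  \<open>u\<close>, so some branch contains both. Uniqueness of that branch makes the other two
  singletons and forces degree three.\<close>

lemma interior:
  shows "\<exists>p q. nb u = {hub u, p, q} \<and> distinct [hub u, p, q] \<and> S u p = {l} \<and> S u q = {r}"
    and hub_nb: "hub u \<in> nb u" and hub_S: "S u (hub u) = {l, r}"
    and hub_J: "hub u \<in> J" and nb_hub: "nb (hub u) = {u, far u}" and nb_far: "nb (far u) = {hub u, l, r}"
proof -
  obtain p p' where p: "p \<in> nb u" "p' \<in> nb u" "p \<noteq> p'" "l \<in> S u p" "l \<in> S u p'"
    using two_branches[OF u, of l] Qu by blast
  obtain q q' where q: "q \<in> nb u" "q' \<in> nb u" "q \<noteq> q'" "r \<in> S u q" "r \<in> S u q'"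
    using two_branches[OF u, of r] Qu by blast
  have sub: "S u x \<subseteq> {l, r}" if "x \<in> nb u" for x using that Qu by (auto simp: Q_def)
  have "\<not> distinct [p, p', q, q']" using four_nbs[OF _ p(1,2) q(1,2)] by blast
  then have "\<exists>w\<in>{p, p'}. w \<in> {q, q'}" using p q by auto
  then have ex: "\<exists>w p q. w \<in> nb u \<and> p \<in> nb u \<and> q \<in> nb u \<and> p \<noteq> w \<and> q \<noteq> w \<and>
      l \<in> S u w \<and> r \<in> S u w \<and> l \<in> S u p \<and> r \<in> S u q"
    using p q by (elim bexE insertE emptyE) metis+
  then obtain w p q where w: "w \<in> nb u" "p \<in> nb u" "q \<in> nb u" "p \<noteq> w" "q \<noteq> w"
      "l \<in> S u w" "r \<in> S u w" "l \<in> S u p" "r \<in> S u q" by blast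
  have Sw: "S u w = {l, r}" using sub w by blast
  have "hub u \<in> nb u \<and> S u (hub u) = Q u"
    unfolding hub_def by (rule someI[of _ w]) (use w Sw Qu in auto)
  then show Wf: "hub u \<in> nb u" "S u (hub u) = {l, r}" using Qu by auto
  have wW: "w = hub u" using full_unique w Sw Wf by blast
  show "hub u \<in> J" "nb (hub u) = {u, far u}" "nb (far u) = {hub u, l, r}" using full_branch[OF Wf] by auto
  have "S u p \<noteq> {l, r}" "S u q \<noteq> {l, r}" using full_unique w Sw by blast+
  then have Spq: "S u p = {l}" "S u q = {r}" using sub w by blast+
  then have d: "distinct [hub u, p, q]" using w wW lr by auto
  have "{hub u, p, q} = nb u"
  proof (rule card_seteq)
    show "card (nb u) \<le> card {hub u, p, q}" using d deg_le[of u] distinct_card[OF d] by simp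
  qed (use w wW finite_nb in auto)
  then show "\<exists>p q. nb u = {hub u, p, q} \<and> distinct [hub u, p, q] \<and> S u p = {l} \<and> S u q = {r}"
    using d Spq by metis
qed

end

lemma pair_diff: "x \<noteq> y \<Longrightarrow> x \<noteq> z \<Longrightarrow> {x, y} - {y, z} = {x}"
  by auto

text \<open>Being linked to \<open>r\<close>, the vertex \<open>u\<close> is adjacent to
  \<open>far r\<close>. The hub of \<open>r\<close> has no neighbours besides \<open>r\<close> and
  \<open>far r\<close>, so the branch of \<open>u\<close> at \<open>far r\<close> is exactly
  \<open>r\<close>, and only \<open>q\<close> fits.\<close>

lemma next_column:
  assumes u: "u \<in> I" "Q u = {l, r}" "l \<noteq> r" and r: "card (Q r) = 2"
    and nbu: "nb u = {hub u, p, q}" "S u p = {l}" "S u q = {r}"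
  shows "q = far r"
proof -
  note f = lr_facts[OF u] interior[OF u]
  obtain a b where ab: "Q r = {a, b}" "a \<noteq> b" using r by (auto simp: card_2_iff)
  note g = interior[OF f(2) ab]
  have "u \<in> {a, b}" using f(6) unfolding ab(1) .
  then have "u \<in> nb (far r)" unfolding g(6) by blast
  then have Bu: "far r \<in> nb u" by (rule nb_sym)
  have BJ: "far r \<in> J" by (rule mate_J[OF g(4)])
  have "S u (far r) = {r, far r} - {far r, u}" unfolding S_J[OF BJ] mate_mate[OF g(4)] g(5) ..
  moreover have "r \<noteq> far r" using f(2) BJ disj by (metis disjoint_iff)
  ultimately have SB: "S u (far r) = {r}" using pair_diff f(4) by metis
  have "far r \<noteq> hub u"
  proof
    assume eq: "far r = hub u"
    have "{r} = {l, r}" using SB f(9) unfolding eq by simp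
    then show False using u(3) by blast
  qed
  moreover have "far r \<noteq> p"
  proof
    assume "far r = p"
    then have "{r} = {l}" using SB nbu(2) by simp
    then show False using u(3) by blast
  qed
  ultimately show ?thesis using Bu nbu(1) by blast
qed

lemma interior_nb:
  assumes u: "u \<in> I" "Q u = {l, r}" "l \<noteq> r" and "card (Q l) = 2" "card (Q r) = 2"
  shows "nb u = {hub u, far l, far r}"
proof -
  obtain p q where pq: "nb u = {hub u, p, q}" "S u p = {l}" "S u q = {r}" using interior(1)[OF u] by blast
  have "q = far r" by (rule next_column[OF u assms(5) pq])
  moreover have "p = far l"
    by (rule next_column[of u r l q p]) (use u pq assms in auto)
  ultimately show ?thesis using pq by simp
qed

text \<open>Here \<open>e\<close> is an end of the link path. In the first alternative
  \<open>e\<close> is the extra vertex \<open>W1'\<close> or \<open>Wk'\<close> attached to the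
  column of \<open>u\<close>. In the second it heads a column of its own with \<open>mate p\<close>
  in the middle and \<open>p\<close> on the other side; the inclusions leave open whether the edge
  between \<open>p\<close> and \<open>e\<close> is present.\<close>

lemma end_column:
  assumes u: "u \<in> I" "Q u = {e, r}" "e \<noteq> r" and r: "card (Q r) = 2" and Qe: "Q e = {u}"
  shows "\<exists>p. nb u = {hub u, p, far r} \<and>
    (p = e \<and> nb e = {far u, u} \<or>
     p \<in> J \<and> nb (mate p) = {p, e} \<and> {mate p, u} \<subseteq> nb p \<and> nb p \<subseteq> {mate p, u, e} \<and>
     {far u, mate p} \<subseteq> nb e \<and> nb e \<subseteq> {far u, mate p, p})"
proof -
  note f = lr_facts[OF u]
  obtain p q where pq: "nb u = {hub u, p, q}" "distinct [hub u, p, q]" "S u p = {e}" "S u q = {r}"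
    using interior(1)[OF u] by blast
  note g = interior(2-6)[OF u]
  have q: "q = far r" by (rule next_column[OF u r pq(1,3,4)])
  have eI: "e \<in> I" "e \<noteq> u" using f by auto
  have pu: "p \<in> nb u" using pq by auto
  have in_branch: "x = hub u \<or> x = p" if "x \<in> nb u" "e \<in> S u x" for x
    using that pq u(3) by auto
  have Be: "far u \<in> nb e" using g(5) nb_sym by blast
  \<comment> \<open>If the branch of \<open>e\<close> at \<open>c\<close> leads to \<open>u\<close>,
    then \<open>mate c\<close> is a neighbour of \<open>u\<close> whose branch contains
    \<open>e\<close>, hence \<open>hub u\<close> or \<open>p\<close>. Otherwise
    \<open>mate c\<close> sees only \<open>c\<close> and \<open>e\<close>, and unless
    \<open>c\<close> is adjacent to \<open>u\<close> the vertex \<open>e\<close> would cut off this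
    matching edge.\<close>
  have nbJ: "c = far u \<or> mate c = p \<or> c = p \<and> nb (mate c) = {c, e}" if c: "c \<in> nb e" "c \<in> J" for c
  proof -
    have cm: "mate c \<in> J" "mate (mate c) = c" "mate c \<noteq> c" using c mate_J mate_mate mate_neq by auto
    have ec: "e \<in> nb c" using nb_sym[OF c(1)] .
    have Sc: "S e c \<subseteq> {u}" using Qe c by (auto simp: Q_def)
    have SJ: "S e c = nb (mate c) - {c, e}" by (rule S_J[OF c(2)])
    show ?thesis
    proof (cases "u \<in> S e c")
      case True
      then have "mate c \<in> nb u" using SJ nb_sym by blast
      moreover have "e \<in> S u (mate c)" using S_J[OF cm(1)] cm ec eI disj by auto
      ultimately have "mate c = hub u \<or> mate c = p" using in_branch by blast
      then show ?thesis using cm by metis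
    next
      case False
      then have sub: "nb (mate c) \<subseteq> {c, e}" using Sc SJ by blast
      have cV: "c \<in> Vs" "mate c \<in> Vs" using c cm Vs_eq by auto
      have "card (nb (mate c)) \<ge> card {c, e}" using deg_ge[OF cV(2)] card_length[of "[c, e]"] by simp
      then have eq: "nb (mate c) = {c, e}" using sub by (intro card_seteq) auto
      have "u \<in> nb c"
      proof (rule ccontr)
        assume nu: "u \<notin> nb c"
        have "mate c \<in> nb e" by (rule nb_sym) (simp add: eq)
        then have "S e (mate c) \<subseteq> {u}" using Qe unfolding Q_def by blast
        then have "nb c \<subseteq> {mate c, e}" using S_J[OF cm(1), of e] cm(2) nu by auto
        then show False using no_cut[OF cV(1) _ sub] by blast
      qed
      then have "c \<in> nb u" by (rule nb_sym)
      moreover have "e \<in> S u c" using S_J[OF c(2)] eq eI c disj by auto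
      ultimately have "c = hub u \<or> c = p" using in_branch by blast
      moreover have "c \<noteq> hub u"
      proof
        assume "c = hub u"
        then have "r \<in> nb (mate c)" using g(5) by simp
        then have "r \<in> {c, e}" unfolding eq .
        then show False using u(3) f(2) c(2) disj by blast
      qed
      ultimately have "c = p" by simp
      then show ?thesis using eq by blast
    qed
  qed
  show ?thesis
  proof (rule nb_cases[OF pu])
    assume pI: "p \<in> I"
    have pe: "p = e" using S_I[OF pI, of u] pq(3) by simp
    have "c \<in> {far u, u}" if c: "c \<in> nb e" for c
    proof (rule nb_cases[OF c])
      assume "c \<in> I" then show ?thesis using Q_direct[OF _ c] Qe by simp
    next
      assume cJ: "c \<in> J"
      have "mate c \<noteq> p" "c \<noteq> p" using cJ mate_J[OF cJ] pI disj by auto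
      then show ?thesis using nbJ[OF c cJ] by simp
    qed
    moreover have "u \<in> nb e" using nb_sym[OF pu] pe by simp
    ultimately have "nb e = {far u, u}" using Be by blast
    then show ?thesis using pq(1) pe unfolding q by blast
  next
    assume pJ: "p \<in> J"
    have mp: "mate p \<in> J" "mate (mate p) = p" "mate p \<noteq> p" using pJ mate_J mate_mate mate_neq by auto
    have Sp: "nb (mate p) - {p, u} = {e}" using S_J[OF pJ] pq by auto
    then have em: "e \<in> nb (mate p)" by blast
    have "u \<notin> nb (mate p)"
    proof
      assume "u \<in> nb (mate p)"
      then have "mate p \<in> nb u" by (rule nb_sym)
      then have "mate p = hub u \<or> mate p = q" using pq mp by auto
      then show False
      proof
        assume "mate p = hub u"
        then have "p = far u" using mp by metis
        moreover have "u \<in> nb p" by (rule nb_sym[OF pu])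
        ultimately show False using g(5) f u g(3) disj by auto
      next
        assume "mate p = q"
        then have "r \<in> nb p" using pq(4) S_J[OF mp(1), of u] mp by auto
        then have "e \<in> Q r" using Q_link(2)[OF pJ _ f(2) em] u(3) f by auto
        then have "r \<in> Q e" using Q_sym f by blast
        then show False using Qe f by auto
      qed
    qed
    then have nbm: "nb (mate p) = {p, e}" using Sp nb_mate[OF pJ] by auto
    have nbp: "nb p \<subseteq> {mate p, u, e}"
    proof
      fix c assume c: "c \<in> nb p"
      show "c \<in> {mate p, u, e}"
      proof (rule ccontr)
        assume n: "c \<notin> {mate p, u, e}"
        then have cI: "c \<in> I" using J_nb[OF pJ c] by auto
        then have "e \<in> Q c" using Q_link(2)[OF pJ c cI em] n eI by auto
        then have "c \<in> Q e" using Q_sym cI by blast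
        then show False using Qe n by auto
      qed
    qed
    have "c \<in> {far u, mate p, p}" if c: "c \<in> nb e" for c
    proof (rule nb_cases[OF c])
      assume "c \<in> I"
      then have "c = u" using Q_direct[OF _ c] Qe by simp
      then have "e \<in> nb u" using nb_sym[OF c] by simp
      moreover have "e \<noteq> hub u" "e \<noteq> p" using g(3) pJ eI disj by auto
      ultimately have "e = q" using pq(1) by simp
      then show ?thesis using pq(4) S_I[OF eI(1)] u(3) by auto
    next
      assume cJ: "c \<in> J"
      then show ?thesis using nbJ[OF c cJ] mate_mate[OF cJ] by auto
    qed
    then have nbe: "nb e \<subseteq> {far u, mate p, p}" by blast
    have "{mate p, u} \<subseteq> nb p" using mate_nb[OF pJ] nb_sym[OF pu] by simp
    moreover have "{far u, mate p} \<subseteq> nb e" using Be nb_sym[OF em] by simp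
    ultimately have "p \<in> J \<and> nb (mate p) = {p, e} \<and> {mate p, u} \<subseteq> nb p \<and> nb p \<subseteq> {mate p, u, e} \<and>
      {far u, mate p} \<subseteq> nb e \<and> nb e \<subseteq> {far u, mate p, p}"
      using pJ nbm nbp nbe by (intro conjI)
    then show ?thesis using pq(1) unfolding q by blast
  qed
qed

end

section \<open>Edges of the ladders\<close>

text \<open>Edges of \<open>L k\<close> with an orientation, so that case analysis yields equations
  between vertices instead of between two-element sets.\<close>

definition col_adj :: "nat \<Rightarrow> lvert \<Rightarrow> lvert \<Rightarrow> bool" where
  "col_adj k a c \<longleftrightarrow> (\<exists>i. 1 \<le> i \<and> i < k \<and> (a = U i \<and> c = U (i + 1) \<or> a = V i \<and> c = V (i + 1))) \<or>
     (\<exists>i. 1 \<le> i \<and> i \<le> k \<and> a = W i \<and> (c = U i \<or> c = V i))"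

lemma col_adj_cases:
  assumes "col_adj k a c"
  obtains (U) i where "1 \<le> i" "i < k" "a = U i" "c = U (i + 1)"
    | (V) i where "1 \<le> i" "i < k" "a = V i" "c = V (i + 1)"
    | (WU) i where "1 \<le> i" "i \<le> k" "a = W i" "c = U i"
    | (WV) i where "1 \<le> i" "i \<le> k" "a = W i" "c = V i"
  using assms unfolding col_adj_def by blast

lemma edges_L_iff: "{a, c} \<in> edges (L k) \<longleftrightarrow> col_adj k a c \<or> col_adj k c a"
proof -
  have "{a, c} \<in> edges (L k) \<longleftrightarrow>
      (\<exists>i. {a, c} = {U i, U (i + 1)} \<and> 1 \<le> i \<and> i < k) \<or> (\<exists>i. {a, c} = {V i, V (i + 1)} \<and> 1 \<le> i \<and> i < k) \<or>
      (\<exists>i. {a, c} = {W i, U i} \<and> 1 \<le> i \<and> i \<le> k) \<or> (\<exists>i. {a, c} = {W i, V i} \<and> 1 \<le> i \<and> i \<le> k)"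
    unfolding L_def ugraph.select_convs by blast
  then show ?thesis unfolding col_adj_def doubleton_eq_iff by blast
qed

lemma edges_L_prime_iff:
  "{a, c} \<in> edges (L_prime k) \<longleftrightarrow> {a, c} \<in> edges (L k) \<or>
    {a, c} \<in> {{U 1, W1'}, {V 1, W1'}, {U 1, V 1}, {U k, Wk'}, {V k, Wk'}, {U k, V k}}"
  by (simp only: L_prime_def ugraph.select_convs Un_iff)

lemma col_edges:
  assumes "1 \<le> j" "j \<le> k"
  shows "{W j, U j} \<in> edges (L k)" "{U j, W j} \<in> edges (L k)"
    "{W j, V j} \<in> edges (L k)" "{V j, W j} \<in> edges (L k)"
  unfolding edges_L_iff col_adj_def using assms by blast+

lemma rail_edges:
  assumes "1 \<le> j" "j < k"
  shows "{U j, U (j + 1)} \<in> edges (L k)" "{U (j + 1), U j} \<in> edges (L k)"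
    "{V j, V (j + 1)} \<in> edges (L k)" "{V (j + 1), V j} \<in> edges (L k)"
  unfolding edges_L_iff col_adj_def using assms by blast+

lemma rail_edges_back:
  assumes "1 < j" "j \<le> k"
  shows "{U j, U (j - 1)} \<in> edges (L k)" "{V j, V (j - 1)} \<in> edges (L k)"
  using rail_edges(2,4)[of "j - 1" k] assms by simp_all

lemma end_edges:
  "{U 1, W1'} \<in> edges (L_prime k)" "{V 1, W1'} \<in> edges (L_prime k)" "{U 1, V 1} \<in> edges (L_prime k)"
  "{W1', U 1} \<in> edges (L_prime k)" "{W1', V 1} \<in> edges (L_prime k)" "{V 1, U 1} \<in> edges (L_prime k)"
  "{U k, Wk'} \<in> edges (L_prime k)" "{V k, Wk'} \<in> edges (L_prime k)" "{U k, V k} \<in> edges (L_prime k)"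
  "{Wk', U k} \<in> edges (L_prime k)" "{Wk', V k} \<in> edges (L_prime k)" "{V k, U k} \<in> edges (L_prime k)"
  by (simp_all add: L_prime_def insert_commute)

lemma edges_L_prime: "e \<in> edges (L k) \<Longrightarrow> e \<in> edges (L_prime k)"
  by (simp add: L_prime_def)

lemmas ladder_edges = edges_L_prime col_edges rail_edges rail_edges_back end_edges

lemma edges_add_edges_iff: "e \<in> edges (add_edges G F) \<longleftrightarrow> e \<in> edges G \<or> e \<in> F"
  by (simp add: add_edges_def)

definition wrap_edges :: "nat \<Rightarrow> lvert set set" where
  "wrap_edges k = (if odd k then {{U 1, V k}, {V 1, U k}} else {{U 1, U k}, {V 1, V k}})"

lemma verts_L: "verts (L k) = U ` {1..k} \<union> V ` {1..k} \<union> W ` {1..k}"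
  by (simp add: L_def)

lemma verts_L_prime: "verts (L_prime k) = verts (L k) \<union> {W1', Wk'}"
  by (simp add: L_prime_def)

definition place :: "(nat \<Rightarrow> 'a) \<Rightarrow> (nat \<Rightarrow> 'a) \<Rightarrow> (nat \<Rightarrow> 'a) \<Rightarrow> 'a \<Rightarrow> 'a \<Rightarrow> lvert \<Rightarrow> 'a" where
  "place u v w e1 e2 a = (case a of U i \<Rightarrow> u i | V i \<Rightarrow> v i | W i \<Rightarrow> w i | W1' \<Rightarrow> e1 | Wk' \<Rightarrow> e2)"

lemma place_simps [simp]:
  "place u v w e1 e2 (U i) = u i" "place u v w e1 e2 (V i) = v i" "place u v w e1 e2 (W i) = w i"
  "place u v w e1 e2 W1' = e1" "place u v w e1 e2 Wk' = e2"
  by (simp_all add: place_def)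

section \<open>From columns to ladders\<close>

context linked_graph
begin

text \<open>An isomorphism onto a graph between \<open>L k\<close> and \<open>L_prime k\<close>,
  read from ladder names to vertices. \<open>T\<close> records which of the two extra vertices
  occur, and having two implications instead of an equivalence leaves the optional edges
  free.\<close>

definition open_ladder :: "nat \<Rightarrow> bool" where
  "open_ladder k \<longleftrightarrow> (\<exists>T g. verts (L k) \<subseteq> T \<and> T \<subseteq> verts (L_prime k) \<and> bij_betw g T Vs \<and>
    (\<forall>a\<in>T. \<forall>c\<in>T. ({a, c} \<in> edges (L k) \<longrightarrow> g c \<in> nb (g a)) \<and>
      (g c \<in> nb (g a) \<longrightarrow> {a, c} \<in> edges (L_prime k))))"

definition closed_ladder :: "nat \<Rightarrow> bool" where
  "closed_ladder k \<longleftrightarrow> (\<exists>g. bij_betw g (verts (L k)) Vs \<and> (\<forall>a\<in>verts (L k). \<forall>c\<in>verts (L k).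
    {a, c} \<in> edges (add_edges (L k) (wrap_edges k)) \<longleftrightarrow> g c \<in> nb (g a)))"

text \<open>Surjectivity comes for free: the neighbour lists show that the image of \<open>T\<close>
  is closed under adjacency, and the graph is connected.\<close>

lemma ladder_iso:
  fixes u v w :: "nat \<Rightarrow> 'a" and e1 e2 :: 'a and c1 c2 :: bool and k :: nat
  defines "g \<equiv> place u v w e1 e2"
    and "T \<equiv> verts (L k) \<union> (if c1 then {W1'} else {}) \<union> (if c2 then {Wk'} else {})"
  assumes k: "1 \<le> k"
    and inj: "inj_on g T" and gV: "g ` T \<subseteq> Vs"
    and w: "\<And>j. 1 \<le> j \<Longrightarrow> j \<le> k \<Longrightarrow> nb (w j) = {u j, v j}"
    and u_next: "\<And>j. 1 \<le> j \<Longrightarrow> j < k \<Longrightarrow> u (j + 1) \<in> nb (u j)"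
    and v_next: "\<And>j. 1 \<le> j \<Longrightarrow> j < k \<Longrightarrow> v (j + 1) \<in> nb (v j)"
    and u_nb: "\<And>j y. 1 \<le> j \<Longrightarrow> j \<le> k \<Longrightarrow> y \<in> nb (u j) \<Longrightarrow>
      y = w j \<or> j < k \<and> y = u (j + 1) \<or> 1 < j \<and> y = u (j - 1) \<or>
      j = 1 \<and> (y = v 1 \<or> c1 \<and> y = e1) \<or> j = k \<and> (y = v k \<or> c2 \<and> y = e2)"
    and v_nb: "\<And>j y. 1 \<le> j \<Longrightarrow> j \<le> k \<Longrightarrow> y \<in> nb (v j) \<Longrightarrow>
      y = w j \<or> j < k \<and> y = v (j + 1) \<or> 1 < j \<and> y = v (j - 1) \<or>
      j = 1 \<and> (y = u 1 \<or> c1 \<and> y = e1) \<or> j = k \<and> (y = u k \<or> c2 \<and> y = e2)"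
    and e1_nb: "c1 \<Longrightarrow> nb e1 \<subseteq> {u 1, v 1}" and e2_nb: "c2 \<Longrightarrow> nb e2 \<subseteq> {u k, v k}"
  shows "open_ladder k"
proof -
  have lower: "g c \<in> nb (g a)" if ca: "col_adj k a c" for a c
    using ca
  proof (cases rule: col_adj_cases)
    case (U i) then show ?thesis using u_next[of i] by (simp add: g_def)
  next
    case (V i) then show ?thesis using v_next[of i] by (simp add: g_def)
  next
    case (WU i) then show ?thesis using w[of i] by (simp add: g_def)
  next
    case (WV i) then show ?thesis using w[of i] by (simp add: g_def)
  qed
  have T: "U j \<in> T" "V j \<in> T" "W j \<in> T" if "1 \<le> j" "j \<le> k" for j
    using that by (auto simp: T_def verts_L)
  have upper: "\<exists>c\<in>T. y = g c \<and> {a, c} \<in> edges (L_prime k)" if a: "a \<in> T" and y: "y \<in> nb (g a)" for a y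
  proof -
    have hit: "?thesis" if "c \<in> T" "y = g c" "{a, c} \<in> edges (L_prime k)" for c using that by blast
    consider (u) j where "1 \<le> j" "j \<le> k" "a = U j" | (v) j where "1 \<le> j" "j \<le> k" "a = V j"
      | (w) j where "1 \<le> j" "j \<le> k" "a = W j" | (e1) "a = W1'" "c1" | (e2) "a = Wk'" "c2"
      using a by (auto simp: T_def verts_L split: if_splits)
    then show ?thesis
    proof cases
      case u
      then have "y \<in> nb (u j)" using y by (simp add: g_def)
      from u_nb[OF u(1,2) this]
      consider "y = w j" | "j < k" "y = u (j + 1)" | "1 < j" "y = u (j - 1)" | "j = 1" "y = v 1"
        | "j = 1" "c1" "y = e1" | "j = k" "y = v k" | "j = k" "c2" "y = e2" by blast
      then show ?thesis
      proof cases
        case 1 then show ?thesis using u T by (intro hit[of "W j"]) (simp_all add: g_def ladder_edges del: One_nat_def)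
      next
        case 2 then show ?thesis using u T by (intro hit[of "U (j + 1)"]) (simp_all add: g_def ladder_edges del: One_nat_def)
      next
        case 3 then show ?thesis using u T by (intro hit[of "U (j - 1)"]) (simp_all add: g_def ladder_edges del: One_nat_def)
      next
        case 4 then show ?thesis using u T by (intro hit[of "V 1"]) (simp_all add: g_def ladder_edges del: One_nat_def)
      next
        case 5 then show ?thesis using u by (intro hit[of "W1'"]) (simp_all add: g_def end_edges T_def del: One_nat_def)
      next
        case 6 then show ?thesis using u T by (intro hit[of "V k"]) (simp_all add: g_def ladder_edges del: One_nat_def)
      next
        case 7 then show ?thesis using u by (intro hit[of "Wk'"]) (simp_all add: g_def end_edges T_def del: One_nat_def)
      qed
    next
      case v
      then have "y \<in> nb (v j)" using y by (simp add: g_def)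
      from v_nb[OF v(1,2) this]
      consider "y = w j" | "j < k" "y = v (j + 1)" | "1 < j" "y = v (j - 1)" | "j = 1" "y = u 1"
        | "j = 1" "c1" "y = e1" | "j = k" "y = u k" | "j = k" "c2" "y = e2" by blast
      then show ?thesis
      proof cases
        case 1 then show ?thesis using v T by (intro hit[of "W j"]) (simp_all add: g_def ladder_edges del: One_nat_def)
      next
        case 2 then show ?thesis using v T by (intro hit[of "V (j + 1)"]) (simp_all add: g_def ladder_edges del: One_nat_def)
      next
        case 3 then show ?thesis using v T by (intro hit[of "V (j - 1)"]) (simp_all add: g_def ladder_edges del: One_nat_def)
      next
        case 4 then show ?thesis using v T by (intro hit[of "U 1"]) (simp_all add: g_def ladder_edges del: One_nat_def)
      next
        case 5 then show ?thesis using v by (intro hit[of "W1'"]) (simp_all add: g_def end_edges T_def del: One_nat_def)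
      next
        case 6 then show ?thesis using v T by (intro hit[of "U k"]) (simp_all add: g_def ladder_edges del: One_nat_def)
      next
        case 7 then show ?thesis using v by (intro hit[of "Wk'"]) (simp_all add: g_def end_edges T_def del: One_nat_def)
      qed
    next
      case w
      then have "y = u j \<or> y = v j" using y assms(6)[OF w(1,2)] by (simp add: g_def)
      then show ?thesis using w T hit[of "U j"] hit[of "V j"] by (elim disjE) (simp_all add: g_def ladder_edges del: One_nat_def)
    next
      case e1
      then have "y = u 1 \<or> y = v 1" using y e1_nb by (auto simp: g_def)
      then show ?thesis using e1 T k hit[of "U 1"] hit[of "V 1"] by (elim disjE) (simp_all add: g_def ladder_edges del: One_nat_def)
    next
      case e2
      then have "y = u k \<or> y = v k" using y e2_nb by (auto simp: g_def)
      then show ?thesis using e2 T k hit[of "U k"] hit[of "V k"] by (elim disjE) (simp_all add: g_def ladder_edges del: One_nat_def)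
    qed
  qed
  have "g ` T = Vs"
  proof (rule conn[OF gV])
    show "g ` T \<noteq> {}" using T(1)[of 1] k by auto
    fix p q assume "p \<in> g ` T" "q \<in> nb p"
    then show "q \<in> g ` T" using upper by blast
  qed
  then have bij: "bij_betw g T Vs" using inj by (simp add: bij_betw_def)
  have "{a, c} \<in> edges (L_prime k)" if "a \<in> T" "c \<in> T" "g c \<in> nb (g a)" for a c
    using upper[OF that(1,3)] inj_onD[OF inj _ that(2)] by metis
  moreover have "g c \<in> nb (g a)" if "{a, c} \<in> edges (L k)" for a c
    using that lower[of a c] nb_sym[OF lower[of c a]] unfolding edges_L_iff by blast
  moreover have "verts (L k) \<subseteq> T" "T \<subseteq> verts (L_prime k)" by (auto simp: T_def verts_L_prime)
  ultimately show ?thesis unfolding open_ladder_def using bij by (intro exI[of _ T] exI[of _ g]) auto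
qed

lemma cycle_iso:
  fixes u v w :: "nat \<Rightarrow> 'a" and k :: nat
  defines "g \<equiv> place u v w undefined undefined"
  assumes k: "1 \<le> k"
    and inj: "inj_on g (verts (L k))" and gV: "g ` verts (L k) \<subseteq> Vs"
    and w: "\<And>j. 1 \<le> j \<Longrightarrow> j \<le> k \<Longrightarrow> nb (w j) = {u j, v j}"
    and u_next: "\<And>j. 1 \<le> j \<Longrightarrow> j < k \<Longrightarrow> u (j + 1) \<in> nb (u j)"
    and v_next: "\<And>j. 1 \<le> j \<Longrightarrow> j < k \<Longrightarrow> v (j + 1) \<in> nb (v j)"
    and u_wrap: "(if odd k then v k else u k) \<in> nb (u 1)"
    and v_wrap: "(if odd k then u k else v k) \<in> nb (v 1)"
    and u_nb: "\<And>j y. 1 \<le> j \<Longrightarrow> j \<le> k \<Longrightarrow> y \<in> nb (u j) \<Longrightarrow>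
      y = w j \<or> j < k \<and> y = u (j + 1) \<or> 1 < j \<and> y = u (j - 1) \<or>
      j = 1 \<and> y = (if odd k then v k else u k) \<or> j = k \<and> y = (if odd k then v 1 else u 1)"
    and v_nb: "\<And>j y. 1 \<le> j \<Longrightarrow> j \<le> k \<Longrightarrow> y \<in> nb (v j) \<Longrightarrow>
      y = w j \<or> j < k \<and> y = v (j + 1) \<or> 1 < j \<and> y = v (j - 1) \<or>
      j = 1 \<and> y = (if odd k then u k else v k) \<or> j = k \<and> y = (if odd k then u 1 else v 1)"
  shows "closed_ladder k"
proof -
  let ?E = "edges (add_edges (L k) (wrap_edges k))"
  have lower: "g c \<in> nb (g a)" if ca: "col_adj k a c" for a c
    using ca
  proof (cases rule: col_adj_cases)
    case (U i) then show ?thesis using u_next[of i] by (simp add: g_def)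
  next
    case (V i) then show ?thesis using v_next[of i] by (simp add: g_def)
  next
    case (WU i) then show ?thesis using w[of i] by (simp add: g_def)
  next
    case (WV i) then show ?thesis using w[of i] by (simp add: g_def)
  qed
  have T: "U j \<in> verts (L k)" "V j \<in> verts (L k)" "W j \<in> verts (L k)" if "1 \<le> j" "j \<le> k" for j
    using that by (auto simp: verts_L)
  have upper: "\<exists>c\<in>verts (L k). y = g c \<and> {a, c} \<in> ?E" if a: "a \<in> verts (L k)" and y: "y \<in> nb (g a)" for a y
  proof -
    have hit: "?thesis" if "c \<in> verts (L k)" "y = g c" "{a, c} \<in> ?E" for c using that by blast
    consider (u) j where "1 \<le> j" "j \<le> k" "a = U j" | (v) j where "1 \<le> j" "j \<le> k" "a = V j"
      | (w) j where "1 \<le> j" "j \<le> k" "a = W j"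
      using a by (auto simp: verts_L)
    then show ?thesis
    proof cases
      case u
      then have "y \<in> nb (u j)" using y by (simp add: g_def)
      from u_nb[OF u(1,2) this]
      consider "y = w j" | "j < k" "y = u (j + 1)" | "1 < j" "y = u (j - 1)"
        | "j = 1" "y = (if odd k then v k else u k)" | "j = k" "y = (if odd k then v 1 else u 1)" by blast
      then show ?thesis
      proof cases
        case 1 then show ?thesis using u T by (intro hit[of "W j"]) (simp_all add: g_def edges_add_edges_iff ladder_edges del: One_nat_def)
      next
        case 2 then show ?thesis using u T by (intro hit[of "U (j + 1)"]) (simp_all add: g_def edges_add_edges_iff ladder_edges del: One_nat_def)
      next
        case 3 then show ?thesis using u T by (intro hit[of "U (j - 1)"]) (simp_all add: g_def edges_add_edges_iff ladder_edges del: One_nat_def)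
      next
        case 4 then show ?thesis using u T k
          by (intro hit[of "if odd k then V k else U k"]) (auto simp: g_def edges_add_edges_iff wrap_edges_def)
      next
        case 5 then show ?thesis using u T k
          by (intro hit[of "if odd k then V 1 else U 1"]) (auto simp: g_def edges_add_edges_iff wrap_edges_def insert_commute)
      qed
    next
      case v
      then have "y \<in> nb (v j)" using y by (simp add: g_def)
      from v_nb[OF v(1,2) this]
      consider "y = w j" | "j < k" "y = v (j + 1)" | "1 < j" "y = v (j - 1)"
        | "j = 1" "y = (if odd k then u k else v k)" | "j = k" "y = (if odd k then u 1 else v 1)" by blast
      then show ?thesis
      proof cases
        case 1 then show ?thesis using v T by (intro hit[of "W j"]) (simp_all add: g_def edges_add_edges_iff ladder_edges del: One_nat_def)
      next
        case 2 then show ?thesis using v T by (intro hit[of "V (j + 1)"]) (simp_all add: g_def edges_add_edges_iff ladder_edges del: One_nat_def)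
      next
        case 3 then show ?thesis using v T by (intro hit[of "V (j - 1)"]) (simp_all add: g_def edges_add_edges_iff ladder_edges del: One_nat_def)
      next
        case 4 then show ?thesis using v T k
          by (intro hit[of "if odd k then U k else V k"]) (auto simp: g_def edges_add_edges_iff wrap_edges_def)
      next
        case 5 then show ?thesis using v T k
          by (intro hit[of "if odd k then U 1 else V 1"]) (auto simp: g_def edges_add_edges_iff wrap_edges_def insert_commute)
      qed
    next
      case w
      then have "y = u j \<or> y = v j" using y assms(5)[OF w(1,2)] by (simp add: g_def)
      then show ?thesis using w T hit[of "U j"] hit[of "V j"] by (elim disjE) (simp_all add: g_def edges_add_edges_iff ladder_edges del: One_nat_def)
    qed
  qed
  have "g ` verts (L k) = Vs"
  proof (rule conn[OF gV])
    show "g ` verts (L k) \<noteq> {}" using T(1)[of 1] k by auto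
    fix p q assume "p \<in> g ` verts (L k)" "q \<in> nb p"
    then show "q \<in> g ` verts (L k)" using upper by blast
  qed
  then have bij: "bij_betw g (verts (L k)) Vs" using inj by (simp add: bij_betw_def)
  have "{a, c} \<in> ?E" if "a \<in> verts (L k)" "c \<in> verts (L k)" "g c \<in> nb (g a)" for a c
    using upper[OF that(1,3)] inj_onD[OF inj _ that(2)] by metis
  moreover have "g c \<in> nb (g a)" if "{a, c} \<in> ?E" for a c
  proof -
    have "{a, c} \<in> edges (L k) \<or> {a, c} \<in> wrap_edges k" using that by (simp add: edges_add_edges_iff)
    then show ?thesis
    proof
      assume "{a, c} \<in> edges (L k)"
      then show ?thesis using lower[of a c] nb_sym[OF lower[of c a]] unfolding edges_L_iff by blast
    next
      assume "{a, c} \<in> wrap_edges k"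
      then show ?thesis using u_wrap v_wrap nb_sym[OF u_wrap] nb_sym[OF v_wrap]
        by (auto simp: wrap_edges_def g_def doubleton_eq_iff split: if_splits)
    qed
  qed
  ultimately show ?thesis unfolding closed_ladder_def using bij by blast
qed

end

section \<open>Columns with alternating rails\<close>

context linked_graph
begin

text \<open>Column \<open>j\<close> consists of an uncovered vertex \<open>x j\<close>, its middle
  vertex \<open>w j\<close> and the mate \<open>b j\<close>. Consecutive columns are joined by
  \<open>x\<close>-\<open>b\<close> edges, so a rail follows \<open>x\<close> at indices of one
  parity and \<open>b\<close> at the others; \<open>u\<close> takes \<open>x\<close> at even
  indices, \<open>v\<close> at odd ones.\<close>

context
  fixes x w b u v :: "nat \<Rightarrow> 'a" and k :: nat
  assumes k: "3 \<le> k"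
    and x_I: "\<And>j. 1 \<le> j \<Longrightarrow> j \<le> k \<Longrightarrow> x j \<in> I"
    and x_inj: "inj_on x {1..k}"
    and w_J: "\<And>j. 1 \<le> j \<Longrightarrow> j \<le> k \<Longrightarrow> w j \<in> J"
    and w_nb: "\<And>j. 1 \<le> j \<Longrightarrow> j \<le> k \<Longrightarrow> nb (w j) = {x j, b j}"
    and b_mate: "\<And>j. 1 \<le> j \<Longrightarrow> j \<le> k \<Longrightarrow> b j = mate (w j)"
    and up: "\<And>j. 1 \<le> j \<Longrightarrow> j < k \<Longrightarrow> x (j + 1) \<in> nb (b j)"
    and down: "\<And>j. 1 \<le> j \<Longrightarrow> j < k \<Longrightarrow> x j \<in> nb (b (j + 1))"
  defines "u \<equiv> \<lambda>j. if even j then x j else b j"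
    and "v \<equiv> \<lambda>j. if even j then b j else x j"
begin

lemma x_eq: "1 \<le> i \<Longrightarrow> i \<le> k \<Longrightarrow> 1 \<le> j \<Longrightarrow> j \<le> k \<Longrightarrow> x i = x j \<longleftrightarrow> i = j"
  using inj_on_eq_iff[OF x_inj, of i j] by simp

lemma b_J: "1 \<le> j \<Longrightarrow> j \<le> k \<Longrightarrow> b j \<in> J"
  using mate_J[OF w_J[of j]] b_mate[of j] by simp

lemma I_neq_J: "p \<in> I \<Longrightarrow> q \<in> J \<Longrightarrow> p \<noteq> q"
  using disj by blast

lemma xb: "1 \<le> i \<Longrightarrow> i \<le> k \<Longrightarrow> 1 \<le> j \<Longrightarrow> j \<le> k \<Longrightarrow> x i \<noteq> b j"
  by (rule I_neq_J[OF x_I b_J])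

lemma w_eq:
  assumes "1 \<le> i" "i \<le> k" "1 \<le> j" "j \<le> k" "w i = w j"
  shows "i = j"
proof -
  have "x i \<in> nb (w i)" using w_nb[OF assms(1,2)] by simp
  then have "x i \<in> {x j, b j}" unfolding assms(5) w_nb[OF assms(3,4)] .
  then show ?thesis using x_eq[OF assms(1-4)] xb[OF assms(1-4)] by simp
qed

lemma b_eq:
  assumes "1 \<le> i" "i \<le> k" "1 \<le> j" "j \<le> k" "b i = b j"
  shows "i = j"
proof -
  have "mate (mate (w i)) = mate (mate (w j))"
    using assms(5) unfolding b_mate[OF assms(1,2)] b_mate[OF assms(3,4)] by simp
  then have "w i = w j" unfolding mate_mate[OF w_J[OF assms(1,2)]] mate_mate[OF w_J[OF assms(3,4)]] .
  then show ?thesis using w_eq assms(1-4) by blast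
qed

lemma b_nb_I:
  assumes "1 \<le> i" "i \<le> k" "1 \<le> j" "j \<le> k" "b i = w j" "1 \<le> l" "l \<le> k" "x l \<in> nb (b i)"
  shows "l = j"
proof -
  have "x l \<in> {x j, b j}" using assms(8) unfolding assms(5) w_nb[OF assms(3,4)] .
  then show ?thesis using x_eq[OF assms(6,7,3,4)] xb[OF assms(6,7,3,4)] by simp
qed

text \<open>By symmetry of \<open>mate\<close>, \<open>b i = w j\<close> also gives
  \<open>b j = w i\<close>. A middle vertex has a single uncovered neighbour, while \<open>b\<close>
  of an inner column has two, so both columns are ends, \<open>1\<close> and \<open>k\<close>. Then
  \<open>b 1\<close> is adjacent to \<open>x 2\<close>, which is not in column \<open>k\<close>
  since \<open>k\<close> is at least 3.\<close>

lemma bw: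
  assumes i: "1 \<le> i" "i \<le> k" and j: "1 \<le> j" "j \<le> k"
  shows "b i \<noteq> w j"
proof
  assume eq: "b i = w j"
  have "mate (b j) = b i" unfolding b_mate[OF j] eq by (rule mate_mate[OF w_J[OF j]])
  then have "mate (mate (b j)) = mate (mate (w i))" unfolding b_mate[OF i] by simp
  then have eq': "b j = w i" unfolding mate_mate[OF w_J[OF i]] mate_mate[OF b_J[OF j]] .
  have mid: "\<not> (1 < i \<and> i < k)" if h: "1 \<le> i" "i \<le> k" "1 \<le> j" "j \<le> k" "b i = w j" for i j
  proof
    assume a: "1 < i \<and> i < k"
    have "x (i + 1) \<in> nb (b i)" using up[of i] a by simp
    then have 1: "i + 1 = j" using b_nb_I[OF h, of "i + 1"] a by simp
    have "1 \<le> i - 1" "i - 1 < k" "i - 1 + 1 = i" using a by linarith+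
    moreover from this have "x (i - 1) \<in> nb (b i)" using down[of "i - 1"] by simp
    ultimately have "i - 1 = j" using b_nb_I[OF h, of "i - 1"] by simp
    then show False using 1 by simp
  qed
  have "i = 1 \<or> i = k" using mid[OF i j eq] i by auto
  moreover have "j = 1 \<or> j = k" using mid[OF j i eq'] j by auto
  moreover have "i \<noteq> j" using eq mate_neq[OF w_J[OF i]] unfolding b_mate[OF i] by blast
  ultimately consider "i = 1" "j = k" | "i = k" "j = 1" by auto
  then show False
  proof cases
    case 1
    have "x 2 \<in> nb (b i)" using up[of 1] k 1 by (simp add: numeral_2_eq_2)
    then show False using b_nb_I[OF i j eq, of 2] k 1 by simp
  next
    case 2
    have "x 2 \<in> nb (b j)" using up[of 1] k 2 by (simp add: numeral_2_eq_2)
    then show False using b_nb_I[OF j i eq', of 2] k 2 by simp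
  qed
qed

lemma uv_cases: "{u j, v j} = {x j, b j}" "u j = x j \<and> v j = b j \<and> even j \<or> u j = b j \<and> v j = x j \<and> odd j"
  by (auto simp: u_def v_def)

lemma uv_nb:
  assumes "1 \<le> j" "j < k"
  shows "u (j + 1) \<in> nb (u j)" "v (j + 1) \<in> nb (v j)"
proof -
  have "x (j + 1) \<in> nb (b j)" "b (j + 1) \<in> nb (x j)" using up down nb_sym assms by blast+
  then show "u (j + 1) \<in> nb (u j)" "v (j + 1) \<in> nb (v j)" by (auto simp: u_def v_def)
qed

text \<open>The relation \<open>kind\<close> names the vertices by their role (\<open>x\<close>,
  \<open>b\<close>, \<open>w\<close>, end) instead of by rail. Parity is thus handled once, in
  \<open>X\<close> and \<open>Y\<close>, and injectivity reduces to the disjointness of the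
  roles.\<close>

lemma place_inj:
  fixes e1 e2 :: 'a and c1 c2 :: bool
  assumes e1: "c1 \<Longrightarrow> e1 \<in> I \<and> e1 \<notin> x ` {1..k}" and e2: "c2 \<Longrightarrow> e2 \<in> I \<and> e2 \<notin> x ` {1..k}"
    and e12: "e1 \<noteq> e2"
  defines "T \<equiv> verts (L k) \<union> (if c1 then {W1'} else {}) \<union> (if c2 then {Wk'} else {})"
  shows "inj_on (place u v w e1 e2) T" "place u v w e1 e2 ` T \<subseteq> Vs"
proof -
  define X Y where "X i = (if even i then U i else V i)" and "Y i = (if even i then V i else U i)" for i :: nat
  define kind :: "lvert \<Rightarrow> 'a \<Rightarrow> bool" where
    "kind a y \<longleftrightarrow> (\<exists>i. 1 \<le> i \<and> i \<le> k \<and> y = x i \<and> a = X i) \<or> (\<exists>i. 1 \<le> i \<and> i \<le> k \<and> y = b i \<and> a = Y i) \<or>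
       (\<exists>i. 1 \<le> i \<and> i \<le> k \<and> y = w i \<and> a = W i) \<or> c1 \<and> y = e1 \<and> a = W1' \<or> c2 \<and> y = e2 \<and> a = Wk'" for a y
  have kind_intros: "kind (X i) (x i)" "kind (Y i) (b i)" "kind (W i) (w i)" if "1 \<le> i" "i \<le> k" for i
    unfolding kind_def using that by blast+
  have kind_ends: "c1 \<Longrightarrow> kind W1' e1" "c2 \<Longrightarrow> kind Wk' e2" unfolding kind_def by blast+
  have kind_uv: "kind (U i) (u i)" "kind (V i) (v i)" if "1 \<le> i" "i \<le> k" for i
    using kind_intros[OF that] by (simp_all add: X_def Y_def u_def v_def split: if_splits)
  have kind: "kind a (place u v w e1 e2 a)" if a: "a \<in> T" for a
  proof (cases a)
    case (U i) then show ?thesis using a kind_uv(1)[of i] by (auto simp: T_def verts_L split: if_splits)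
  next
    case (V i) then show ?thesis using a kind_uv(2)[of i] by (auto simp: T_def verts_L split: if_splits)
  next
    case (W i) then show ?thesis using a kind_intros(3)[of i] by (auto simp: T_def verts_L split: if_splits)
  next
    case W1' then show ?thesis using a kind_ends(1) by (auto simp: T_def verts_L split: if_splits)
  next
    case Wk' then show ?thesis using a kind_ends(2) by (auto simp: T_def verts_L split: if_splits)
  qed
  have nx: "e1 \<noteq> x i" if "c1" "1 \<le> i" "i \<le> k" for i using e1[OF that(1)] that(2,3) by auto
  have nx': "e2 \<noteq> x i" if "c2" "1 \<le> i" "i \<le> k" for i using e2[OF that(1)] that(2,3) by auto
  have kind_inj: "a = a'" if h: "kind a y" "kind a' y" for a a' y
  proof (cases "y \<in> I")
    case True
    have *: "(\<exists>i. 1 \<le> i \<and> i \<le> k \<and> y = x i \<and> a = X i) \<or> c1 \<and> y = e1 \<and> a = W1' \<or> c2 \<and> y = e2 \<and> a = Wk'"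
      if "kind a y" for a
      using that I_neq_J[OF True b_J] I_neq_J[OF True w_J] unfolding kind_def by blast
    from *[OF h(1)] *[OF h(2)] show ?thesis
    proof (elim disjE exE conjE)
      fix i j assume "1 \<le> i" "i \<le> k" "y = x i" "a = X i" "1 \<le> j" "j \<le> k" "y = x j" "a' = X j"
      then show ?thesis using x_eq[of i j] by simp
    qed (use nx nx' e12 in blast)+
  next
    case False
    have nI: "y \<noteq> x i" if "1 \<le> i" "i \<le> k" for i using x_I[OF that] False by blast
    have nI': "\<not> (c1 \<and> y = e1)" "\<not> (c2 \<and> y = e2)" using e1 e2 False by blast+
    have *: "(\<exists>i. 1 \<le> i \<and> i \<le> k \<and> y = b i \<and> a = Y i) \<or> (\<exists>i. 1 \<le> i \<and> i \<le> k \<and> y = w i \<and> a = W i)"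
      if "kind a y" for a
      using that nI nI' unfolding kind_def by blast
    from *[OF h(1)] *[OF h(2)] show ?thesis
    proof (elim disjE exE conjE)
      fix i j assume "1 \<le> i" "i \<le> k" "y = b i" "a = Y i" "1 \<le> j" "j \<le> k" "y = b j" "a' = Y j"
      then show ?thesis using b_eq[of i j] by simp
    next
      fix i j assume "1 \<le> i" "i \<le> k" "y = w i" "a = W i" "1 \<le> j" "j \<le> k" "y = w j" "a' = W j"
      then show ?thesis using w_eq[of i j] by simp
    next
      fix i j assume "1 \<le> i" "i \<le> k" "y = b i" "a = Y i" "1 \<le> j" "j \<le> k" "y = w j" "a' = W j"
      then show ?thesis using bw[of i j] by simp
    next
      fix i j assume "1 \<le> i" "i \<le> k" "y = w i" "a = W i" "1 \<le> j" "j \<le> k" "y = b j" "a' = Y j"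
      then show ?thesis using bw[of j i] by simp
    qed
  qed
  show "inj_on (place u v w e1 e2) T"
  proof (rule inj_onI)
    fix a a' assume a: "a \<in> T" "a' \<in> T" "place u v w e1 e2 a = place u v w e1 e2 a'"
    have "kind a' (place u v w e1 e2 a)" unfolding a(3) by (rule kind[OF a(2)])
    then show "a = a'" using kind_inj[OF kind[OF a(1)]] by blast
  qed
  show "place u v w e1 e2 ` T \<subseteq> Vs"
  proof
    fix y assume "y \<in> place u v w e1 e2 ` T"
    then obtain a where "kind a y" using kind by blast
    then have "y \<in> I \<or> y \<in> J" unfolding kind_def
    proof (elim disjE exE conjE)
      fix i assume "1 \<le> i" "i \<le> k" "y = x i" then show ?thesis using x_I by simp
    next
      fix i assume "1 \<le> i" "i \<le> k" "y = b i" then show ?thesis using b_J by simp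
    next
      fix i assume "1 \<le> i" "i \<le> k" "y = w i" then show ?thesis using w_J by simp
    next
      assume c1 "y = e1" then show ?thesis using e1 by simp
    next
      assume c2 "y = e2" then show ?thesis using e2 by simp
    qed
    then show "y \<in> Vs" using Vs_eq by simp
  qed
qed

lemma ladder_cols:
  fixes e1 e2 :: 'a and c1 c2 :: bool
  assumes e1: "c1 \<Longrightarrow> e1 \<in> I \<and> e1 \<notin> x ` {1..k}" and e2: "c2 \<Longrightarrow> e2 \<in> I \<and> e2 \<notin> x ` {1..k}"
    and e12: "e1 \<noteq> e2"
    and x_nb: "\<And>j y. 1 \<le> j \<Longrightarrow> j \<le> k \<Longrightarrow> y \<in> nb (x j) \<Longrightarrow>
      y = w j \<or> j < k \<and> y = b (j + 1) \<or> 1 < j \<and> y = b (j - 1) \<or>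
      j = 1 \<and> (y = b 1 \<or> c1 \<and> y = e1) \<or> j = k \<and> (y = b k \<or> c2 \<and> y = e2)"
    and b_nb: "\<And>j y. 1 \<le> j \<Longrightarrow> j \<le> k \<Longrightarrow> y \<in> nb (b j) \<Longrightarrow>
      y = w j \<or> j < k \<and> y = x (j + 1) \<or> 1 < j \<and> y = x (j - 1) \<or>
      j = 1 \<and> (y = x 1 \<or> c1 \<and> y = e1) \<or> j = k \<and> (y = x k \<or> c2 \<and> y = e2)"
    and e1_nb: "c1 \<Longrightarrow> nb e1 \<subseteq> {x 1, b 1}" and e2_nb: "c2 \<Longrightarrow> nb e2 \<subseteq> {x k, b k}"
  shows "open_ladder k"
proof (rule ladder_iso[where u = u and v = v and w = w and k = k and ?e1.0 = e1 and ?e2.0 = e2 and ?c1.0 = c1 and ?c2.0 = c2])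
  show "1 \<le> k" using k by simp
  show "nb (w j) = {u j, v j}" if "1 \<le> j" "j \<le> k" for j using w_nb[OF that] uv_cases(1) by simp
  show "y = w j \<or> j < k \<and> y = u (j + 1) \<or> 1 < j \<and> y = u (j - 1) \<or>
      j = 1 \<and> (y = v 1 \<or> c1 \<and> y = e1) \<or> j = k \<and> (y = v k \<or> c2 \<and> y = e2)"
    if "1 \<le> j" "j \<le> k" "y \<in> nb (u j)" for j y
  proof (cases "even j")
    case True
    then have "y \<in> nb (x j)" using that(3) by (simp add: u_def)
    from x_nb[OF that(1,2) this] show ?thesis using True
      by (elim disjE conjE) (simp_all add: u_def v_def)
  next
    case False
    then have "y \<in> nb (b j)" using that(3) by (simp add: u_def)
    from b_nb[OF that(1,2) this] show ?thesis using False
      by (elim disjE conjE) (simp_all add: u_def v_def)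
  qed
  show "y = w j \<or> j < k \<and> y = v (j + 1) \<or> 1 < j \<and> y = v (j - 1) \<or>
      j = 1 \<and> (y = u 1 \<or> c1 \<and> y = e1) \<or> j = k \<and> (y = u k \<or> c2 \<and> y = e2)"
    if "1 \<le> j" "j \<le> k" "y \<in> nb (v j)" for j y
  proof (cases "even j")
    case True
    then have "y \<in> nb (b j)" using that(3) by (simp add: v_def)
    from b_nb[OF that(1,2) this] show ?thesis using True
      by (elim disjE conjE) (simp_all add: u_def v_def)
  next
    case False
    then have "y \<in> nb (x j)" using that(3) by (simp add: v_def)
    from x_nb[OF that(1,2) this] show ?thesis using False
      by (elim disjE conjE) (simp_all add: u_def v_def)
  qed
  show "nb e1 \<subseteq> {u 1, v 1}" if c1 using e1_nb[OF that] uv_cases(1) by simp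
  show "nb e2 \<subseteq> {u k, v k}" if c2 using e2_nb[OF that] uv_cases(1) by simp
  show "u (j + 1) \<in> nb (u j)" "v (j + 1) \<in> nb (v j)" if "1 \<le> j" "j < k" for j
    using uv_nb[OF that] .
  show "inj_on (place u v w e1 e2) (verts (L k) \<union> (if c1 then {W1'} else {}) \<union> (if c2 then {Wk'} else {}))"
    by (rule place_inj(1)[OF e1 e2 e12])
  show "place u v w e1 e2 ` (verts (L k) \<union> (if c1 then {W1'} else {}) \<union> (if c2 then {Wk'} else {})) \<subseteq> Vs"
    by (rule place_inj(2)[OF e1 e2 e12])
qed

lemma cycle_cols:
  assumes x_nb: "\<And>j y. 1 \<le> j \<Longrightarrow> j \<le> k \<Longrightarrow> y \<in> nb (x j) \<Longrightarrow>
      y = w j \<or> j < k \<and> y = b (j + 1) \<or> 1 < j \<and> y = b (j - 1) \<or>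
      j = 1 \<and> y = b k \<or> j = k \<and> y = b 1"
    and b_nb: "\<And>j y. 1 \<le> j \<Longrightarrow> j \<le> k \<Longrightarrow> y \<in> nb (b j) \<Longrightarrow>
      y = w j \<or> j < k \<and> y = x (j + 1) \<or> 1 < j \<and> y = x (j - 1) \<or>
      j = 1 \<and> y = x k \<or> j = k \<and> y = x 1"
    and wrap: "x k \<in> nb (b 1)" "b k \<in> nb (x 1)"
  shows "closed_ladder k"
proof (rule cycle_iso[where u = u and v = v and w = w and k = k])
  show "1 \<le> k" using k by simp
  \<comment> \<open>\<open>place_inj\<close> asks for two distinct end vertices even when none is
    placed; \<open>x 1\<close> and \<open>x 2\<close> serve, since \<open>L k\<close> contains
    neither \<open>W1'\<close> nor \<open>Wk'\<close>.\<close>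
  have e: "x 1 \<noteq> x 2" using x_eq[of 1 2] k by simp
  have *: "place u v w undefined undefined a = place u v w (x 1) (x 2) a" if "a \<in> verts (L k)" for a
    using that by (auto simp: verts_L)
  show "inj_on (place u v w undefined undefined) (verts (L k))"
  proof -
    have "inj_on (place u v w undefined undefined) (verts (L k)) \<longleftrightarrow> inj_on (place u v w (x 1) (x 2)) (verts (L k))"
      by (rule inj_on_cong) (rule *)
    then show ?thesis using place_inj(1)[OF _ _ e, of False False] by simp
  qed
  show "place u v w undefined undefined ` verts (L k) \<subseteq> Vs"
  proof -
    have "place u v w undefined undefined ` verts (L k) = place u v w (x 1) (x 2) ` verts (L k)"
      by (rule image_cong[OF refl]) (rule *)
    then show ?thesis using place_inj(2)[OF _ _ e, of False False] by simp
  qed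
  show "nb (w j) = {u j, v j}" if "1 \<le> j" "j \<le> k" for j using w_nb[OF that] uv_cases(1) by simp
  show "(if odd k then v k else u k) \<in> nb (u 1)" "(if odd k then u k else v k) \<in> nb (v 1)"
    using wrap by (simp_all add: u_def v_def)
  show "y = w j \<or> j < k \<and> y = u (j + 1) \<or> 1 < j \<and> y = u (j - 1) \<or>
      j = 1 \<and> y = (if odd k then v k else u k) \<or> j = k \<and> y = (if odd k then v 1 else u 1)"
    if "1 \<le> j" "j \<le> k" "y \<in> nb (u j)" for j y
  proof (cases "even j")
    case True
    then have "y \<in> nb (x j)" using that(3) by (simp add: u_def)
    from x_nb[OF that(1,2) this] show ?thesis using True
      by (elim disjE conjE) (simp_all add: u_def v_def)
  next
    case False
    then have "y \<in> nb (b j)" using that(3) by (simp add: u_def)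
    from b_nb[OF that(1,2) this] show ?thesis using False
      by (elim disjE conjE) (simp_all add: u_def v_def)
  qed
  show "y = w j \<or> j < k \<and> y = v (j + 1) \<or> 1 < j \<and> y = v (j - 1) \<or>
      j = 1 \<and> y = (if odd k then u k else v k) \<or> j = k \<and> y = (if odd k then u 1 else v 1)"
    if "1 \<le> j" "j \<le> k" "y \<in> nb (v j)" for j y
  proof (cases "even j")
    case True
    then have "y \<in> nb (b j)" using that(3) by (simp add: v_def)
    from b_nb[OF that(1,2) this] show ?thesis using True
      by (elim disjE conjE) (simp_all add: u_def v_def)
  next
    case False
    then have "y \<in> nb (x j)" using that(3) by (simp add: v_def)
    from x_nb[OF that(1,2) this] show ?thesis using False
      by (elim disjE conjE) (simp_all add: u_def v_def)
  qed
  show "u (j + 1) \<in> nb (u j)" "v (j + 1) \<in> nb (v j)" if "1 \<le> j" "j < k" for j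
    using uv_nb[OF that] .
qed

end

end

section \<open>The link graph is a path or a cycle\<close>

context linked_graph
begin

text \<open>A longest path in the link graph is spanning: its ends have no link leaving it by
  maximality, its inner vertices already have their two links on it, so its vertex set is closed
  under links.\<close>

lemma longest_path:
  "\<exists>x. inj_on x {..<card I} \<and> x ` {..<card I} = I \<and> (\<forall>i. Suc i < card I \<longrightarrow> x (Suc i) \<in> Q (x i))"
proof -
  define P where "P xs \<longleftrightarrow> distinct xs \<and> xs \<noteq> [] \<and> set xs \<subseteq> I \<and> (\<forall>i. Suc i < length xs \<longrightarrow> xs ! Suc i \<in> Q (xs ! i))"
    for xs
  have finI: "finite I" using fin Vs_eq by simp
  obtain a where "a \<in> I" using order_le(3) by fastforce
  then have Pa: "P [a]" by (simp add: P_def)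
  have bd: "\<forall>xs. P xs \<longrightarrow> length xs < Suc (card I)"
    unfolding P_def by (metis card_mono[OF finI] distinct_card less_Suc_eq_le)
  obtain xs where xs: "P xs" and max: "\<And>ys. P ys \<Longrightarrow> length ys \<le> length xs"
    using ex_has_greatest_nat[of P, OF Pa bd] by blast
  define m where "m = length xs"
  have d: "distinct xs" and ne: "xs \<noteq> []" and sub: "set xs \<subseteq> I"
    and step: "\<And>i. Suc i < m \<Longrightarrow> xs ! Suc i \<in> Q (xs ! i)" using xs unfolding P_def m_def by blast+
  have nthI: "xs ! i \<in> I" if "i < m" for i using that sub by (auto simp: m_def)
  have m0: "0 < m" using ne by (simp add: m_def)
  have first: "Q (xs ! 0) \<subseteq> set xs"
  proof
    fix y assume y: "y \<in> Q (xs ! 0)"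
    show "y \<in> set xs"
    proof (rule ccontr)
      assume n: "y \<notin> set xs"
      have "(y # xs) ! Suc i \<in> Q ((y # xs) ! i)" if "Suc i < length (y # xs)" for i
        using that step[of "i - 1"] Q_sym[OF nthI[OF m0] y] by (cases i) (simp_all add: m_def)
      then have "P (y # xs)" using d n sub Q_I[OF nthI[OF m0] y] unfolding P_def by simp
      then show False using max by fastforce
    qed
  qed
  have last: "Q (xs ! (m - 1)) \<subseteq> set xs"
  proof
    fix y assume y: "y \<in> Q (xs ! (m - 1))"
    have mI: "xs ! (m - 1) \<in> I" using nthI m0 by simp
    show "y \<in> set xs"
    proof (rule ccontr)
      assume n: "y \<notin> set xs"
      have "(xs @ [y]) ! Suc i \<in> Q ((xs @ [y]) ! i)" if "Suc i < length (xs @ [y])" for i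
      proof (cases "Suc i < m")
        case True then show ?thesis using step[of i] by (simp add: nth_append m_def)
      next
        case False
        then have "i = m - 1" "Suc i = length xs" using that by (simp_all add: m_def)
        then show ?thesis using y by (simp add: nth_append m_def)
      qed
      then have "P (xs @ [y])" using d n sub Q_I[OF mI y] unfolding P_def by simp
      then show False using max by fastforce
    qed
  qed
  have "set xs = I"
  proof (rule Q_conn[OF sub])
    fix u assume "u \<in> set xs"
    then obtain i where i: "i < m" "u = xs ! i" by (auto simp: in_set_conv_nth m_def)
    show "Q u \<subseteq> set xs"
    proof (cases "i = 0 \<or> i = m - 1")
      case True then show ?thesis using first last i by auto
    next
      case False
      then obtain i' where i': "i = Suc i'" by (cases i) auto
      have i'm: "Suc i < m" "i' < m" using False i i' by auto
      have "Q (xs ! i) = {xs ! i', xs ! Suc i}"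
      proof (rule Q_eq[OF nthI[OF i(1)]])
        show "xs ! i' \<in> Q (xs ! i)" using Q_sym[OF nthI[OF i'm(2)]] step[of i'] i i' by simp
        show "xs ! i' \<noteq> xs ! Suc i" using d i'm i' by (simp add: nth_eq_iff_index_eq m_def)
      qed (rule step[OF i'm(1)])
      then show ?thesis using i i'm by (simp add: m_def)
    qed
  qed (use ne in simp)
  moreover from this have "m = card I" using distinct_card[OF d] by (simp add: m_def)
  moreover have "inj_on (nth xs) {..<m}" using d by (simp add: inj_on_nth m_def)
  moreover have "nth xs ` {..<m} = set xs" unfolding m_def by (auto simp: set_conv_nth)
  ultimately show ?thesis using step by (intro exI[of _ "nth xs"]) simp
qed

lemma cycle_structure:
  assumes m: "m = card I" and inj: "inj_on x {..<m}" and im: "x ` {..<m} = I"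
    and Qx: "\<And>i. i < m \<Longrightarrow>
      Q (x i) = {x (if i = 0 then m - 1 else i - 1), x (if Suc i = m then 0 else Suc i)}"
  shows "closed_ladder m"
proof -
  have m6: "6 \<le> m" using order_le(3) m by simp
  have xI: "x i \<in> I" if "i < m" for i using im that by auto
  have x_eq: "x i = x j \<longleftrightarrow> i = j" if "i < m" "j < m" for i j
    using inj_on_eq_iff[OF inj] that by simp
  define pr where "pr i = (if i = 0 then m - 1 else i - 1)" for i
  define sc where "sc i = (if Suc i = m then 0 else Suc i)" for i
  have ps: "pr i < m" "sc i < m" "x (pr i) \<noteq> x (sc i)" if "i < m" for i
  proof -
    show 1: "pr i < m" "sc i < m" using that m6 by (auto simp: pr_def sc_def)
    have "pr i \<noteq> sc i" using that m6 by (auto simp: pr_def sc_def)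
    then show "x (pr i) \<noteq> x (sc i)" using x_eq[OF 1] by simp
  qed
  have Q2: "Q (x i) = {x (pr i), x (sc i)}" if "i < m" for i
    using Qx[OF that] by (simp only: pr_def sc_def)
  have cQ: "card (Q (x i)) = 2" if "i < m" for i using Q2[OF that] ps[OF that] by simp
  note int = interior[OF xI Q2 ps(3)]
  have nbx: "nb (x i) = {hub (x i), far (x (pr i)), far (x (sc i))}" if "i < m" for i
    by (rule interior_nb[OF xI[OF that] Q2[OF that] ps(3)[OF that] cQ[OF ps(1)[OF that]] cQ[OF ps(2)[OF that]]])
  have idx: "j - 1 < m" if "1 \<le> j" "j \<le> m" for j using that by simp
  have sc_j: "sc (j - 1) = j" if "1 \<le> j" "j < m" for j using that by (simp add: sc_def)
  have pr_j: "pr (j - 1) = j - 1 - 1" if "1 < j" for j using that by (simp add: pr_def)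
  \<comment> \<open>Columns are numbered from 1 while \<open>x\<close> starts at 0, hence the shifts
    by one.\<close>
  show ?thesis
  proof (rule cycle_cols[of m "\<lambda>j. x (j - 1)" "\<lambda>j. hub (x (j - 1))" "\<lambda>j. far (x (j - 1))"])
    show "3 \<le> m" using m6 by simp
    show "x (j - 1) \<in> I" if "1 \<le> j" "j \<le> m" for j using xI idx[OF that] by simp
    show "inj_on (\<lambda>j. x (j - 1)) {1..m}"
    proof (rule inj_onI)
      fix i j assume a: "i \<in> {1..m}" "j \<in> {1..m}" "x (i - 1) = x (j - 1)"
      then have "i - 1 = j - 1" using x_eq[of "i - 1" "j - 1"] idx by auto
      then show "i = j" using a by auto
    qed
    show "hub (x (j - 1)) \<in> J" if "1 \<le> j" "j \<le> m" for j using int(4) idx[OF that] by simp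
    show "nb (hub (x (j - 1))) = {x (j - 1), far (x (j - 1))}" if "1 \<le> j" "j \<le> m" for j
      using int(5) idx[OF that] by simp
    show "x (j + 1 - 1) \<in> nb (far (x (j - 1)))" if "1 \<le> j" "j < m" for j
      using int(6)[of "j - 1"] sc_j[OF that] that by simp
    show "x (j - 1) \<in> nb (far (x (j + 1 - 1)))" if "1 \<le> j" "j < m" for j
      using int(6)[of j] that by (simp add: pr_def)
    show "x (m - 1) \<in> nb (far (x (1 - 1)))" using int(6)[of 0] m6 by (simp add: pr_def)
    show "far (x (m - 1)) \<in> nb (x (1 - 1))" using nbx[of 0] m6 by (simp add: pr_def)
    show "y = hub (x (j - 1)) \<or> j < m \<and> y = far (x (j + 1 - 1)) \<or> 1 < j \<and> y = far (x (j - 1 - 1)) \<or>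
      j = 1 \<and> y = far (x (m - 1)) \<or> j = m \<and> y = far (x (1 - 1))"
      if "1 \<le> j" "j \<le> m" "y \<in> nb (x (j - 1))" for j y
    proof -
      have "y = hub (x (j - 1)) \<or> y = far (x (pr (j - 1))) \<or> y = far (x (sc (j - 1)))"
        using that(3) nbx[OF idx[OF that(1,2)]] by simp
      moreover have "1 < j \<and> pr (j - 1) = j - 1 - 1 \<or> j = 1 \<and> pr (j - 1) = m - 1" using that by (auto simp: pr_def)
      moreover have "j < m \<and> sc (j - 1) = j \<or> j = m \<and> sc (j - 1) = 0" using that by (auto simp: sc_def)
      ultimately show ?thesis by (elim disjE conjE) simp_all
    qed
    show "y = hub (x (j - 1)) \<or> j < m \<and> y = x (j + 1 - 1) \<or> 1 < j \<and> y = x (j - 1 - 1) \<or>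
      j = 1 \<and> y = x (m - 1) \<or> j = m \<and> y = x (1 - 1)"
      if "1 \<le> j" "j \<le> m" "y \<in> nb (far (x (j - 1)))" for j y
    proof -
      have "y = hub (x (j - 1)) \<or> y = x (pr (j - 1)) \<or> y = x (sc (j - 1))"
        using that(3) int(6)[OF idx[OF that(1,2)] idx[OF that(1,2)] idx[OF that(1,2)]] by simp
      moreover have "1 < j \<and> pr (j - 1) = j - 1 - 1 \<or> j = 1 \<and> pr (j - 1) = m - 1" using that by (auto simp: pr_def)
      moreover have "j < m \<and> sc (j - 1) = j \<or> j = m \<and> sc (j - 1) = 0" using that by (auto simp: sc_def)
      ultimately show ?thesis by (elim disjE conjE) simp_all
    qed
  qed simp
qed

text \<open>At each end of the link path \<open>end_column\<close> decides whether the last vertex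
  is an extra vertex or heads a column. \<open>c1\<close> and \<open>c2\<close> record the first
  case, and the columns are those with index from \<open>s\<close> to \<open>t\<close>.\<close>

lemma path_structure:
  assumes m: "m = card I" and inj: "inj_on x {..<m}" and im: "x ` {..<m} = I"
    and Qx: "\<And>i. 1 \<le> i \<Longrightarrow> i + 1 < m \<Longrightarrow> Q (x i) = {x (i - 1), x (i + 1)}"
    and Q0: "Q (x 0) = {x 1}" and Qm: "Q (x (m - 1)) = {x (m - 2)}"
  shows "\<exists>k\<ge>1. open_ladder k"
proof -
  have m6: "6 \<le> m" using order_le(3) m by simp
  have xI: "x i \<in> I" if "i < m" for i using im that by auto
  have x_eq: "x i = x j \<longleftrightarrow> i = j" if "i < m" "j < m" for i j
    using inj_on_eq_iff[OF inj] that by simp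
  have ne: "x (i - 1) \<noteq> x (i + 1)" if "1 \<le> i" "i + 1 < m" for i using x_eq[of "i - 1" "i + 1"] that by simp
  have xI': "x i \<in> I" if "1 \<le> i" "i + 1 < m" for i using xI that by simp
  have cQ: "card (Q (x i)) = 2" if "1 \<le> i" "i + 1 < m" for i using Qx[OF that] ne[OF that] by simp
  have int: "hub (x i) \<in> J" "nb (hub (x i)) = {x i, far (x i)}" "nb (far (x i)) = {hub (x i), x (i - 1), x (i + 1)}"
    if "1 \<le> i" "i + 1 < m" for i
    using interior(4-6)[OF xI'[OF that] Qx[OF that] ne[OF that]] .
  have i1: "1 \<le> (1::nat)" "1 + 1 < m" and i2: "1 \<le> (2::nat)" "2 + 1 < m"
    and j1: "1 \<le> m - 2" "m - 2 + 1 < m" and j2: "1 \<le> m - 3" "m - 3 + 1 < m" using m6 by linarith+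
  have j_simps: "m - 2 + 1 = m - 1" "m - 2 - 1 = m - 3" using m6 by linarith+
  have Q1: "Q (x 1) = {x 0, x 2}" using Qx[OF i1] by (simp add: numeral_2_eq_2)
  have Q1': "Q (x (m - 2)) = {x (m - 1), x (m - 3)}" using Qx[OF j1] unfolding j_simps by blast
  have "x 0 \<noteq> x 2" using x_eq[of 0 2] m6 by simp
  from end_column[OF xI'[OF i1] Q1 this cQ[OF i2] Q0] obtain p where
    p: "nb (x 1) = {hub (x 1), p, far (x 2)}" and
    pcase: "p = x 0 \<and> nb (x 0) = {far (x 1), x 1} \<or>
     p \<in> J \<and> nb (mate p) = {p, x 0} \<and> {mate p, x 1} \<subseteq> nb p \<and> nb p \<subseteq> {mate p, x 1, x 0} \<and>
     {far (x 1), mate p} \<subseteq> nb (x 0) \<and> nb (x 0) \<subseteq> {far (x 1), mate p, p}" by (elim exE conjE)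
  have "x (m - 1) \<noteq> x (m - 3)" using x_eq[of "m - 1" "m - 3"] m6 by simp
  from end_column[OF xI'[OF j1] Q1' this cQ[OF j2] Qm] obtain q where
    q: "nb (x (m - 2)) = {hub (x (m - 2)), q, far (x (m - 3))}" and
    qcase: "q = x (m - 1) \<and> nb (x (m - 1)) = {far (x (m - 2)), x (m - 2)} \<or>
     q \<in> J \<and> nb (mate q) = {q, x (m - 1)} \<and> {mate q, x (m - 2)} \<subseteq> nb q \<and> nb q \<subseteq> {mate q, x (m - 2), x (m - 1)} \<and>
     {far (x (m - 2)), mate q} \<subseteq> nb (x (m - 1)) \<and> nb (x (m - 1)) \<subseteq> {far (x (m - 2)), mate q, q}" by (elim exE conjE)
  define c1 c2 where "c1 \<longleftrightarrow> p = x 0" and "c2 \<longleftrightarrow> q = x (m - 1)"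
  have P1: "nb (x 0) = {far (x 1), x 1}" if c1
    using pcase that xI[of 0] m6 disj unfolding c1_def by auto
  have P2: "p \<in> J" "nb (mate p) = {p, x 0}" "{mate p, x 1} \<subseteq> nb p" "nb p \<subseteq> {mate p, x 1, x 0}"
     "{far (x 1), mate p} \<subseteq> nb (x 0)" "nb (x 0) \<subseteq> {far (x 1), mate p, p}" if "\<not> c1"
    using pcase that unfolding c1_def by blast+
  have R1: "nb (x (m - 1)) = {far (x (m - 2)), x (m - 2)}" if c2
    using qcase that xI[of "m - 1"] m6 disj unfolding c2_def by auto
  have R2: "q \<in> J" "nb (mate q) = {q, x (m - 1)}" "{mate q, x (m - 2)} \<subseteq> nb q" "nb q \<subseteq> {mate q, x (m - 2), x (m - 1)}"
     "{far (x (m - 2)), mate q} \<subseteq> nb (x (m - 1))" "nb (x (m - 1)) \<subseteq> {far (x (m - 2)), mate q, q}" if "\<not> c2"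
    using qcase that unfolding c2_def by blast+
  \<comment> \<open>At the ends the column is taken from \<open>end_column\<close>:
    \<open>hub (x 0)\<close> would be ambiguous there, since \<open>far (x 1)\<close> and
    \<open>mate p\<close> both lead exactly to \<open>x 1\<close>.\<close>
  define w where "w i = (if i = 0 then mate p else if i = m - 1 then mate q else hub (x i))" for i
  define b where "b i = (if i = 0 then p else if i = m - 1 then q else far (x i))" for i
  define s t where "s = (if c1 then 1 else (0::nat))" and "t = (if c2 then m - 2 else m - 1)"
  have st: "s \<le> 1" "m - 2 \<le> t" "t \<le> m - 1" by (auto simp: s_def t_def)
  have wb_int: "w i = hub (x i)" "b i = far (x i)" if "1 \<le> i" "i + 1 < m" for i
  proof -
    have "i \<noteq> 0" "i \<noteq> m - 1" using that by linarith+
    then show "w i = hub (x i)" "b i = far (x i)" by (simp_all add: w_def b_def)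
  qed
  have col_cases: "(1 \<le> i \<and> i + 1 < m) \<or> (i = 0 \<and> \<not> c1) \<or> (i = m - 1 \<and> \<not> c2)" if "s \<le> i" "i \<le> t" for i
    using that m6 by (auto simp: s_def t_def split: if_splits)
  have w0: "w 0 = mate p" "b 0 = p" "w (m - 1) = mate q" "b (m - 1) = q" using m6 by (simp_all add: w_def b_def)
  have wJ: "w i \<in> J" "nb (w i) = {x i, b i}" "b i = mate (w i)" if "s \<le> i" "i \<le> t" for i
  proof -
    have "w i \<in> J \<and> nb (w i) = {x i, b i} \<and> b i = mate (w i)"
      using col_cases[OF that]
    proof (elim disjE conjE)
      assume i: "1 \<le> i" "i + 1 < m"
      then show ?thesis using int[OF i] wb_int[OF i] by simp
    next
      assume i: "i = 0" "\<not> c1"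
      show ?thesis unfolding i(1) w0 using P2(1,2)[OF i(2)] mate_J mate_mate by auto
    next
      assume i: "i = m - 1" "\<not> c2"
      show ?thesis unfolding i(1) w0 using R2(1,2)[OF i(2)] mate_J mate_mate by auto
    qed
    then show "w i \<in> J" "nb (w i) = {x i, b i}" "b i = mate (w i)" by blast+
  qed
  have b_int: "nb (b i) = {w i, x (i - 1), x (i + 1)}" if "1 \<le> i" "i + 1 < m" for i
    using int(3)[OF that] wb_int[OF that] by simp
  have x_int: "nb (x i) = {w i, b (i - 1), b (i + 1)}" if "1 \<le> i" "i + 1 < m" for i
  proof -
    consider "i = 1" | "i = m - 2" | "1 < i" "i < m - 2" using \<open>1 \<le> i\<close> \<open>i + 1 < m\<close> by linarith
    then show ?thesis
    proof cases
      case 1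
      then show ?thesis using p wb_int[OF i1] wb_int[OF i2] w0 by (simp add: numeral_2_eq_2)
    next
      case 2
      have "nb (x (m - 2)) = {w (m - 2), b (m - 3), b (m - 1)}"
        unfolding q wb_int[OF j1] wb_int[OF j2] w0 by blast
      then show ?thesis unfolding 2 j_simps .
    next
      case 3
      then have i: "1 \<le> i - 1" "i - 1 + 1 < m" "1 \<le> i + 1" "i + 1 + 1 < m" by linarith+
      have "nb (x i) = {hub (x i), far (x (i - 1)), far (x (i + 1))}"
        by (rule interior_nb[OF xI'[OF that] Qx[OF that] ne[OF that] cQ[OF i(1,2)] cQ[OF i(3,4)]])
      then show ?thesis unfolding wb_int[OF that] wb_int[OF i(1,2)] wb_int[OF i(3,4)] .
    qed
  qed
  have low: "s \<le> i - 1 \<or> i = 1 \<and> s = 1 \<and> c1" if "1 \<le> i" for i using that by (auto simp: s_def)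
  have high: "i + 1 \<le> t \<or> i = m - 2 \<and> t = m - 2 \<and> c2" if "i + 1 < m" for i using that by (auto simp: t_def)
  have x_glob: "y = w i \<or> 1 \<le> i \<and> s \<le> i - 1 \<and> y = b (i - 1) \<or> i + 1 \<le> t \<and> y = b (i + 1) \<or>
      i = s \<and> (y = b s \<or> c1 \<and> y = x 0) \<or> i = t \<and> (y = b t \<or> c2 \<and> y = x (m - 1))"
    if i: "s \<le> i" "i \<le> t" and y: "y \<in> nb (x i)" for i y
    using col_cases[OF i]
  proof (elim disjE conjE)
    assume a: "1 \<le> i" "i + 1 < m"
    have "y = w i \<or> y = b (i - 1) \<or> y = b (i + 1)" using y unfolding x_int[OF a] by simp
    \<comment> \<open>If \<open>x 0\<close> heads no column, then \<open>b 0\<close> is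
      \<open>p\<close>, which is \<open>x 0\<close> itself; so the neighbour list of
      \<open>x 1\<close> is still correct.\<close>
    moreover have "b 0 = x 0" if c1 using that w0 by (simp add: c1_def)
    moreover have "b (m - 1) = x (m - 1)" if c2 using that w0 by (simp add: c2_def)
    ultimately show ?thesis using low[OF a(1)] high[OF a(2)] a j_simps by (elim disjE conjE) simp_all
  next
    assume a: "i = 0" "\<not> c1"
    have "y = b 1 \<or> y = w 0 \<or> y = b 0" using P2(6)[OF a(2)] y unfolding a(1) w0 wb_int(2)[OF i1] by blast
    moreover have "s = 0" "1 \<le> t" using a st m6 by (auto simp: s_def)
    ultimately show ?thesis unfolding a(1) by (elim disjE conjE) simp_all
  next
    assume a: "i = m - 1" "\<not> c2"
    have "y = b (m - 2) \<or> y = w (m - 1) \<or> y = b (m - 1)" using R2(6)[OF a(2)] y unfolding a(1) w0 wb_int(2)[OF j1] by blast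
    moreover have "t = m - 1" "m - 1 - 1 = m - 2" "s \<le> m - 2" "1 \<le> m - 1" using a st m6 by (auto simp: t_def)
    ultimately show ?thesis unfolding a(1) by (elim disjE conjE) simp_all
  qed
  have b_glob: "y = w i \<or> 1 \<le> i \<and> s \<le> i - 1 \<and> y = x (i - 1) \<or> i + 1 \<le> t \<and> y = x (i + 1) \<or>
      i = s \<and> (y = x s \<or> c1 \<and> y = x 0) \<or> i = t \<and> (y = x t \<or> c2 \<and> y = x (m - 1))"
    if i: "s \<le> i" "i \<le> t" and y: "y \<in> nb (b i)" for i y
    using col_cases[OF i]
  proof (elim disjE conjE)
    assume a: "1 \<le> i" "i + 1 < m"
    have "y = w i \<or> y = x (i - 1) \<or> y = x (i + 1)" using y unfolding b_int[OF a] by simp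
    then show ?thesis using low[OF a(1)] high[OF a(2)] a j_simps by (elim disjE conjE) simp_all
  next
    assume a: "i = 0" "\<not> c1"
    have "y = w 0 \<or> y = x 1 \<or> y = x 0" using P2(4)[OF a(2)] y unfolding a(1) w0 by blast
    moreover have "s = 0" "1 \<le> t" using a st m6 by (auto simp: s_def)
    ultimately show ?thesis unfolding a(1) by (elim disjE conjE) simp_all
  next
    assume a: "i = m - 1" "\<not> c2"
    have "y = w (m - 1) \<or> y = x (m - 2) \<or> y = x (m - 1)" using R2(4)[OF a(2)] y unfolding a(1) w0 by blast
    moreover have "t = m - 1" "m - 1 - 1 = m - 2" "s \<le> m - 2" "1 \<le> m - 1" using a st m6 by (auto simp: t_def)
    ultimately show ?thesis unfolding a(1) by (elim disjE conjE) simp_all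
  qed
  define k where "k = t + 1 - s"
  \<comment> \<open>The index of the \<open>j\<close>-th column. As \<open>s\<close> may be 0, the
    form \<open>s - 1 + j\<close> would be spoiled by truncated subtraction.\<close>
  define c where "c j = j + s - 1" for j
  have k3: "3 \<le> k" using st m6 unfolding k_def by linarith
  have c_rng: "s \<le> c j" "c j \<le> t" "c j < m" if "1 \<le> j" "j \<le> k" for j
    using that st m6 unfolding c_def k_def by linarith+
  have c_suc: "c (j + 1) = c j + 1" if "1 \<le> j" for j using that unfolding c_def by linarith
  have c_pre: "c (j - 1) = c j - 1" if "1 < j" for j using that unfolding c_def by linarith
  have c1e: "c 1 = s" by (simp add: c_def)
  have cke: "c k = t" using st m6 unfolding c_def k_def by linarith
  have "open_ladder k"
  proof (rule ladder_cols[of k "\<lambda>j. x (c j)" "\<lambda>j. w (c j)" "\<lambda>j. b (c j)" c1 "x 0" c2 "x (m - 1)"])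
    show "3 \<le> k" by (rule k3)
    show "x (c j) \<in> I" if "1 \<le> j" "j \<le> k" for j using xI c_rng(3)[OF that] by blast
    show "inj_on (\<lambda>j. x (c j)) {1..k}"
    proof (rule inj_onI)
      fix i j assume a: "i \<in> {1..k}" "j \<in> {1..k}" "x (c i) = x (c j)"
      then have "c i = c j" using x_eq[of "c i" "c j"] c_rng(3) by simp
      then show "i = j" using a(1,2) unfolding c_def atLeastAtMost_iff by linarith
    qed
    show "w (c j) \<in> J" "nb (w (c j)) = {x (c j), b (c j)}" "b (c j) = mate (w (c j))"
      if "1 \<le> j" "j \<le> k" for j using wJ[OF c_rng(1,2)[OF that]] by blast+
    have up_g: "x (i + 1) \<in> nb (b i)" if "s \<le> i" "i < t" for i
    proof -
      have "1 \<le> i \<and> i + 1 < m \<or> i = 0 \<and> \<not> c1" using col_cases[of i] that st m6 by linarith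
      then show ?thesis
      proof (elim disjE conjE)
        assume i: "1 \<le> i" "i + 1 < m" show ?thesis using b_int[OF i] by simp
      next
        assume i: "i = 0" "\<not> c1" show ?thesis using P2(3)[OF i(2)] unfolding i(1) w0 by simp
      qed
    qed
    have down_g: "x i \<in> nb (b (i + 1))" if "s \<le> i" "i < t" for i
    proof -
      have "1 \<le> i + 1 \<and> i + 1 + 1 < m \<or> i + 1 = m - 1 \<and> \<not> c2" using col_cases[of "i + 1"] that st m6 by linarith
      then show ?thesis
      proof (elim disjE conjE)
        assume i: "1 \<le> i + 1" "i + 1 + 1 < m" show ?thesis using b_int[OF i] by simp
      next
        assume i: "i + 1 = m - 1" "\<not> c2"
        then have "i = m - 2" by linarith
        then show ?thesis using R2(3)[OF i(2)] unfolding i(1) w0 by simp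
      qed
    qed
    have c_lt: "c j < t" if "1 \<le> j" "j < k" for j using that st m6 unfolding c_def k_def by linarith
    show "x (c (j + 1)) \<in> nb (b (c j))" "x (c j) \<in> nb (b (c (j + 1)))" if "1 \<le> j" "j < k" for j
      using up_g[OF c_rng(1)[of j] c_lt[OF that]] down_g[OF c_rng(1)[of j] c_lt[OF that]] that c_suc[of j] by simp_all
    show "x 0 \<in> I \<and> x 0 \<notin> (\<lambda>j. x (c j)) ` {1..k}" if c1
    proof -
      have "x 0 \<noteq> x (c j)" if "1 \<le> j" "j \<le> k" for j
        using x_eq[of 0 "c j"] c_rng[OF that] \<open>c1\<close> m6 by (simp add: s_def)
      then show ?thesis using xI[of 0] m6 by (simp add: image_iff)
    qed
    show "x (m - 1) \<in> I \<and> x (m - 1) \<notin> (\<lambda>j. x (c j)) ` {1..k}" if c2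
    proof -
      have "x (m - 1) \<noteq> x (c j)" if "1 \<le> j" "j \<le> k" for j
        using x_eq[of "m - 1" "c j"] c_rng[OF that] \<open>c2\<close> m6 by (simp add: t_def)
      then show ?thesis using xI[of "m - 1"] m6 by (simp add: image_iff)
    qed
    show "x 0 \<noteq> x (m - 1)" using x_eq[of 0 "m - 1"] m6 by simp
    have pos: "1 \<le> c j \<and> s \<le> c j - 1 \<Longrightarrow> 1 < j \<and> c (j - 1) = c j - 1" "c j + 1 \<le> t \<Longrightarrow> j < k \<and> c (j + 1) = c j + 1"
      "c j = s \<Longrightarrow> j = 1" "c j = t \<Longrightarrow> j = k" if "1 \<le> j" "j \<le> k" for j
      using that st m6 unfolding c_def k_def by linarith+
    show "y = w (c j) \<or> j < k \<and> y = b (c (j + 1)) \<or> 1 < j \<and> y = b (c (j - 1)) \<or>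
      j = 1 \<and> (y = b (c 1) \<or> c1 \<and> y = x 0) \<or> j = k \<and> (y = b (c k) \<or> c2 \<and> y = x (m - 1))"
      if j: "1 \<le> j" "j \<le> k" and y: "y \<in> nb (x (c j))" for j y
    proof -
      note p1 = pos(1)[OF j] and p2 = pos(2)[OF j] and p3 = pos(3)[OF j] and p4 = pos(4)[OF j]
      from x_glob[OF c_rng(1,2)[OF j] y] show ?thesis
      proof (elim disjE conjE)
        assume "1 \<le> c j" "s \<le> c j - 1" "y = b (c j - 1)" then show ?thesis using p1 by simp
      next
        assume "c j + 1 \<le> t" "y = b (c j + 1)" then show ?thesis using p2 by simp
      next
        assume "c j = s" "y = b s" then show ?thesis using p3 c1e by simp
      next
        assume "c j = s" "c1" "y = x 0" then show ?thesis using p3 by simp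
      next
        assume "c j = t" "y = b t" then show ?thesis using p4 cke by simp
      next
        assume "c j = t" "c2" "y = x (m - 1)" then show ?thesis using p4 by simp
      qed simp
    qed
    show "y = w (c j) \<or> j < k \<and> y = x (c (j + 1)) \<or> 1 < j \<and> y = x (c (j - 1)) \<or>
      j = 1 \<and> (y = x (c 1) \<or> c1 \<and> y = x 0) \<or> j = k \<and> (y = x (c k) \<or> c2 \<and> y = x (m - 1))"
      if j: "1 \<le> j" "j \<le> k" and y: "y \<in> nb (b (c j))" for j y
    proof -
      note p1 = pos(1)[OF j] and p2 = pos(2)[OF j] and p3 = pos(3)[OF j] and p4 = pos(4)[OF j]
      from b_glob[OF c_rng(1,2)[OF j] y] show ?thesis
      proof (elim disjE conjE)
        assume "1 \<le> c j" "s \<le> c j - 1" "y = x (c j - 1)" then show ?thesis using p1 by simp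
      next
        assume "c j + 1 \<le> t" "y = x (c j + 1)" then show ?thesis using p2 by simp
      next
        assume "c j = s" "y = x s" then show ?thesis using p3 c1e by simp
      next
        assume "c j = s" "c1" "y = x 0" then show ?thesis using p3 by simp
      next
        assume "c j = t" "y = x t" then show ?thesis using p4 cke by simp
      next
        assume "c j = t" "c2" "y = x (m - 1)" then show ?thesis using p4 by simp
      qed simp
    qed
    show "nb (x 0) \<subseteq> {x (c 1), b (c 1)}" if c1
      using P1[OF that] that wb_int[OF i1] unfolding c1e s_def by simp
    show "nb (x (m - 1)) \<subseteq> {x (c k), b (c k)}" if c2
      using R1[OF that] that wb_int[OF j1] unfolding cke t_def by simp
  qed
  then show ?thesis using k3 by (intro exI[of _ k]) simp
qed

text \<open>Inner vertices of the spanning link path have both their links on it, so an end can be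
  linked to its successor and to the opposite end only. Whether the two ends are linked decides
  between cycle and path.\<close>

lemma ladder_structure: "(\<exists>k\<ge>1. open_ladder k) \<or> (\<exists>k\<ge>3. closed_ladder k)"
proof -
  define m where m: "m = card I"
  from longest_path obtain x where x: "inj_on x {..<m} \<and> x ` {..<m} = I \<and> (\<forall>i. Suc i < m \<longrightarrow> x (Suc i) \<in> Q (x i))"
    unfolding m ..
  then have inj: "inj_on x {..<m}" and im: "x ` {..<m} = I" by simp_all
  have step: "x (Suc i) \<in> Q (x i)" if "Suc i < m" for i using x that by simp
  have m6: "6 \<le> m" using order_le(3) m by simp
  have xI: "x i \<in> I" if "i < m" for i using im that by auto
  have x_eq: "x i = x j \<longleftrightarrow> i = j" if "i < m" "j < m" for i j
    using inj_on_eq_iff[OF inj] that by simp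
  have prev_Q: "x (i - 1) \<in> Q (x i)" if "1 \<le> i" "i < m" for i
    using Q_sym[OF xI[of "i - 1"] step[of "i - 1"]] that by simp
  have Qx: "Q (x i) = {x (i - 1), x (i + 1)}" if "1 \<le> i" "i + 1 < m" for i
    using Q_eq[OF xI[of i] prev_Q[of i], of "x (i + 1)"] step[of i] x_eq[of "i - 1" "i + 1"] that by simp
  have end_Q: "v = x j \<or> v = x (m - 1 - i)"
    if i: "i = 0 \<and> j = 1 \<or> i = m - 1 \<and> j = m - 2" and v: "v \<in> Q (x i)" for i j v
  proof -
    have im: "i < m" using i m6 by linarith
    obtain l where l: "l < m" "v = x l" using Q_I[OF xI[OF im] v] im \<open>x ` {..<m} = I\<close> by auto
    have li: "l \<noteq> i" using Q_subset[of "x i"] v l by auto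
    have "x i \<in> Q (x l)" using Q_sym[OF xI[OF im] v] l by simp
    then have "x i = x (l - 1) \<or> x i = x (l + 1)" if "1 \<le> l" "l + 1 < m" using Qx[OF that] by simp
    then have "i = l - 1 \<or> i = l + 1" if "1 \<le> l" "l + 1 < m"
      using x_eq[of i "l - 1"] x_eq[of i "l + 1"] im that by auto
    then have "l = j \<or> l = m - 1 - i" using i li l(1) by (cases "1 \<le> l \<and> l + 1 < m") auto
    then show ?thesis using l by auto
  qed
  have Q0: "Q (x 0) \<subseteq> {x 1, x (m - 1)}" using end_Q[of 0 1] by auto
  have Qm: "Q (x (m - 1)) \<subseteq> {x (m - 2), x 0}" using end_Q[of "m - 1" "m - 2"] by auto
  have s0: "x 1 \<in> Q (x 0)" using step[of 0] m6 by simp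
  have sm: "x (m - 2) \<in> Q (x (m - 1))" using prev_Q[of "m - 1"] m6 by (simp add: numeral_2_eq_2)
  show ?thesis
  proof (cases "x (m - 1) \<in> Q (x 0)")
    case True
    have "x 0 \<in> Q (x (m - 1))" using Q_sym[OF _ True] xI[of 0] m6 by simp
    then have Qm': "Q (x (m - 1)) = {x (m - 2), x 0}" using sm Qm by auto
    have Q0': "Q (x 0) = {x (m - 1), x 1}" using s0 Q0 True by auto
    have "Q (x i) = {x (if i = 0 then m - 1 else i - 1), x (if Suc i = m then 0 else Suc i)}" if "i < m" for i
    proof -
      consider "i = 0" | "i = m - 1" | "1 \<le> i" "i + 1 < m" using \<open>i < m\<close> by linarith
      then show ?thesis
      proof cases
        case 1 then show ?thesis using Q0' m6 by simp
      next
        case 2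
        then have "i \<noteq> 0" "Suc i = m" "i - 1 = m - 2" using m6 by linarith+
        then show ?thesis using Qm' 2 by simp
      next
        case 3 then show ?thesis using Qx[OF 3] by simp
      qed
    qed
    from cycle_structure[OF m inj im this] show ?thesis using m6 by (intro disjI2 exI[of _ m]) simp
  next
    case False
    then have Q0': "Q (x 0) = {x 1}" using s0 Q0 by auto
    have "x 0 \<notin> Q (x (m - 1))" using Q_sym[of "x (m - 1)" "x 0"] xI[of "m - 1"] m6 False by auto
    then have Qm': "Q (x (m - 1)) = {x (m - 2)}" using sm Qm by auto
    from path_structure[OF m inj im Qx Q0' Qm'] show ?thesis by (rule disjI1)
  qed
qed

end

section \<open>Graphs and matchings\<close>

definition nbh :: "'a ugraph \<Rightarrow> 'a \<Rightarrow> 'a set" where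
  "nbh G v = {u. {u, v} \<in> edges G}"

lemma edge_pair:
  assumes "simple_graph G" "e \<in> edges G" "v \<in> e"
  obtains u where "e = {u, v}" "u \<noteq> v" "u \<in> verts G" "v \<in> verts G"
proof -
  have "card e = 2" and sub: "e \<subseteq> verts G" using assms(1,2) by (auto simp: simple_graph_def)
  then obtain a b where ab: "e = {a, b}" "a \<noteq> b" by (auto simp: card_2_iff)
  show ?thesis
  proof (cases "v = b")
    case True then show ?thesis using that[of a] ab sub by simp
  next
    case False
    then have "v = a" using assms(3) ab by simp
    then show ?thesis using that[of b] ab sub by (simp add: insert_commute)
  qed
qed

lemma finite_edges: "simple_graph G \<Longrightarrow> finite (edges G)"
  unfolding simple_graph_def by (meson Pow_iff finite_Pow_iff finite_subset subsetI)

lemma nbh_sym: "u \<in> nbh G v \<Longrightarrow> v \<in> nbh G u"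
  by (simp add: nbh_def insert_commute)

lemma nbh_verts: "simple_graph G \<Longrightarrow> u \<in> nbh G v \<Longrightarrow> u \<in> verts G"
  by (auto simp: nbh_def simple_graph_def)

lemma nbh_irrefl: "simple_graph G \<Longrightarrow> v \<notin> nbh G v"
  by (auto simp: nbh_def simple_graph_def)

lemma finite_nbh: "simple_graph G \<Longrightarrow> finite (nbh G v)"
  using nbh_verts finite_subset unfolding simple_graph_def by (metis subsetI simple_graph_def nbh_verts)

lemma degree_eq:
  assumes "simple_graph G" shows "degree G v = card (nbh G v)"
proof -
  have "{e \<in> edges G. v \<in> e} = (\<lambda>u. {u, v}) ` nbh G v"
  proof
    show "{e \<in> edges G. v \<in> e} \<subseteq> (\<lambda>u. {u, v}) ` nbh G v"
    proof
      fix e assume "e \<in> {e \<in> edges G. v \<in> e}"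
      then have e: "e \<in> edges G" "v \<in> e" by auto
      obtain u where "e = {u, v}" by (rule edge_pair[OF assms e])
      then show "e \<in> (\<lambda>u. {u, v}) ` nbh G v" using e by (auto simp: nbh_def)
    qed
    show "(\<lambda>u. {u, v}) ` nbh G v \<subseteq> {e \<in> edges G. v \<in> e}" by (auto simp: nbh_def)
  qed
  moreover have "inj_on (\<lambda>u. {u, v}) (nbh G v)" by (auto simp: inj_on_def doubleton_eq_iff)
  ultimately show ?thesis by (simp add: degree_def card_image)
qed

section \<open>Consequences of 2-connectedness\<close>

lemma connected_closed:
  assumes "connected_graph H" "D \<subseteq> verts H" "D \<noteq> {}"
    and cl: "\<And>v u. v \<in> D \<Longrightarrow> {v, u} \<in> edges H \<Longrightarrow> u \<in> D"
  shows "D = verts H"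
proof -
  obtain d where d: "d \<in> D" using assms(3) by auto
  have "y \<in> D" if "(x, y) \<in> {(a, b). {a, b} \<in> edges H}\<^sup>*" "x \<in> D" for x y
    using that by (induction rule: rtrancl_induct) (use cl in auto)
  then show ?thesis using assms(1,2) d unfolding connected_graph_def by blast
qed

text \<open>With \<open>X\<close> empty this yields connectedness, with a single vertex it excludes
  cut vertices.\<close>

lemma two_connected_closed:
  assumes "k_connected 2 G" "D \<subseteq> verts G - X" "D \<noteq> {}" "X \<subseteq> verts G" "card X < 2"
    and cl: "\<And>v u. v \<in> D \<Longrightarrow> u \<in> nbh G v \<Longrightarrow> u \<notin> X \<Longrightarrow> u \<in> D"
  shows "D = verts G - X"
proof -
  have "D = verts (induced_on G (verts G - X))"
  proof (rule connected_closed)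
    show "connected_graph (induced_on G (verts G - X))"
      using assms(1,4,5) by (simp add: k_connected_def)
    show "D \<subseteq> verts (induced_on G (verts G - X))" using assms(2) by (auto simp: induced_on_def)
    fix v u assume "v \<in> D" "{v, u} \<in> edges (induced_on G (verts G - X))"
    then show "u \<in> D" using cl[of v u] by (auto simp: induced_on_def nbh_def insert_commute)
  qed (rule assms(3))
  then show ?thesis by (auto simp: induced_on_def)
qed

lemma two_connected_deg:
  assumes G: "simple_graph G" "k_connected 2 G" and v: "v \<in> verts G"
  shows "2 \<le> card (nbh G v)"
proof (rule ccontr)
  assume "\<not> ?thesis"
  then have "card (nbh G v) \<le> Suc 0" by simp
  then have eq: "\<forall>a\<in>nbh G v. \<forall>b\<in>nbh G v. a = b" using card_le_Suc0_iff_eq[OF finite_nbh[OF G(1)]] by blast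
  define y where "y = (SOME y. y \<in> nbh G v)"
  have y: "nbh G v \<subseteq> {y}" unfolding y_def using eq by (metis insertI1 someI subsetI)
  \<comment> \<open>If \<open>v\<close> is isolated, \<open>y\<close> is an arbitrary value,
    possibly \<open>v\<close> or no vertex at all; the intersection and the difference keep
    \<open>X\<close> a set of at most one vertex other than \<open>v\<close>.\<close>
  define X where "X = {y} \<inter> verts G - {v}"
  have "{v} = verts G - X"
  proof (rule two_connected_closed[OF G(2)])
    have "card X \<le> card {y}" unfolding X_def by (rule card_mono) auto
    then show "card X < 2" by simp
    show "u \<in> {v}" if "w \<in> {v}" "u \<in> nbh G w" "u \<notin> X" for w u
      using that y nbh_verts[OF G(1)] by (auto simp: X_def)
  qed (use v in \<open>auto simp: X_def\<close>)
  then have "verts G \<subseteq> {v, y}" by (auto simp: X_def)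
  then have "card (verts G) \<le> card {v, y}" by (intro card_mono) auto
  also have "\<dots> \<le> 2" using card_length[of "[v, y]"] by simp
  finally show False using G(2) by (simp add: k_connected_def)
qed

text \<open>Removing \<open>x\<close> would leave \<open>p\<close> and \<open>q\<close> closed under
  adjacency, although a fourth vertex exists.\<close>

lemma two_connected_no_cut:
  assumes G: "simple_graph G" "k_connected 2 G" "3 < card (verts G)"
    and p: "p \<in> verts G" and np: "nbh G p \<subseteq> {q, x}" and nq: "nbh G q \<subseteq> {p, x}"
  shows False
proof -
  have "card (nbh G p) \<ge> 2" by (rule two_connected_deg[OF G(1,2) p])
  moreover have "card {q, x} \<le> 2" using card_length[of "[q, x]"] by simp
  ultimately have nbp: "nbh G p = {q, x}" by (intro card_seteq[OF _ np]) auto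
  then have "card {q, x} = 2" using \<open>card (nbh G p) \<ge> 2\<close> \<open>card {q, x} \<le> 2\<close> by simp
  then have qx: "q \<noteq> x" by auto
  have q: "q \<in> verts G" "x \<in> verts G" "x \<noteq> p"
    using nbp nbh_verts[OF G(1), of _ p] nbh_irrefl[OF G(1), of p] by auto
  have "{p, q} = verts G - {x}"
  proof (rule two_connected_closed[OF G(2)])
    fix v u assume "v \<in> {p, q}" "u \<in> nbh G v" "u \<notin> {x}"
    then show "u \<in> {p, q}" using np nq by blast
  qed (use p q qx in auto)
  then have "verts G \<subseteq> {p, q, x}" by blast
  then have "card (verts G) \<le> card {p, q, x}" by (intro card_mono) auto
  also have "\<dots> \<le> 3" using card_length[of "[p, q, x]"] by simp
  finally show False using G(3) by simp
qed

section \<open>Matchings as sets of edges\<close>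

lemma matching_edge_eq: "matching G M \<Longrightarrow> e \<in> M \<Longrightarrow> f \<in> M \<Longrightarrow> v \<in> e \<Longrightarrow> v \<in> f \<Longrightarrow> e = f"
  by (auto simp: matching_def)

lemma matching_subset_eq:
  assumes G: "simple_graph G" and M: "matching G M" and N: "N \<subseteq> M" "\<Union>M \<subseteq> \<Union>N"
  shows "N = M"
proof
  show "M \<subseteq> N"
  proof
    fix e assume e: "e \<in> M"
    then have "card e = 2" using M G by (auto simp: matching_def simple_graph_def)
    then obtain v where v: "v \<in> e" by fastforce
    then obtain f where f: "f \<in> N" "v \<in> f" using e N(2) by blast
    then have "e = f" using matching_edge_eq[OF M e, of f v] N(1) v by blast
    then show "e \<in> N" using f by simp
  qed
qed (rule N(1))

lemma matching_verts:
  assumes "simple_graph G" "matching G M" shows "\<Union>M \<subseteq> verts G"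
proof (rule Union_least)
  fix e assume "e \<in> M"
  then have "e \<in> edges G" using assms(2) unfolding matching_def by blast
  then show "e \<subseteq> verts G" using assms(1) unfolding simple_graph_def by blast
qed

lemma perfect_matching_induced_iff:
  assumes G: "simple_graph G" and M: "matching G M"
  shows "perfect_matching (induced_on G (\<Union>M)) N \<longleftrightarrow> matching G N \<and> \<Union>N = \<Union>M"
proof -
  have v: "verts (induced_on G (\<Union>M)) = \<Union>M"
    using matching_verts[OF assms] unfolding induced_on_def ugraph.select_convs by (rule Int_absorb1)
  have "N \<subseteq> edges (induced_on G (\<Union>M)) \<longleftrightarrow> N \<subseteq> edges G" if "\<Union>N = \<Union>M"
  proof -
    have "e \<subseteq> \<Union>M" if "e \<in> N" for e using that unfolding \<open>\<Union>N = \<Union>M\<close>[symmetric] by (rule Union_upper)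
    then show ?thesis by (auto simp: induced_on_def)
  qed
  then show ?thesis unfolding perfect_matching_def v matching_def
    by (cases "\<Union>N = \<Union>M") (simp_all only: simp_thms)
qed

lemma ur_matching_iff:
  assumes G: "simple_graph G"
  shows "uniquely_restricted_matching G M \<longleftrightarrow>
    matching G M \<and> (\<forall>N. matching G N \<longrightarrow> \<Union>N = \<Union>M \<longrightarrow> N = M)"
proof (cases "matching G M")
  case M: True
  define A where "A N \<longleftrightarrow> matching G N \<and> \<Union>N = \<Union>M" for N
  have "A M" using M by (simp add: A_def)
  then have "(\<forall>N. A N \<longleftrightarrow> N = M) \<longleftrightarrow> (\<forall>N. A N \<longrightarrow> N = M)" by blast
  then show ?thesis using M
    unfolding uniquely_restricted_matching_def perfect_matching_induced_iff[OF G M] A_def imp_conjL by simp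
qed (simp add: uniquely_restricted_matching_def)

lemma induced_matching_iff:
  assumes G: "simple_graph G"
  shows "induced_matching G M \<longleftrightarrow> matching G M \<and> (\<forall>e\<in>edges G. e \<subseteq> \<Union>M \<longrightarrow> e \<in> M)"
proof (cases "matching G M")
  case M: True
  have sub: "\<Union>M \<subseteq> verts G" by (rule matching_verts[OF G M])
  have ME: "M \<subseteq> edges G" using M by (simp add: matching_def)
  define D where "D v = {e \<in> edges (induced_on G (\<Union>M)). v \<in> e}" for v
  have D: "D v = {e \<in> edges G. e \<subseteq> \<Union>M \<and> v \<in> e}" for v by (auto simp: D_def induced_on_def)
  have reg: "regular 1 (induced_on G (\<Union>M)) \<longleftrightarrow> (\<forall>v\<in>\<Union>M. card (D v) = 1)"
    using sub by (auto simp: regular_def degree_def D_def induced_on_def Int_absorb1)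
  show ?thesis
  proof
    assume "induced_matching G M"
    then have c: "\<forall>v\<in>\<Union>M. card (D v) = 1" unfolding induced_matching_def reg by (rule conjunct2)
    have "e \<in> M" if e: "e \<in> edges G" "e \<subseteq> \<Union>M" for e
    proof -
      have "card e = 2" using G e by (auto simp: simple_graph_def)
      then obtain v where v: "v \<in> e" by fastforce
      then obtain f where f: "f \<in> M" "v \<in> f" using e by blast
      have "e \<in> D v" "f \<in> D v" using e v f ME by (auto simp: D)
      moreover have "card (D v) = 1" using c v e by blast
      ultimately have "e = f" by (metis card_1_singletonE singletonD)
      then show ?thesis using f by simp
    qed
    then show "matching G M \<and> (\<forall>e\<in>edges G. e \<subseteq> \<Union>M \<longrightarrow> e \<in> M)" using M by blast
  next
    assume a: "matching G M \<and> (\<forall>e\<in>edges G. e \<subseteq> \<Union>M \<longrightarrow> e \<in> M)"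
    have "card (D v) = 1" if v: "v \<in> \<Union>M" for v
    proof -
      obtain e where e: "e \<in> M" "v \<in> e" using v by blast
      have "D v = {e}"
      proof
        show "{e} \<subseteq> D v" using e ME by (auto simp: D)
        show "D v \<subseteq> {e}"
        proof
          fix f assume "f \<in> D v"
          then have "f \<in> M" "v \<in> f" using a by (auto simp: D)
          then show "f \<in> {e}" using matching_edge_eq[OF M _ e(1), of f v] e by simp
        qed
      qed
      then show ?thesis by simp
    qed
    then show "induced_matching G M" using M unfolding induced_matching_def reg by blast
  qed
qed (simp add: induced_matching_def)

text \<open>Every edge inside the covered set belongs to \<open>M\<close>, so a competing perfect
  matching is a subset of \<open>M\<close> covering the same vertices.\<close>

lemma induced_imp_ur:
  assumes G: "simple_graph G" and M: "induced_matching G M"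
  shows "uniquely_restricted_matching G M"
proof -
  have m: "matching G M" and ind: "\<forall>e\<in>edges G. e \<subseteq> \<Union>M \<longrightarrow> e \<in> M"
    using M by (simp_all add: induced_matching_iff[OF G])
  have "N = M" if N: "matching G N" "\<Union>N = \<Union>M" for N
  proof (rule matching_subset_eq[OF G m])
    show "N \<subseteq> M"
    proof
      fix e assume e: "e \<in> N"
      then have "e \<in> edges G" using N(1) unfolding matching_def by blast
      moreover have "e \<subseteq> \<Union>M" unfolding N(2)[symmetric] using e by (rule Union_upper)
      ultimately show "e \<in> M" using ind by blast
    qed
    show "\<Union>M \<subseteq> \<Union>N" using N by simp
  qed
  then show ?thesis using m by (simp add: ur_matching_iff[OF G])
qed

lemma finite_matching_cards:
  assumes G: "simple_graph G"
  shows "finite (card ` {M. induced_matching G M})" "finite (card ` {M. uniquely_restricted_matching G M})"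
proof -
  have "{M. matching G M} \<subseteq> Pow (edges G)" by (auto simp: matching_def)
  then have "finite {M. matching G M}" using finite_edges[OF G] finite_subset by blast
  then show "finite (card ` {M. induced_matching G M})" "finite (card ` {M. uniquely_restricted_matching G M})"
    by (auto intro!: finite_imageI elim!: rev_finite_subset
        simp: induced_matching_def uniquely_restricted_matching_def)
qed

lemma empty_induced: "simple_graph G \<Longrightarrow> induced_matching G {}"
  by (auto simp: induced_matching_iff matching_def simple_graph_def)

lemma nu_s_ge: "simple_graph G \<Longrightarrow> induced_matching G M \<Longrightarrow> card M \<le> nu_s G"
  unfolding nu_s_def by (rule Max_ge) (auto simp: finite_matching_cards)

lemma nu_ur_ge: "simple_graph G \<Longrightarrow> uniquely_restricted_matching G M \<Longrightarrow> card M \<le> nu_ur G"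
  unfolding nu_ur_def by (rule Max_ge) (auto simp: finite_matching_cards)

lemma nu_s_witness:
  assumes G: "simple_graph G" shows "\<exists>M. induced_matching G M \<and> card M = nu_s G"
proof -
  have "nu_s G \<in> card ` {M. induced_matching G M}"
    unfolding nu_s_def by (rule Max_in) (use empty_induced[OF G] finite_matching_cards[OF G] in auto)
  then show ?thesis by auto
qed

lemma nu_ur_witness:
  assumes G: "simple_graph G" shows "\<exists>M. uniquely_restricted_matching G M \<and> card M = nu_ur G"
proof -
  have "nu_ur G \<in> card ` {M. uniquely_restricted_matching G M}"
    unfolding nu_ur_def
    by (rule Max_in) (use induced_imp_ur[OF G empty_induced[OF G]] finite_matching_cards[OF G] in auto)
  then show ?thesis by auto
qed

lemma nu_s_le_nu_ur: "simple_graph G \<Longrightarrow> nu_s G \<le> nu_ur G"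
  using nu_s_witness induced_imp_ur nu_ur_ge by metis

section \<open>Maximum induced matchings that are maximum uniquely restricted\<close>

locale equal_numbers =
  fixes G :: "'a ugraph" and M :: "'a set set"
  assumes G: "simple_graph G"
    and M: "induced_matching G M" and max: "card M = nu_ur G"
begin

definition mt :: "'a \<Rightarrow> 'a" where
  "mt p = (SOME q. {p, q} \<in> M)"

lemma match: "matching G M" and ind: "e \<in> edges G \<Longrightarrow> e \<subseteq> \<Union>M \<Longrightarrow> e \<in> M"
  using M unfolding induced_matching_iff[OF G] by blast+

lemma M_edges: "M \<subseteq> edges G"
  using match unfolding matching_def by blast

lemma mt_edge: assumes "p \<in> \<Union>M" shows "{p, mt p} \<in> M"
proof -
  obtain e where e: "e \<in> M" "p \<in> e" using assms by (rule UnionE)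
  obtain q where "e = {q, p}" by (rule edge_pair[OF G _ e(2)]) (use e M_edges in auto)
  then have "{p, q} \<in> M" using e(1) by (simp add: insert_commute)
  then show ?thesis unfolding mt_def by (rule someI)
qed

lemma M_eq: "{p, q} \<in> M \<Longrightarrow> q = mt p"
proof -
  assume a: "{p, q} \<in> M"
  then have "p \<in> \<Union>M" by (rule UnionI) simp
  then have "{p, q} = {p, mt p}" using matching_edge_eq[OF match a mt_edge, of p p] by simp
  then show ?thesis by (auto simp: doubleton_eq_iff)
qed

lemma mt_cover: "p \<in> \<Union>M \<Longrightarrow> mt p \<in> \<Union>M"
  using UnionI[OF mt_edge[of p], of "mt p"] by simp

lemma mt_mt: "p \<in> \<Union>M \<Longrightarrow> mt (mt p) = p"
  using M_eq[of "mt p" p] mt_edge[of p] by (simp add: insert_commute)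

lemma mt_nbh: "p \<in> \<Union>M \<Longrightarrow> mt p \<in> nbh G p"
  using mt_edge[of p] M_edges by (auto simp: nbh_def insert_commute)

lemma cover_nbh:
  assumes "p \<in> \<Union>M" "u \<in> nbh G p" "u \<noteq> mt p"
  shows "u \<in> verts G - \<Union>M"
proof -
  have "{u, p} \<in> edges G" using assms(2) by (simp add: nbh_def)
  have "u \<notin> \<Union>M"
  proof
    assume "u \<in> \<Union>M"
    then have "{u, p} \<subseteq> \<Union>M" using assms(1) by simp
    then have "{p, u} \<in> M" using ind[OF \<open>{u, p} \<in> edges G\<close>] by (simp add: insert_commute)
    then show False using M_eq assms(3) by blast
  qed
  then show ?thesis using nbh_verts[OF G assms(2)] by simp
qed

text \<open>Two uncovered vertices joined by an augmenting path are joined by a second one: otherwise the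
  augmented matching is the only perfect matching on its vertex set.\<close>

lemma second_link:
  assumes u: "u \<in> verts G - \<Union>M" and p: "p \<in> nbh G u"
    and v: "v \<in> branch (verts G - \<Union>M) (nbh G) mt u p"
  shows "\<exists>p'\<in>nbh G u. p' \<noteq> p \<and> v \<in> branch (verts G - \<Union>M) (nbh G) mt u p'"
proof (rule ccontr)
  define I where "I = verts G - \<Union>M"
  assume "\<not> ?thesis"
  then have uniq: "p' = p" if "p' \<in> nbh G u" "v \<in> branch I (nbh G) mt u p'" for p'
    using that unfolding I_def by blast
  have uI: "u \<in> I" and vb: "v \<in> branch I (nbh G) mt u p" using u v by (simp_all add: I_def)
  have up: "{u, p} \<in> edges G" using nbh_sym[OF p] by (simp add: nbh_def)
  have pV: "p \<in> verts G" by (rule nbh_verts[OF G p])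
  have unp: "u \<noteq> p" using nbh_irrefl[OF G] p by blast
  have uM: "u \<notin> e" if "e \<in> M" for e using that u by auto
  \<comment> \<open>\<open>M\<close> augmented along the link from \<open>u\<close> to
    \<open>v\<close>: the link is a single edge if \<open>p\<close> is uncovered, and otherwise the
    middle edge of a path of three edges is exchanged for the two outer ones.\<close>
  define M' where "M' = (if p \<in> I then insert {u, p} M else insert {u, p} (insert {mt p, v} (M - {{p, mt p}})))"
  have pI: "v = p" if "p \<in> I" using vb that by (simp add: branch_def)
  have pJ: "p \<in> \<Union>M" "v \<in> nbh G (mt p)" "v \<noteq> p" "v \<noteq> u" if "p \<notin> I"
  proof -
    have "v \<in> nbh G (mt p) - {p, u}" using vb that by (simp add: branch_def)
    then show "v \<in> nbh G (mt p)" "v \<noteq> p" "v \<noteq> u" by simp_all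
    show "p \<in> \<Union>M" using pV that unfolding I_def by blast
  qed
  have vI: "v \<in> I"
  proof (cases "p \<in> I")
    case False
    show ?thesis unfolding I_def
      using cover_nbh[OF mt_cover[OF pJ(1)[OF False]] pJ(2)[OF False]] mt_mt[OF pJ(1)[OF False]] pJ(3)[OF False] by simp
  qed (use pI in simp)
  have vM: "v \<notin> e" if "e \<in> M" for e using that vI by (auto simp: I_def)
  have uv: "u \<noteq> v" using pI pJ(4) unp by (cases "p \<in> I") auto
  have cover_M: "\<Union>M' = insert u (insert v (\<Union>M))"
  proof (cases "p \<in> I")
    case True then show ?thesis using pI by (simp add: M'_def)
  next
    case False
    have "\<Union>M = \<Union>(insert {p, mt p} (M - {{p, mt p}}))"
      using mt_edge[OF pJ(1)[OF False]] by (simp add: insert_absorb)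
    then show ?thesis using False by (auto simp: M'_def)
  qed
  have disjM: "e \<inter> f = {}" if "e \<in> M" "f \<in> M" "e \<noteq> f" for e f
    using match that by (auto simp: matching_def)
  have M'_match: "matching G M'"
  proof (cases "p \<in> I")
    case True
    have "{u, p} \<inter> e = {}" if "e \<in> M" for e using uM[OF that] vM[OF that] pI[OF True] by simp
    then show ?thesis using True up M_edges disjM unfolding M'_def matching_def by (auto simp: Int_commute)
  next
    case False
    note pJ = pJ[OF False]
    have e0: "{p, mt p} \<in> M" by (rule mt_edge[OF pJ(1)])
    have vm: "{mt p, v} \<in> edges G" using nbh_sym[OF pJ(2)] by (simp add: nbh_def)
    have pm: "p \<noteq> mt p" using mt_nbh[OF pJ(1)] nbh_irrefl[OF G, of p] by auto
    have mI: "mt p \<noteq> u" using mt_cover[OF pJ(1)] u by auto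
    have d: "{u, p} \<inter> e = {}" "{mt p, v} \<inter> e = {}" if "e \<in> M - {{p, mt p}}" for e
      using disjM[OF _ e0, of e] that uM[of e] vM[of e] by auto
    have d2: "{u, p} \<inter> {mt p, v} = {}" using pm mI uv pJ(3) by auto
    show ?thesis unfolding matching_def
    proof (intro conjI ballI impI)
      show "M' \<subseteq> edges G" using False up vm M_edges by (auto simp: M'_def)
      fix e f assume ef: "e \<in> M'" "f \<in> M'" "e \<noteq> f"
      have M'e: "M' = insert {u, p} (insert {mt p, v} (M - {{p, mt p}}))" using False by (simp add: M'_def)
      have "e = {u, p} \<or> e = {mt p, v} \<or> e \<in> M - {{p, mt p}}" "f = {u, p} \<or> f = {mt p, v} \<or> f \<in> M - {{p, mt p}}"
        using ef(1,2) unfolding M'e by simp_all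
      then show "e \<inter> f = {}"
        using d d2 ef(3) disjM[of e f] by (elim disjE) (simp_all add: Int_commute)
    qed
  qed
  have finM: "finite M" using finite_edges[OF G] M_edges finite_subset by blast
  have card_M': "card M' = Suc (card M)"
  proof (cases "p \<in> I")
    case True
    have "{u, p} \<notin> M" using uM[of "{u, p}"] by blast
    then show ?thesis using True finM by (simp add: M'_def)
  next
    case False
    have "{u, p} \<notin> insert {mt p, v} (M - {{p, mt p}})"
      using uM[of "{u, p}"] uv mt_cover[OF pJ(1)[OF False]] u by (auto simp: doubleton_eq_iff)
    moreover have "{mt p, v} \<notin> M - {{p, mt p}}" using vM[of "{mt p, v}"] by auto
    moreover have "{p, mt p} \<in> M" by (rule mt_edge[OF pJ(1)[OF False]])
    then have "Suc (card (M - {{p, mt p}})) = card M" using finM by (metis card_Suc_Diff1)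
    ultimately show ?thesis using False finM by (simp add: M'_def)
  qed
  have "\<not> uniquely_restricted_matching G M'"
    using nu_ur_ge[OF G, of M'] card_M' max by auto
  then obtain N where N: "matching G N" "\<Union>N = \<Union>M'" "N \<noteq> M'"
    using M'_match unfolding ur_matching_iff[OF G] by blast
  have cover_N: "\<Union>N = insert u (insert v (\<Union>M))" using N(2) cover_M by simp
  have N_edges: "N \<subseteq> edges G" using N(1) unfolding matching_def by blast
  have "u \<in> \<Union>N" unfolding cover_N by simp
  then obtain e where e: "e \<in> N" "u \<in> e" by (rule UnionE)
  obtain p' where p': "e = {p', u}" "p' \<noteq> u" by (rule edge_pair[OF G _ e(2)]) (use e N_edges in auto)
  have p'N: "p' \<in> nbh G u" using e p' N_edges by (auto simp: nbh_def)
  have p'c: "p' \<in> insert v (\<Union>M)"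
    using UnionI[OF e(1), of p'] p' unfolding cover_N by auto
  have inM: "f \<in> M" if f: "f \<in> N" "u \<notin> f" "v \<notin> f" for f
  proof (rule ind)
    show "f \<in> edges G" using f(1) N_edges by blast
    have "f \<subseteq> \<Union>N" using f(1) by (rule Union_upper)
    then show "f \<subseteq> \<Union>M" using f(2,3) unfolding cover_N by blast
  qed
  have eN: "f = e" if "f \<in> N" "u \<in> f \<or> p' \<in> f" for f
    using matching_edge_eq[OF N(1) that(1) e(1)] that(2) p' by auto
  \<comment> \<open>The partner \<open>p'\<close> of \<open>u\<close> in \<open>N\<close> starts a
    link to \<open>v\<close>: if \<open>p'\<close> is not \<open>v\<close>, it is covered by
    \<open>M\<close>, and \<open>mt p'\<close> must be matched outside the cover of
    \<open>M\<close>, with \<open>u\<close> already used, so with \<open>v\<close>. Uniqueness of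
    the link gives \<open>p' = p\<close>, and the remaining edges of \<open>N\<close> lie inside the
    cover of \<open>M\<close> and hence in \<open>M\<close>.\<close>
  have "N \<subseteq> M'"
  proof (cases "p' = v")
    case True
    have "v \<in> branch I (nbh G) mt u p'" using True vI by (simp add: branch_def)
    then have p: "p = v" using uniq p'N True by blast
    then have M'e: "M' = insert {u, v} M" using vI by (simp add: M'_def)
    show ?thesis
    proof
      fix f assume f: "f \<in> N"
      show "f \<in> M'"
      proof (cases "u \<in> f \<or> v \<in> f")
        case True
        then have "f = e" using eN[OF f] \<open>p' = v\<close> by simp
        then show ?thesis using p' \<open>p' = v\<close> by (simp add: M'e insert_commute)
      next
        case False
        then show ?thesis using inM[OF f] by (simp add: M'e)
      qed
    qed
  next
    case False
    then have p'M: "p' \<in> \<Union>M" using p'c by blast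
    have "mt p' \<in> \<Union>N" unfolding cover_N using mt_cover[OF p'M] by blast
    then obtain e' where e': "e' \<in> N" "mt p' \<in> e'" by (rule UnionE)
    obtain z where z: "e' = {z, mt p'}" "z \<noteq> mt p'" by (rule edge_pair[OF G _ e'(2)]) (use e' N_edges in auto)
    have zn: "z \<in> nbh G (mt p')" using e' z N_edges by (auto simp: nbh_def)
    have mu: "mt p' \<noteq> u" using mt_cover[OF p'M] u by auto
    have mp': "mt p' \<noteq> p'" using mt_nbh[OF p'M] nbh_irrefl[OF G, of p'] by auto
    have ne: "e' \<noteq> e" using e' z p' mu mp' by (auto simp: doubleton_eq_iff)
    have zu: "z \<noteq> u" "z \<noteq> p'" using eN[OF e'(1)] ne z by auto
    have "z \<in> verts G - \<Union>M" using cover_nbh[OF mt_cover[OF p'M] zn] mt_mt[OF p'M] zu by simp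
    moreover have "z \<in> \<Union>N" using UnionI[OF e'(1), of z] z by simp
    ultimately have zv: "z = v" using zu unfolding cover_N by blast
    have "p' \<notin> I" using p'M by (simp add: I_def)
    then have "v \<in> branch I (nbh G) mt u p'" using zn zv zu by (simp add: branch_def)
    then have pp: "p' = p" using uniq p'N by blast
    have M'e: "M' = insert {u, p} (insert {mt p, v} (M - {{p, mt p}}))"
      using \<open>p' \<notin> I\<close> pp by (simp add: M'_def)
    show ?thesis
    proof
      fix f assume f: "f \<in> N"
      consider "f = e" | "f = e'" | "f \<noteq> e" "f \<noteq> e'" by blast
      then show "f \<in> M'"
      proof cases
        case 1 then show ?thesis using p' pp by (simp add: M'e insert_commute)
      next
        case 2 then show ?thesis using z zv pp by (simp add: M'e insert_commute)
      next
        case 3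
        have "u \<notin> f" "p' \<notin> f" using eN[OF f] 3 by auto
        moreover have "v \<notin> f" using matching_edge_eq[OF N(1) f e'(1), of v] 3 z zv by auto
        ultimately have "f \<in> M" "f \<noteq> {p, mt p}" using inM[OF f] pp by auto
        then show ?thesis by (simp add: M'e)
      qed
    qed
  qed
  then have "N = M'" using matching_subset_eq[OF G M'_match] N(2) by simp
  then show False using N(3) by simp
qed

lemma linked_graph:
  assumes "k_connected 2 G" "subcubic G" "21 \<le> card (verts G)"
  shows "linked_graph (verts G) (verts G - \<Union>M) (\<Union>M) (nbh G) mt"
proof
  have sub: "\<Union>M \<subseteq> verts G" by (rule matching_verts[OF G match])
  show "finite (verts G)" using G by (simp add: simple_graph_def)
  show "verts G = verts G - \<Union>M \<union> \<Union>M" using sub by auto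
  show "(verts G - \<Union>M) \<inter> \<Union>M = {}" by auto
  show nV: "u \<in> verts G" if "u \<in> nbh G v" for u v by (rule nbh_verts[OF G that])
  show "v \<in> nbh G u" if "u \<in> nbh G v" for u v by (rule nbh_sym[OF that])
  show "v \<notin> nbh G v" for v by (rule nbh_irrefl[OF G])
  show "card (nbh G v) \<le> 3" for v
  proof (cases "v \<in> verts G")
    case True then show ?thesis using assms(2) degree_eq[OF G] by (auto simp: subcubic_def)
  next
    case False
    then have "nbh G v = {}" using nV[OF nbh_sym[of _ G v]] by auto
    then show ?thesis by simp
  qed
  show "2 \<le> card (nbh G v)" if "v \<in> verts G" for v by (rule two_connected_deg[OF G assms(1) that])
  show "D = verts G" if "D \<subseteq> verts G" "D \<noteq> {}" "\<And>v u. v \<in> D \<Longrightarrow> u \<in> nbh G v \<Longrightarrow> u \<in> D" for D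
  proof -
    have "D = verts G - {}" by (rule two_connected_closed[OF assms(1)]) (use that in auto)
    then show ?thesis by simp
  qed
  show False if "p \<in> verts G" "nbh G p \<subseteq> {q, x}" "nbh G q \<subseteq> {p, x}" for p q x
    by (rule two_connected_no_cut[OF G assms(1) _ that]) (use assms(3) in simp)
  show "mt p \<in> \<Union>M" "mt (mt p) = p" "mt p \<in> nbh G p" if "p \<in> \<Union>M" for p
    using mt_cover[OF that] mt_mt[OF that] mt_nbh[OF that] .
  show "u \<in> verts G - \<Union>M" if "p \<in> \<Union>M" "u \<in> nbh G p" "u \<noteq> mt p" for p u
    by (rule cover_nbh[OF that])
  show "\<exists>p'\<in>nbh G u. p' \<noteq> p \<and> v \<in> branch (verts G - \<Union>M) (nbh G) mt u p'"
    if "u \<in> verts G - \<Union>M" "p \<in> nbh G u" "v \<in> branch (verts G - \<Union>M) (nbh G) mt u p" for u p v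
    by (rule second_link[OF that])
  show "21 \<le> card (verts G)" by (rule assms(3))
qed

end

section \<open>Isomorphic graphs\<close>

locale graph_map =
  fixes G :: "'a ugraph" and H :: "'b ugraph" and f :: "'a \<Rightarrow> 'b"
  assumes G: "simple_graph G" and H: "simple_graph H"
    and bij: "bij_betw f (verts G) (verts H)"
    and edge: "x \<in> verts G \<Longrightarrow> y \<in> verts G \<Longrightarrow> {x, y} \<in> edges G \<longleftrightarrow> {f x, f y} \<in> edges H"
begin

lemma inj: "inj_on f (verts G)" and im: "f ` verts G = verts H"
  using bij by (auto simp: bij_betw_def)

lemma nbh_map:
  assumes v: "v \<in> verts G" shows "nbh H (f v) = f ` nbh G v"
proof
  show "nbh H (f v) \<subseteq> f ` nbh G v"
  proof
    fix y assume y: "y \<in> nbh H (f v)"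
    then have "y \<in> f ` verts G" using nbh_verts[OF H y] im by simp
    then obtain x where x: "x \<in> verts G" "y = f x" by (rule imageE) simp
    then have "x \<in> nbh G v" using y edge[OF x(1) v] by (simp add: nbh_def)
    then show "y \<in> f ` nbh G v" using x(2) by simp
  qed
  show "f ` nbh G v \<subseteq> nbh H (f v)"
  proof (rule image_subsetI)
    fix x assume x: "x \<in> nbh G v"
    show "f x \<in> nbh H (f v)" using x edge[OF nbh_verts[OF G x] v] by (simp add: nbh_def)
  qed
qed

lemma subcubic_map: "subcubic G \<Longrightarrow> subcubic H"
proof -
  assume s: "subcubic G"
  have "card (nbh H w) \<le> 3" if w: "w \<in> verts H" for w
  proof -
    from w have "w \<in> f ` verts G" using im by simp
    then obtain v where v: "v \<in> verts G" "w = f v" by (rule imageE) simp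
    have "card (nbh H w) \<le> card (nbh G v)"
      unfolding v(2) nbh_map[OF v(1)] by (rule card_image_le[OF finite_nbh[OF G]])
    also have "\<dots> \<le> 3" using s v(1) by (simp add: subcubic_def degree_eq[OF G])
    finally show ?thesis .
  qed
  then show ?thesis by (simp add: subcubic_def degree_eq[OF H])
qed

lemma k_connected_map:
  assumes "k_connected k G" shows "k_connected k H"
  unfolding k_connected_def
proof (intro conjI allI impI)
  show "k < card (verts H)" using assms bij_betw_same_card[OF bij] by (simp add: k_connected_def)
  fix Y assume Y: "Y \<subseteq> verts H \<and> card Y < k"
  define X where "X = {x \<in> verts G. f x \<in> Y}"
  have fX: "f ` X = Y" using Y im by (auto simp: X_def)
  have "card X = card Y" using card_image[OF inj_on_subset[OF inj], of X] fX by (auto simp: X_def)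
  then have c: "connected_graph (induced_on G (verts G - X))"
    using assms Y by (auto simp: k_connected_def X_def)
  let ?G = "induced_on G (verts G - X)" and ?H = "induced_on H (verts H - Y)"
  have vG: "verts ?G = verts G - X" and vH: "verts ?H = verts H - Y" by (auto simp: induced_on_def)
  have vf: "f x \<in> verts H - Y" if "x \<in> verts G - X" for x using that im by (auto simp: X_def)
  have step: "{f x, f y} \<in> edges ?H" if "{x, y} \<in> edges ?G" for x y
  proof -
    have xy: "{x, y} \<in> edges G" "x \<in> verts G - X" "y \<in> verts G - X" using that by (auto simp: induced_on_def)
    then have "{f x, f y} \<in> edges H" using edge[of x y] by simp
    then show ?thesis using vf[OF xy(2)] vf[OF xy(3)] by (simp add: induced_on_def)
  qed
  have path: "(f x, f y) \<in> {(a, b). {a, b} \<in> edges ?H}\<^sup>*" if "(x, y) \<in> {(a, b). {a, b} \<in> edges ?G}\<^sup>*" for x y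
    using that
  proof (induction rule: rtrancl_induct)
    case (step y z)
    have "(f y, f z) \<in> {(a, b). {a, b} \<in> edges ?H}" using \<open>\<And>x y. {x, y} \<in> edges ?G \<Longrightarrow> {f x, f y} \<in> edges ?H\<close> step.hyps(2) by simp
    then show ?case using step.IH by (rule rtrancl_into_rtrancl[rotated])
  qed simp
  have img: "\<exists>x\<in>verts G - X. y = f x" if "y \<in> verts H - Y" for y
  proof -
    have "y \<in> f ` verts G" using that im by simp
    then obtain x where "x \<in> verts G" "y = f x" by (rule imageE) simp
    then show ?thesis using that by (auto simp: X_def)
  qed
  show "connected_graph ?H"
    unfolding connected_graph_def vH
  proof (intro conjI ballI)
    obtain x where "x \<in> verts G - X" using c unfolding connected_graph_def vG by blast
    then show "verts H - Y \<noteq> {}" using vf by blast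
    fix y z assume "y \<in> verts H - Y" "z \<in> verts H - Y"
    then obtain x x' where x: "x \<in> verts G - X" "y = f x" "x' \<in> verts G - X" "z = f x'" using img by blast
    then have "(x, x') \<in> {(a, b). {a, b} \<in> edges ?G}\<^sup>*" using c unfolding connected_graph_def vG by blast
    then show "(y, z) \<in> {(a, b). {a, b} \<in> edges ?H}\<^sup>*" using path x by simp
  qed
qed

section \<open>Transport of edges and matchings along an isomorphism\<close>

lemma edges_map: "edges H = (`) f ` edges G"
proof
  show "edges H \<subseteq> (`) f ` edges G"
  proof
    fix e assume e: "e \<in> edges H"
    then have "card e = 2" "e \<subseteq> verts H" using H by (auto simp: simple_graph_def)
    then obtain a b where ab: "e = {a, b}" "a \<in> f ` verts G" "b \<in> f ` verts G" using im by (auto simp: card_2_iff)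
    then obtain x y where "x \<in> verts G" "a = f x" "y \<in> verts G" "b = f y" by (elim imageE)
    then show "e \<in> (`) f ` edges G" using edge[of x y] e ab(1) by (intro image_eqI[of _ _ "{x, y}"]) simp_all
  qed
  show "(`) f ` edges G \<subseteq> edges H"
  proof (rule image_subsetI)
    fix e assume e: "e \<in> edges G"
    then have "card e = 2" "e \<subseteq> verts G" using G by (auto simp: simple_graph_def)
    then obtain a b where "e = {a, b}" "a \<in> verts G" "b \<in> verts G" by (auto simp: card_2_iff)
    then show "f ` e \<in> edges H" using edge[of a b] e by simp
  qed
qed

lemma edge_sub: "e \<in> edges G \<Longrightarrow> e \<subseteq> verts G"
  using G by (simp add: simple_graph_def)

lemma image_subD:
  assumes "A \<subseteq> verts G" "C \<subseteq> verts G" "f ` A \<subseteq> f ` C" shows "A \<subseteq> C"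
proof
  fix x assume x: "x \<in> A"
  then have "f x \<in> f ` C" using assms(3) by blast
  then obtain y where y: "y \<in> C" "f x = f y" by (rule imageE) simp
  then have "x = y" using inj_onD[OF inj y(2)] x assms(1,2) by blast
  then show "x \<in> C" using y(1) by simp
qed

lemma image_eq_iff: "A \<subseteq> verts G \<Longrightarrow> C \<subseteq> verts G \<Longrightarrow> f ` A = f ` C \<longleftrightarrow> A = C"
  by (rule inj_on_image_eq_iff[OF inj])

lemma matching_map:
  assumes "M \<subseteq> edges G"
  shows "matching H ((`) f ` M) \<longleftrightarrow> matching G M"
proof -
  have sub: "e \<subseteq> verts G" if "e \<in> M" for e using that assms edge_sub by blast
  have pw: "(f ` e \<noteq> f ` e' \<longrightarrow> f ` e \<inter> f ` e' = {}) \<longleftrightarrow> (e \<noteq> e' \<longrightarrow> e \<inter> e' = {})" if "e \<in> M" "e' \<in> M" for e e'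
    using image_eq_iff[OF sub[OF that(1)] sub[OF that(2)]]
      inj_on_image_Int[OF inj sub[OF that(1)] sub[OF that(2)], symmetric] by simp
  have img: "(`) f ` M \<subseteq> edges H" unfolding edges_map by (rule image_mono[OF assms])
  show ?thesis
  proof
    assume m: "matching H ((`) f ` M)"
    show "matching G M" unfolding matching_def
    proof (intro conjI ballI assms)
      fix e e' assume e: "e \<in> M" "e' \<in> M"
      have "f ` e \<noteq> f ` e' \<longrightarrow> f ` e \<inter> f ` e' = {}" using m e unfolding matching_def by simp
      then show "e \<noteq> e' \<longrightarrow> e \<inter> e' = {}" using pw[OF e] by simp
    qed
  next
    assume m: "matching G M"
    show "matching H ((`) f ` M)" unfolding matching_def
    proof (intro conjI ballI img)
      fix a a' assume "a \<in> (`) f ` M" "a' \<in> (`) f ` M"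
      then obtain e e' where e: "e \<in> M" "a = f ` e" "e' \<in> M" "a' = f ` e'" by (elim imageE)
      have "e \<noteq> e' \<longrightarrow> e \<inter> e' = {}" using m e(1,3) unfolding matching_def by simp
      then show "a \<noteq> a' \<longrightarrow> a \<inter> a' = {}" using pw[OF e(1,3)] unfolding e(2,4) by simp
    qed
  qed
qed

lemma Union_map: "\<Union>((`) f ` M) = f ` \<Union>M"
  by blast

lemma card_map:
  assumes "M \<subseteq> edges G" shows "card ((`) f ` M) = card M"
proof (rule card_image, rule inj_onI)
  fix e e' assume "e \<in> M" "e' \<in> M" "f ` e = f ` e'"
  then show "e = e'" using image_eq_iff[of e e'] edge_sub assms by blast
qed

lemma induced_map:
  assumes "induced_matching G M" shows "induced_matching H ((`) f ` M)"
proof -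
  have m: "matching G M" and ind: "\<And>e. e \<in> edges G \<Longrightarrow> e \<subseteq> \<Union>M \<Longrightarrow> e \<in> M"
    using assms unfolding induced_matching_iff[OF G] by blast+
  have sub: "M \<subseteq> edges G" using m unfolding matching_def by blast
  have "e' \<in> (`) f ` M" if "e' \<in> edges H" "e' \<subseteq> f ` \<Union>M" for e'
  proof -
    from that(1) obtain e where e: "e \<in> edges G" "e' = f ` e" unfolding edges_map by (rule imageE) simp
    then have "e \<subseteq> \<Union>M" using that(2) image_subD[OF edge_sub[OF e(1)] matching_verts[OF G m]] by simp
    then show ?thesis using ind e by simp
  qed
  then show ?thesis unfolding induced_matching_iff[OF H] Union_map using matching_map[OF sub] m by simp
qed

lemma ur_map:
  assumes "uniquely_restricted_matching G M" shows "uniquely_restricted_matching H ((`) f ` M)"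
proof -
  have m: "matching G M" and uniq: "\<And>N. matching G N \<Longrightarrow> \<Union>N = \<Union>M \<Longrightarrow> N = M"
    using assms unfolding ur_matching_iff[OF G] by blast+
  have sub: "M \<subseteq> edges G" using m unfolding matching_def by blast
  have "N' = (`) f ` M" if N': "matching H N'" "\<Union>N' = f ` \<Union>M" for N'
  proof -
    have "N' \<subseteq> (`) f ` edges G" using N'(1) edges_map unfolding matching_def by simp
    then obtain N where N: "N \<subseteq> edges G" "N' = (`) f ` N" unfolding subset_image_iff by (elim exE conjE)
    have mN: "matching G N" using N'(1) unfolding N(2) matching_map[OF N(1)] .
    have "f ` \<Union>N = f ` \<Union>M" using N'(2) unfolding N(2) Union_map .
    then have "\<Union>N = \<Union>M" using image_eq_iff[OF matching_verts[OF G mN] matching_verts[OF G m]] by simp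
    then show ?thesis using uniq[OF mN] N(2) by simp
  qed
  then show ?thesis unfolding ur_matching_iff[OF H] Union_map using matching_map[OF sub] m by simp
qed

lemma nu_s_le: "nu_s G \<le> nu_s H"
proof -
  obtain M where M: "induced_matching G M" "card M = nu_s G" using nu_s_witness[OF G] by blast
  have "M \<subseteq> edges G" using M(1) unfolding induced_matching_def matching_def by blast
  then show ?thesis using nu_s_ge[OF H induced_map[OF M(1)]] card_map M(2) by simp
qed

lemma nu_ur_le: "nu_ur G \<le> nu_ur H"
proof -
  obtain M where M: "uniquely_restricted_matching G M" "card M = nu_ur G" using nu_ur_witness[OF G] by blast
  have "M \<subseteq> edges G" using M(1) unfolding uniquely_restricted_matching_def matching_def by blast
  then show ?thesis using nu_ur_ge[OF H ur_map[OF M(1)]] card_map M(2) by simp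
qed

lemma graph_map_inv: "graph_map H G (inv_into (verts G) f)"
proof
  let ?h = "inv_into (verts G) f"
  show "bij_betw ?h (verts H) (verts G)" by (rule bij_betw_inv_into[OF bij])
  fix x y assume xy: "x \<in> verts H" "y \<in> verts H"
  have "?h x \<in> verts G" "?h y \<in> verts G" using xy inv_into_into[of _ f "verts G"] im by auto
  moreover have "f (?h x) = x" "f (?h y) = y" using xy f_inv_into_f[of _ f "verts G"] im by auto
  ultimately show "{x, y} \<in> edges H \<longleftrightarrow> {?h x, ?h y} \<in> edges G" using edge[of "?h x" "?h y"] by simp
qed (rule G H)+

lemma iso: "graph_iso G H"
  unfolding graph_iso_def using bij edge by blast

end

lemma graph_iso_map: "graph_iso G H \<Longrightarrow> simple_graph G \<Longrightarrow> simple_graph H \<Longrightarrow> \<exists>f. graph_map G H f"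
  unfolding graph_iso_def graph_map_def by blast

lemma graph_iso_nu:
  assumes "simple_graph G" "simple_graph H" "graph_iso G H"
  shows "nu_s G = nu_s H" "nu_ur G = nu_ur H"
proof -
  obtain f where f: "graph_map G H f" using graph_iso_map assms by blast
  note f' = graph_map.graph_map_inv[OF f]
  show "nu_s G = nu_s H" "nu_ur G = nu_ur H"
    using graph_map.nu_s_le[OF f] graph_map.nu_s_le[OF f'] graph_map.nu_ur_le[OF f] graph_map.nu_ur_le[OF f'] by simp_all
qed

section \<open>Parity of the number of perfect matchings\<close>

lemma even_card_involution:
  assumes "finite A" "\<And>a. a \<in> A \<Longrightarrow> f a \<in> A \<and> f (f a) = a \<and> f a \<noteq> a"
  shows "even (card A)"
  using assms
proof (induction A rule: finite_psubset_induct)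
  case (psubset A)
  show ?case
  proof (cases "A = {}")
    case False
    then obtain a where a: "a \<in> A" by auto
    note fa = psubset.prems[OF a]
    define C where "C = A - {a, f a}"
    have "even (card C)"
    proof (rule psubset.IH)
      show "C \<subset> A" using a by (auto simp: C_def)
      fix c assume c: "c \<in> C"
      then have cA: "c \<in> A" and "c \<noteq> a" "c \<noteq> f a" by (auto simp: C_def)
      note fc = psubset.prems[OF cA]
      have "f c \<noteq> a" using fc \<open>c \<noteq> f a\<close> by auto
      moreover have "f c \<noteq> f a" using fc fa \<open>c \<noteq> a\<close> by metis
      ultimately show "f c \<in> C \<and> f (f c) = c \<and> f c \<noteq> c" using fc by (simp add: C_def)
    qed
    moreover have "card A = card C + 2"
    proof -
      have "card {a, f a} = 2" using fa by auto
      moreover have "{a, f a} \<subseteq> A" using a fa by simp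
      ultimately show ?thesis unfolding C_def using psubset.hyps(1)
        by (metis card_Diff_subset card_mono finite.emptyI finite.insertI le_add_diff_inverse2)
    qed
    ultimately show ?thesis by simp
  qed simp
qed

text \<open>Perfect matchings of the subgraph induced by \<open>X\<close>. Modulo 2 their number is
  the Pfaffian of its adjacency matrix, whose square is the determinant.\<close>

definition pms :: "'a ugraph \<Rightarrow> 'a set \<Rightarrow> 'a set set set" where
  "pms G X = {N. matching G N \<and> \<Union>N = X}"

lemma finite_pms: "simple_graph G \<Longrightarrow> finite (pms G X)"
proof -
  assume G: "simple_graph G"
  have "pms G X \<subseteq> Pow (edges G)" by (auto simp: pms_def matching_def)
  then show ?thesis using finite_edges[OF G] finite_subset by blast
qed

lemma pms_partner:
  assumes G: "simple_graph G" and N: "N \<in> pms G X" and z: "z \<in> X"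
  shows "\<exists>!y. {z, y} \<in> N"
proof -
  have NM: "matching G N" "\<Union>N = X" using N by (simp_all add: pms_def)
  have NE: "N \<subseteq> edges G" using NM(1) unfolding matching_def by blast
  have "z \<in> \<Union>N" using z NM(2) by simp
  then obtain e where e: "e \<in> N" "z \<in> e" by (rule UnionE)
  obtain y where y: "e = {y, z}" by (rule edge_pair[OF G _ e(2)]) (use e NE in auto)
  show ?thesis
  proof (rule ex1I[of _ y])
    show "{z, y} \<in> N" using e y by (simp add: insert_commute)
    fix y' assume "{z, y'} \<in> N"
    then have "{z, y'} = {z, y}" using matching_edge_eq[OF NM(1) _ e(1), of "{z, y'}" z] y by (simp add: insert_commute)
    then show "y' = y" by (auto simp: doubleton_eq_iff)
  qed
qed

lemma pms_remove:
  assumes N: "N \<in> pms G X" and e: "e \<in> N"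
  shows "N - {e} \<in> pms G (X - e)"
proof -
  have m: "matching G N" "\<Union>N = X" using N by (simp_all add: pms_def)
  have "\<Union>(N - {e}) = X - e"
  proof
    show "\<Union>(N - {e}) \<subseteq> X - e"
    proof
      fix v assume "v \<in> \<Union>(N - {e})"
      then obtain f where f: "f \<in> N" "f \<noteq> e" "v \<in> f" by blast
      then have "v \<notin> e" using matching_edge_eq[OF m(1) f(1) e f(3)] by blast
      then show "v \<in> X - e" using f m(2) by blast
    qed
    show "X - e \<subseteq> \<Union>(N - {e})" using m(2) by blast
  qed
  moreover have "matching G (N - {e})" using m(1) unfolding matching_def by blast
  ultimately show ?thesis by (simp add: pms_def)
qed

lemma pms_add:
  assumes N: "N \<in> pms G Y" and e: "e \<in> edges G" "e \<inter> Y = {}"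
  shows "insert e N \<in> pms G (e \<union> Y)"
proof -
  have m: "matching G N" "\<Union>N = Y" using N by (simp_all add: pms_def)
  have d: "e \<inter> f = {}" "f \<inter> e = {}" if "f \<in> N" for f using that m(2) e(2) by blast+
  have "matching G (insert e N)" unfolding matching_def
  proof (intro conjI ballI impI)
    show "insert e N \<subseteq> edges G" using m(1) e(1) unfolding matching_def by simp
    fix f g assume fg: "f \<in> insert e N" "g \<in> insert e N" "f \<noteq> g"
    have "f \<inter> g = {}" if "f \<in> N" "g \<in> N" using m(1) that fg(3) unfolding matching_def by simp
    then show "f \<inter> g = {}" using fg d by (elim insertE) simp_all
  qed
  then show ?thesis using m(2) by (simp add: pms_def)
qed

text \<open>The matrix identity \<open>Adj \<cdot> adj(Adj) = det \<cdot> 1\<close> modulo 2, for Pfaffian minors: this is its diagonal part.\<close>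

lemma card_pms_expand:
  assumes G: "simple_graph G" and s: "s \<in> X" and finX: "finite X"
  shows "card (pms G X) = (\<Sum>y\<in>(X - {s}) \<inter> nbh G s. card (pms G (X - {s, y})))"
proof -
  define Y where "Y = (X - {s}) \<inter> nbh G s"
  define P where "P y = insert {s, y} ` pms G (X - {s, y})" for y
  have e: "{s, y} \<in> edges G" if "y \<in> Y" for y using that by (simp add: Y_def nbh_def insert_commute)
  have nin: "{s, y} \<notin> N" if "N \<in> pms G (X - {s, y})" for N y using that by (auto simp: pms_def)
  have "pms G X = (\<Union>y\<in>Y. P y)"
  proof
    show "pms G X \<subseteq> (\<Union>y\<in>Y. P y)"
    proof
      fix N assume N: "N \<in> pms G X"
      obtain y where y: "{s, y} \<in> N" using pms_partner[OF G N s] by blast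
      have "{s, y} \<in> edges G" using N y unfolding pms_def matching_def by blast
      then have "y \<in> nbh G s" by (simp add: nbh_def insert_commute)
      moreover have "y \<in> X" using N y unfolding pms_def by blast
      ultimately have "y \<in> Y" using nbh_irrefl[OF G, of s] by (auto simp: Y_def)
      moreover have "N = insert {s, y} (N - {{s, y}})" using y by blast
      then have "N \<in> P y" unfolding P_def using pms_remove[OF N y] by (rule image_eqI)
      ultimately show "N \<in> (\<Union>y\<in>Y. P y)" by blast
    qed
    show "(\<Union>y\<in>Y. P y) \<subseteq> pms G X"
    proof (rule UN_least)
      fix y assume y: "y \<in> Y"
      have "insert {s, y} N \<in> pms G X" if N: "N \<in> pms G (X - {s, y})" for N
      proof -
        have "{s, y} \<union> (X - {s, y}) = X" using s y by (auto simp: Y_def)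
        then show ?thesis using pms_add[OF N e[OF y]] by auto
      qed
      then show "P y \<subseteq> pms G X" unfolding P_def by (rule image_subsetI)
    qed
  qed
  moreover have "card (\<Union>y\<in>Y. P y) = (\<Sum>y\<in>Y. card (P y))"
  proof (rule card_UN_disjoint)
    show "finite Y" using finX by (simp add: Y_def)
    show "\<forall>y\<in>Y. finite (P y)" using finite_pms[OF G] by (simp add: P_def)
    show "\<forall>y\<in>Y. \<forall>y'\<in>Y. y \<noteq> y' \<longrightarrow> P y \<inter> P y' = {}"
    proof (intro ballI impI)
      fix y y' assume yy: "y \<in> Y" "y' \<in> Y" "y \<noteq> y'"
      show "P y \<inter> P y' = {}"
      proof (rule ccontr)
        assume "P y \<inter> P y' \<noteq> {}"
        then obtain N where N: "N \<in> P y" "N \<in> P y'" by blast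
        then have "N \<in> pms G X" using \<open>pms G X = (\<Union>y\<in>Y. P y)\<close> yy by blast
        moreover have "{s, y} \<in> N" if "N \<in> P y" for y using that unfolding P_def by (elim imageE) simp
        then have "{s, y} \<in> N" "{s, y'} \<in> N" using N by simp_all
        ultimately show False using pms_partner[OF G _ s] yy(3) by blast
      qed
    qed
  qed
  moreover have "card (P y) = card (pms G (X - {s, y}))" for y
    unfolding P_def
  proof (rule card_image, rule inj_onI)
    fix N N' assume N: "N \<in> pms G (X - {s, y})" "N' \<in> pms G (X - {s, y})" "insert {s, y} N = insert {s, y} N'"
    then show "N = N'" using nin[OF N(1)] nin[OF N(2)] by (metis Diff_insert_absorb)
  qed
  ultimately show ?thesis by (simp add: Y_def)
qed

text \<open>The off-diagonal part, by a fixed-point-free involution on pairs of a neighbour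
  \<open>y\<close> of \<open>z\<close> and a perfect matching of \<open>X - {s, y}\<close>: if
  \<open>z\<close> is matched to \<open>y'\<close>, exchange this edge for \<open>{z, y}\<close>,
  which gives a perfect matching of \<open>X - {s, y'}\<close>.\<close>

lemma even_pms_offdiag:
  assumes G: "simple_graph G" and z: "z \<in> X" "z \<noteq> s" and finX: "finite X"
  shows "even (\<Sum>y\<in>(X - {s}) \<inter> nbh G z. card (pms G (X - {s, y})))"
proof -
  define Y where "Y = (X - {s}) \<inter> nbh G z"
  define A where "A = Sigma Y (\<lambda>y. pms G (X - {s, y}))"
  have zy: "z \<noteq> y" if "y \<in> Y" for y using that nbh_irrefl[OF G] by (auto simp: Y_def)
  define pt where "pt N = (THE y. {z, y} \<in> N)" for N
  define f where "f = (\<lambda>(y, N). (pt N, insert {z, y} (N - {{z, pt N}})))"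
  have finY: "finite Y" using finX by (simp add: Y_def)
  have "even (card A)"
  proof (rule even_card_involution)
    show "finite A" unfolding A_def using finite_pms[OF G] finY by blast
    fix a assume "a \<in> A"
    then obtain y N where a: "a = (y, N)" "y \<in> Y" and N: "N \<in> pms G (X - {s, y})" by (auto simp: A_def)
    have zX: "z \<in> X - {s, y}" using z zy[OF a(2)] by simp
    define y' where "y' = pt N"
    have ex1: "\<exists>!y. {z, y} \<in> N" by (rule pms_partner[OF G N zX])
    have y': "{z, y'} \<in> N" unfolding y'_def pt_def by (rule theI'[OF ex1])
    have y'X: "y' \<in> X - {s, y}" using N y' unfolding pms_def by blast
    have "{z, y'} \<in> edges G" using N y' unfolding pms_def matching_def by blast
    then have y'Y: "y' \<in> Y" using y'X by (simp add: Y_def nbh_def insert_commute)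
    define N' where "N' = insert {z, y} (N - {{z, y'}})"
    have ze: "{z, y} \<in> edges G" using a(2) by (simp add: Y_def nbh_def insert_commute)
    have yX: "y \<in> X" "y \<noteq> s" using a(2) by (simp_all add: Y_def)
    have "{z, y} \<inter> (X - {s, y} - {z, y'}) = {}" by blast
    from pms_add[OF pms_remove[OF N y'] ze this]
    have "N' \<in> pms G ({z, y} \<union> (X - {s, y} - {z, y'}))" by (simp add: N'_def)
    moreover have "{z, y} \<union> (X - {s, y} - {z, y'}) = X - {s, y'}"
      using z yX y'X zy[OF y'Y] by auto
    ultimately have N'P: "N' \<in> pms G (X - {s, y'})" by simp
    have zX': "z \<in> X - {s, y'}" using z zy[OF y'Y] by simp
    have zyN': "{z, y} \<in> N'" by (simp add: N'_def)
    have ptN': "pt N' = y"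
      unfolding pt_def using pms_partner[OF G N'P zX'] zyN' by (rule the1_equality)
    have fa: "f a = (y', N')" by (simp add: f_def a(1) y'_def N'_def)
    have "{z, y} \<notin> N" using N unfolding pms_def by blast
    then have "insert {z, y'} (N' - {{z, y}}) = N" using y' unfolding N'_def by blast
    then have "f (f a) = a" unfolding fa by (simp add: f_def ptN' a(1))
    moreover have "f a \<in> A" unfolding fa A_def using y'Y N'P by simp
    moreover have "(y', N') \<noteq> (y, N)" using y'X by simp
    then have "f a \<noteq> a" using fa a(1) by metis
    ultimately show "f a \<in> A \<and> f (f a) = a \<and> f a \<noteq> a" by blast
  qed
  moreover have "card A = (\<Sum>y\<in>Y. card (pms G (X - {s, y})))"
    unfolding A_def using finY finite_pms[OF G] by (simp add: card_SigmaI)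
  ultimately show ?thesis by (simp add: Y_def)
qed

text \<open>\<open>S\<close> is a nonzero vector in the kernel of the adjacency matrix over GF(2).
  Summing the expansions along all \<open>z\<close> in \<open>S\<close>, the diagonal term is the
  number of perfect matchings and the others are even. After exchanging the sums each minor is
  counted \<open>card (S \<inter> nbh G y)\<close> times, an even number.\<close>

lemma even_card_pms:
  assumes G: "simple_graph G" and finX: "finite X" and S: "S \<subseteq> X" "S \<noteq> {}"
    and ev: "\<And>y. y \<in> X \<Longrightarrow> even (card (S \<inter> nbh G y))"
  shows "even (card (pms G X))"
proof -
  obtain s where s: "s \<in> S" using S(2) by blast
  have sX: "s \<in> X" using s S(1) by blast
  have finS: "finite S" using finX S(1) finite_subset by blast
  define P where "P y = card (pms G (X - {s, y}))" for y
  define R where "R z = (\<Sum>y\<in>(X - {s}) \<inter> nbh G z. P y)" for z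
  have "(\<Sum>z\<in>S. R z) = (\<Sum>z\<in>S. \<Sum>y\<in>X - {s}. if y \<in> nbh G z then P y else 0)"
    unfolding R_def by (intro sum.cong refl sum.inter_restrict) (simp add: finX)
  also have "\<dots> = (\<Sum>y\<in>X - {s}. \<Sum>z\<in>S. if y \<in> nbh G z then P y else 0)" by (rule sum.swap)
  also have "\<dots> = (\<Sum>y\<in>X - {s}. card (S \<inter> nbh G y) * P y)"
  proof (rule sum.cong[OF refl])
    fix y
    have sw: "y \<in> nbh G z \<longleftrightarrow> z \<in> nbh G y" for z using nbh_sym[of y G z] nbh_sym[of z G y] by (rule iffI)
    have "(\<Sum>z\<in>S. if y \<in> nbh G z then P y else 0) = (\<Sum>z\<in>S. if z \<in> nbh G y then P y else 0)"
      unfolding sw ..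
    also have "\<dots> = (\<Sum>z\<in>S \<inter> nbh G y. P y)" by (rule sum.inter_restrict[OF finS, symmetric])
    also have "\<dots> = card (S \<inter> nbh G y) * P y" by simp
    finally show "(\<Sum>z\<in>S. if y \<in> nbh G z then P y else 0) = card (S \<inter> nbh G y) * P y" .
  qed
  also have "even \<dots>"
  proof (rule dvd_sum)
    fix y assume "y \<in> X - {s}"
    then show "even (card (S \<inter> nbh G y) * P y)" using ev[of y] by simp
  qed
  finally have "even (\<Sum>z\<in>S. R z)" .
  moreover have "(\<Sum>z\<in>S. R z) = R s + (\<Sum>z\<in>S - {s}. R z)" using finS s by (rule sum.remove)
  moreover have "even (\<Sum>z\<in>S - {s}. R z)"
  proof (rule dvd_sum)
    fix z assume "z \<in> S - {s}"
    then have "z \<in> X" "z \<noteq> s" using S(1) by auto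
    then show "even (R z)" unfolding R_def P_def by (rule even_pms_offdiag[OF G _ _ finX])
  qed
  moreover have "R s = card (pms G X)"
    unfolding R_def P_def by (rule card_pms_expand[OF G sX finX, symmetric])
  ultimately show ?thesis by simp
qed

lemma card_matching_cover:
  assumes G: "simple_graph G" and M: "matching G M"
  shows "card (\<Union>M) = 2 * card M"
proof -
  have two: "card e = 2" "finite e" if "e \<in> M" for e
  proof -
    have "e \<in> edges G" using M that unfolding matching_def by blast
    then show "card e = 2" using G unfolding simple_graph_def by blast
    then show "finite e" using card.infinite by fastforce
  qed
  have "pairwise disjnt M" using M unfolding matching_def pairwise_def disjnt_def by blast
  then have "card (\<Union>M) = sum card M" using two(2) by (rule card_Union_disjoint)
  also have "\<dots> = (\<Sum>e\<in>M. 2)" using two(1) by (rule sum.cong[OF refl])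
  finally show ?thesis by simp
qed

lemma even_card_sym_diff:
  assumes "finite A" "finite C" "even (card A) = even (card C)"
  shows "even (card (A - C \<union> (C - A)))"
proof -
  have "card (A - C \<union> (C - A)) = card (A - C) + card (C - A)"
    using assms by (intro card_Un_disjoint) auto
  moreover have "card A = card (A \<inter> C) + card (A - C)" "card C = card (A \<inter> C) + card (C - A)"
    using assms(1,2) card_Int_Diff[of A C] card_Int_Diff[of C A] by (simp_all add: Int_commute)
  ultimately show ?thesis using assms(3) by auto
qed

text \<open>Over GF(2): if the parities at \<open>K\<close> force all parities, then the adjacency matrix of the covered
  vertices has rank at most \<open>card K\<close>, whereas a unique perfect matching makes it nonsingular.\<close>

lemma ur_bound:
  assumes G: "simple_graph G" and M: "uniquely_restricted_matching G M" and K: "finite K"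
    and even_K: "\<And>S. S \<subseteq> \<Union>M \<Longrightarrow> (\<And>y. y \<in> K \<Longrightarrow> even (card (S \<inter> nbh G y))) \<Longrightarrow>
      (\<And>y. y \<in> \<Union>M \<Longrightarrow> even (card (S \<inter> nbh G y)))"
  shows "2 * card M \<le> card K"
proof (rule ccontr)
  assume neg: "\<not> ?thesis"
  define X where "X = \<Union>M"
  have m: "matching G M" and uniq: "\<And>N. matching G N \<Longrightarrow> \<Union>N = \<Union>M \<Longrightarrow> N = M"
    using M unfolding ur_matching_iff[OF G] by blast+
  have cX: "card K < card X" using neg card_matching_cover[OF G m] by (simp add: X_def)
  have finX: "finite X" using matching_verts[OF G m] G finite_subset unfolding simple_graph_def X_def by blast
  \<comment> \<open>The parity vector of \<open>S\<close> on \<open>K\<close>. There are more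
    subsets of \<open>X\<close> than such vectors, so two subsets agree, and their symmetric
    difference is a nonempty set with even parity on \<open>K\<close>.\<close>
  define f where "f S = {y \<in> K. odd (card (S \<inter> nbh G y))}" for S
  have "card (f ` Pow X) \<le> card (Pow K)" using K by (intro card_mono) (auto simp: f_def)
  also have "\<dots> < card (Pow X)" using cX K finX by (simp add: card_Pow)
  finally have "\<not> inj_on f (Pow X)" by (rule pigeonhole)
  then obtain S1 S2 where S: "S1 \<subseteq> X" "S2 \<subseteq> X" "f S1 = f S2" "S1 \<noteq> S2" unfolding inj_on_def by blast
  define S where "S = (S1 - S2) \<union> (S2 - S1)"
  have SX: "S \<subseteq> X" "S \<noteq> {}" using S by (auto simp: S_def)
  have "even (card (S \<inter> nbh G y))" if "y \<in> K" for y
  proof -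
    have "y \<in> f S1 \<longleftrightarrow> y \<in> f S2" using S(3) by simp
    then have eq: "even (card (S1 \<inter> nbh G y)) = even (card (S2 \<inter> nbh G y))" using that by (simp add: f_def)
    have "S \<inter> nbh G y = (S1 \<inter> nbh G y - S2 \<inter> nbh G y) \<union> (S2 \<inter> nbh G y - S1 \<inter> nbh G y)"
      unfolding S_def by blast
    then show ?thesis using even_card_sym_diff[OF _ _ eq] S(1,2) finX finite_subset by (metis finite_Int)
  qed
  then have "even (card (S \<inter> nbh G y))" if "y \<in> X" for y using even_K[of S y] SX that unfolding X_def by blast
  then have "even (card (pms G X))" by (rule even_card_pms[OF G finX SX])
  moreover have "pms G X = {M}" unfolding pms_def X_def using m uniq by blast
  ultimately show False by simp
qed

section \<open>Matching numbers of ladders\<close>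

text \<open>The exchange of the two rails, a symmetry of all graphs in \<open>B\<close>.\<close>

fun flip :: "lvert \<Rightarrow> lvert" where
  "flip (U i) = V i" | "flip (V i) = U i" | "flip a = a"

lemma flip_flip [simp]: "flip (flip a) = a"
  by (cases a) simp_all

lemma flip_eq_iff [simp]: "flip a = flip c \<longleftrightarrow> a = c"
  using flip_flip[of a] flip_flip[of c] by metis

text \<open>The common ground of \<open>B1\<close> and \<open>B2\<close>. The symmetry
  \<open>flip\<close> is for the rank bound. \<open>UU\<close>, \<open>VV\<close> and
  \<open>UV\<close> say that the vertices \<open>U i\<close> for odd \<open>i\<close> and
  \<open>V i\<close> for even \<open>i\<close> are independent, which is what the alternating
  matching needs.\<close>

locale ladder_like =
  fixes H :: "lvert ugraph" and k :: nat
  assumes H: "simple_graph H"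
    and vL: "verts (L k) \<subseteq> verts H" and vL': "verts H \<subseteq> verts (L_prime k)"
    and eL: "edges (L k) \<subseteq> edges H"
    and flip: "c \<in> nbh H a \<Longrightarrow> flip c \<in> nbh H (flip a)"
    and nbh_W: "1 \<le> i \<Longrightarrow> i \<le> k \<Longrightarrow> nbh H (W i) = {U i, V i}"
    and nbh_ends: "nbh H W1' \<subseteq> {U 1, V 1}" "nbh H Wk' \<subseteq> {U k, V k}"
    and ends_k: "1 \<le> k"
    and UU: "1 \<le> i \<Longrightarrow> i \<le> k \<Longrightarrow> 1 \<le> j \<Longrightarrow> j \<le> k \<Longrightarrow> odd i \<Longrightarrow> odd j \<Longrightarrow> U i \<notin> nbh H (U j)"
    and VV: "1 \<le> i \<Longrightarrow> i \<le> k \<Longrightarrow> 1 \<le> j \<Longrightarrow> j \<le> k \<Longrightarrow> even i \<Longrightarrow> even j \<Longrightarrow> V i \<notin> nbh H (V j)"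
    and UV: "1 \<le> i \<Longrightarrow> i \<le> k \<Longrightarrow> 1 \<le> j \<Longrightarrow> j \<le> k \<Longrightarrow> odd i \<Longrightarrow> even j \<Longrightarrow> U i \<notin> nbh H (V j)"
begin

lemma vert_cases:
  assumes "a \<in> verts H"
  shows "(\<exists>i. 1 \<le> i \<and> i \<le> k \<and> (a = U i \<or> a = V i \<or> a = W i)) \<or> a = W1' \<or> a = Wk'"
proof -
  have "a \<in> verts (L k) \<or> a = W1' \<or> a = Wk'" using assms vL' unfolding verts_L_prime by blast
  then show ?thesis unfolding verts_L by auto
qed

lemma even_pair:
  assumes "U i \<in> S \<longleftrightarrow> V i \<in> S" "A \<subseteq> {U i, V i}" "U i \<in> A \<longleftrightarrow> V i \<in> A"
  shows "even (card (S \<inter> A))"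
proof -
  show ?thesis
  proof (cases "U i \<in> S \<and> U i \<in> A")
    case True
    then have "{U i, V i} \<subseteq> S \<inter> A" using assms(1,3) by simp
    then have "S \<inter> A = {U i, V i}" using assms(2) by (meson Int_lower2 subset_antisym subset_trans)
    then show ?thesis by simp
  next
    case False
    have "a \<notin> S \<inter> A" for a
    proof
      assume a: "a \<in> S \<inter> A"
      then have "a = U i \<or> a = V i" using assms(2) by blast
      then show False using a False assms(1,3) by (elim disjE) simp_all
    qed
    then have "S \<inter> A = {}" by blast
    then show ?thesis by simp
  qed
qed

text \<open>Even parity at every \<open>W i\<close> means that \<open>S\<close> contains both or
  none of \<open>U i\<close> and \<open>V i\<close>, so \<open>S\<close> is invariant under
  \<open>flip\<close>. Then the parity at \<open>V i\<close> equals that at \<open>U i\<close>, and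
  at the extra vertices it is even since they see both or none of a column's rail vertices. So the
  2k vertices \<open>U i\<close> and \<open>W i\<close> control all parities.\<close>

lemma nu_ur_le_k: "nu_ur H \<le> k"
proof -
  obtain M where M: "uniquely_restricted_matching H M" "card M = nu_ur H" using nu_ur_witness[OF H] by blast
  define K where "K = U ` {1..k} \<union> W ` {1..k}"
  have finK: "finite K" by (simp add: K_def)
  have "card K \<le> card (U ` {1..k}) + card (W ` {1..k})" unfolding K_def by (rule card_Un_le)
  also have "\<dots> \<le> k + k" using card_image_le[of "{1..k}" U] card_image_le[of "{1..k}" W] by simp
  finally have cK: "card K \<le> 2 * k" by simp
  have m: "matching H M" using M(1) unfolding uniquely_restricted_matching_def by blast
  have "2 * card M \<le> card K"
  proof (rule ur_bound[OF H M(1) finK])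
    fix S y assume S: "S \<subseteq> \<Union>M" and evK: "\<And>y. y \<in> K \<Longrightarrow> even (card (S \<inter> nbh H y))" and y: "y \<in> \<Union>M"
    have SV: "S \<subseteq> verts H" using S matching_verts[OF H m] by blast
    have pair: "U i \<in> S \<longleftrightarrow> V i \<in> S" if i: "1 \<le> i" "i \<le> k" for i
    proof -
      have e: "even (card (S \<inter> {U i, V i}))" using evK[of "W i"] nbh_W[OF i] i by (simp add: K_def)
      have "card (S \<inter> {U i, V i}) = (if U i \<in> S then 1 else 0) + (if V i \<in> S then 1 else 0)"
        by (simp add: Int_insert_right)
      then show ?thesis using e by (simp split: if_splits)
    qed
    have flipS: "flip a \<in> S" if a: "a \<in> S" for a
    proof -
      have "a \<in> verts H" using a SV by blast
      from vert_cases[OF this] show ?thesis using a pair by auto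
    qed
    have ends: "U i \<in> nbh H a \<longleftrightarrow> V i \<in> nbh H a" if "flip a = a" for a i
      using flip[of "U i" a] flip[of "V i" a] that by auto
    have "y \<in> verts H" using y matching_verts[OF H m] by blast
    from vert_cases[OF this] consider (K) "y \<in> K" | (V) i where "1 \<le> i" "i \<le> k" "y = V i" | (W1') "y = W1'" | (Wk') "y = Wk'"
      by (auto simp: K_def)
    then show "even (card (S \<inter> nbh H y))"
    proof cases
      case K then show ?thesis by (rule evK)
    next
      case V
      have "S \<inter> nbh H (V i) = flip ` (S \<inter> nbh H (U i))"
      proof
        show "S \<inter> nbh H (V i) \<subseteq> flip ` (S \<inter> nbh H (U i))"
        proof
          fix a assume a: "a \<in> S \<inter> nbh H (V i)"
          then have "flip a \<in> S \<inter> nbh H (U i)" using flipS flip[of a "V i"] by simp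
          then have "flip (flip a) \<in> flip ` (S \<inter> nbh H (U i))" by (rule imageI)
          then show "a \<in> flip ` (S \<inter> nbh H (U i))" by simp
        qed
        show "flip ` (S \<inter> nbh H (U i)) \<subseteq> S \<inter> nbh H (V i)"
        proof (rule image_subsetI)
          fix a assume "a \<in> S \<inter> nbh H (U i)"
          then show "flip a \<in> S \<inter> nbh H (V i)" using flipS flip[of a "U i"] by simp
        qed
      qed
      then have "card (S \<inter> nbh H y) = card (S \<inter> nbh H (U i))"
        unfolding V(3) by (simp add: card_image inj_on_def)
      then show ?thesis using evK[of "U i"] V(1,2) by (simp add: K_def)
    next
      case W1'
      show ?thesis unfolding W1' using pair[of 1] ends_k nbh_ends(1) ends[of W1' 1] by (intro even_pair[of 1]) simp_all
    next
      case Wk'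
      show ?thesis unfolding Wk' using pair[of k] ends_k nbh_ends(2) ends[of Wk' k] by (intro even_pair[of k]) simp_all
    qed
  qed
  then show ?thesis using cK M(2) by simp
qed

text \<open>The rail vertices \<open>m i\<close> are independent, and of the two neighbours of
  \<open>W i\<close> only \<open>m i\<close> is covered.\<close>

lemma nu_s_ge_k: "k \<le> nu_s H"
proof -
  define m where "m i = (if odd i then U i else V i)" for i
  define M where "M = (\<lambda>i. {W i, m i}) ` {1..k}"
  have mW: "m i \<noteq> W j" for i j by (simp add: m_def)
  have m_eq: "m i = m j \<Longrightarrow> i = j" for i j by (simp add: m_def split: if_splits)
  have pair_eq: "i = j" if "v \<in> {W i, m i}" "v \<in> {W j, m j}" for i j v
    using that mW[of i j] mW[of j i] m_eq[of i j] by auto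
  have inj: "inj_on (\<lambda>i. {W i, m i}) {1..k}"
  proof (rule inj_onI)
    fix i j assume "{W i, m i} = {W j, m j}"
    then show "i = j" using pair_eq[of "W i" i j] by auto
  qed
  have "{W i, m i} \<in> edges H" if "1 \<le> i" "i \<le> k" for i
    using col_edges(1,3)[OF that] eL by (auto simp: m_def)
  then have ME: "M \<subseteq> edges H" by (auto simp: M_def)
  have match: "matching H M" unfolding matching_def
  proof (intro conjI ballI impI ME)
    fix e f assume "e \<in> M" "f \<in> M" and ne: "e \<noteq> f"
    then obtain i j where ij: "e = {W i, m i}" "f = {W j, m j}" by (auto simp: M_def)
    then have "i \<noteq> j" using ne by auto
    then show "e \<inter> f = {}" using pair_eq[of _ i j] unfolding ij by blast
  qed
  have mm: "m i \<notin> nbh H (m j)" if "1 \<le> i" "i \<le> k" "1 \<le> j" "j \<le> k" for i j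
  proof -
    have "U i \<notin> nbh H (V j) \<or> odd j" if "odd i" using UV[of i j] that \<open>1 \<le> i\<close> \<open>i \<le> k\<close> \<open>1 \<le> j\<close> \<open>j \<le> k\<close> by blast
    moreover have "V i \<notin> nbh H (U j) \<or> odd i" if "odd j"
      using UV[of j i] nbh_sym[of "V i" H "U j"] that \<open>1 \<le> i\<close> \<open>i \<le> k\<close> \<open>1 \<le> j\<close> \<open>j \<le> k\<close> by blast
    ultimately show ?thesis using UU[OF that] VV[OF that]
      by (cases "odd i"; cases "odd j") (simp_all add: m_def)
  qed
  have Wm: "c = m i" if h: "1 \<le> i" "i \<le> k" "c \<in> nbh H (W i)" "c \<in> \<Union>M" for i c
  proof -
    obtain j where j: "1 \<le> j" "c \<in> {W j, m j}" using h(4) by (auto simp: M_def)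
    have "c = U i \<or> c = V i" using h(3) nbh_W[OF h(1,2)] by simp
    then show ?thesis using j by (auto simp: m_def split: if_splits)
  qed
  have "induced_matching H M" unfolding induced_matching_iff[OF H]
  proof (intro conjI ballI impI match)
    fix e assume e: "e \<in> edges H" "e \<subseteq> \<Union>M"
    then have "card e = 2" using H by (simp add: simple_graph_def)
    then obtain a c where ac: "e = {a, c}" by (auto simp: card_2_iff)
    have nb: "a \<in> nbh H c" "c \<in> nbh H a" using e(1) unfolding ac nbh_def by (simp_all add: insert_commute)
    have cov: "a \<in> \<Union>M" "c \<in> \<Union>M" using e(2) unfolding ac by blast+
    obtain i where i: "1 \<le> i" "i \<le> k" "a = W i \<or> a = m i" using cov(1) by (auto simp: M_def)
    obtain j where j: "1 \<le> j" "j \<le> k" "c = W j \<or> c = m j" using cov(2) by (auto simp: M_def)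
    show "e \<in> M"
    proof (cases "a = W i")
      case True
      then have "c = m i" using Wm[OF i(1,2)] nb cov by simp
      then show ?thesis using True i by (simp add: M_def ac)
    next
      case False
      then have a: "a = m i" using i by simp
      then have c: "c = W j" using j mm[OF i(1,2) j(1,2)] nb by auto
      then have "a = m j" using Wm[OF j(1,2)] nb cov by simp
      then show ?thesis using c j by (simp add: M_def ac insert_commute)
    qed
  qed
  moreover have "card M = k" using card_image[OF inj] by (simp add: M_def)
  ultimately show ?thesis using nu_s_ge[OF H] by metis
qed

lemma nu_eq: "nu_s H = nu_ur H"
  using nu_ur_le_k nu_s_ge_k nu_s_le_nu_ur[OF H] by simp

end

section \<open>The graphs of both families are ladder-like\<close>

lemma simple_L: "simple_graph (L k)"
  unfolding simple_graph_def
proof (intro conjI ballI)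
  show "finite (verts (L k))" by (simp add: verts_L)
  fix e assume "e \<in> edges (L k)"
  then show "e \<subseteq> verts (L k)" "card e = 2" unfolding L_def by auto
qed

lemma col_adj_flip: "col_adj k a c \<Longrightarrow> col_adj k (flip a) (flip c)"
  by (erule col_adj_cases) (simp_all add: col_adj_def)

lemma L_flip: "{a, c} \<in> edges (L k) \<Longrightarrow> {flip a, flip c} \<in> edges (L k)"
  unfolding edges_L_iff using col_adj_flip by blast

lemma L_nbh:
  shows "{c, W i} \<in> edges (L k) \<Longrightarrow> c = U i \<or> c = V i"
    and "{c, W1'} \<notin> edges (L k)" "{c, Wk'} \<notin> edges (L k)"
    and "{U i, U j} \<in> edges (L k) \<Longrightarrow> i = j + 1 \<or> j = i + 1"
    and "{V i, V j} \<in> edges (L k) \<Longrightarrow> i = j + 1 \<or> j = i + 1"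
    and "{U i, V j} \<notin> edges (L k)"
  unfolding edges_L_iff by (auto elim!: col_adj_cases)

lemma L_prime_end_cases:
  assumes "{c, a} \<in> edges (L_prime k)" "{c, a} \<notin> edges (L k)"
  shows "{c, a} = {U 1, W1'} \<or> {c, a} = {V 1, W1'} \<or> {c, a} = {U 1, V 1} \<or>
    {c, a} = {U k, Wk'} \<or> {c, a} = {V k, Wk'} \<or> {c, a} = {U k, V k}"
  using assms unfolding edges_L_prime_iff insert_iff empty_iff by (simp only: simp_thms)

lemma L_prime_nbh:
  shows "{c, W i} \<in> edges (L_prime k) \<Longrightarrow> c = U i \<or> c = V i"
    and "{c, W1'} \<in> edges (L_prime k) \<Longrightarrow> c = U 1 \<or> c = V 1"
    and "{c, Wk'} \<in> edges (L_prime k) \<Longrightarrow> c = U k \<or> c = V k"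
    and "{U i, U j} \<in> edges (L_prime k) \<Longrightarrow> i = j + 1 \<or> j = i + 1"
    and "{V i, V j} \<in> edges (L_prime k) \<Longrightarrow> i = j + 1 \<or> j = i + 1"
    and "{U i, V j} \<in> edges (L_prime k) \<Longrightarrow> i = j"
proof -
  show "c = U i \<or> c = V i" if e: "{c, W i} \<in> edges (L_prime k)"
  proof (cases "{c, W i} \<in> edges (L k)")
    case True then show ?thesis using L_nbh(1) by blast
  next
    case False
    from L_prime_end_cases[OF e False] show ?thesis by (elim disjE) (simp_all add: doubleton_eq_iff)
  qed
  show "c = U 1 \<or> c = V 1" if e: "{c, W1'} \<in> edges (L_prime k)"
  proof (cases "{c, W1'} \<in> edges (L k)")
    case True then show ?thesis using L_nbh(2) by simp
  next
    case False
    from L_prime_end_cases[OF e False] show ?thesis by (elim disjE) (simp_all add: doubleton_eq_iff)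
  qed
  show "c = U k \<or> c = V k" if e: "{c, Wk'} \<in> edges (L_prime k)"
  proof (cases "{c, Wk'} \<in> edges (L k)")
    case True then show ?thesis using L_nbh(3) by simp
  next
    case False
    from L_prime_end_cases[OF e False] show ?thesis by (elim disjE) (simp_all add: doubleton_eq_iff)
  qed
  show "i = j + 1 \<or> j = i + 1" if e: "{U i, U j} \<in> edges (L_prime k)"
  proof (cases "{U i, U j} \<in> edges (L k)")
    case True then show ?thesis using L_nbh(4) by blast
  next
    case False
    from L_prime_end_cases[OF e False] show ?thesis by (elim disjE) (simp_all add: doubleton_eq_iff)
  qed
  show "i = j + 1 \<or> j = i + 1" if e: "{V i, V j} \<in> edges (L_prime k)"
  proof (cases "{V i, V j} \<in> edges (L k)")
    case True then show ?thesis using L_nbh(5) by blast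
  next
    case False
    from L_prime_end_cases[OF e False] show ?thesis by (elim disjE) (simp_all add: doubleton_eq_iff)
  qed
  show "i = j" if e: "{U i, V j} \<in> edges (L_prime k)"
  proof (cases "{U i, V j} \<in> edges (L k)")
    case True then show ?thesis using L_nbh(6) by simp
  next
    case False
    from L_prime_end_cases[OF e False] show ?thesis by (elim disjE) (simp_all add: doubleton_eq_iff)
  qed
qed

text \<open>A subgraph of \<open>L_prime k\<close> need not be symmetric under \<open>flip\<close>,
  because it could contain just one of the two edges at \<open>W1'\<close> or \<open>Wk'\<close>.
  Minimum degree 2 excludes this; the other optional edges are fixed by \<open>flip\<close>.\<close>

lemma B1_ladder_like:
  assumes "H \<in> B1" shows "\<exists>k. ladder_like H k"
proof -
  obtain k where H: "simple_graph H" "k_connected 2 H" and k: "1 \<le> k"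
    and L: "verts (L k) \<subseteq> verts H" "edges (L k) \<subseteq> edges H"
    and L': "verts H \<subseteq> verts (L_prime k)" "edges H \<subseteq> edges (L_prime k)"
    using assms unfolding B1_def subgraph_def by blast
  have nb': "{c, a} \<in> edges (L_prime k)" if "c \<in> nbh H a" for a c
    using that L'(2) by (auto simp: nbh_def)
  have nb: "c \<in> nbh H a" if "{c, a} \<in> edges (L k)" for a c
    using that L(2) by (auto simp: nbh_def)
  have ends: "nbh H W1' \<subseteq> {U 1, V 1}" "nbh H Wk' \<subseteq> {U k, V k}"
    using L_prime_nbh(2,3)[OF nb'] by blast+
  have full: "nbh H a = {U i, V i}" if "nbh H a \<subseteq> {U i, V i}" "c \<in> nbh H a" for a c i
  proof (rule card_seteq[OF _ that(1)])
    have "a \<in> verts H" by (rule nbh_verts[OF H(1) nbh_sym[OF that(2)]])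
    then have "2 \<le> card (nbh H a)" by (rule two_connected_deg[OF H])
    then show "card {U i, V i} \<le> card (nbh H a)" by simp
  qed simp
  have flip: "flip c \<in> nbh H (flip a)" if ca: "c \<in> nbh H a" for a c
  proof (cases "{c, a} \<in> edges (L k)")
    case True
    then show ?thesis using nb[OF L_flip] by blast
  next
    case False
    have 1: "{U 1, V 1} \<subseteq> nbh H W1'" if "{U 1, W1'} \<in> edges H \<or> {V 1, W1'} \<in> edges H"
      using that full[OF ends(1), of "U 1"] full[OF ends(1), of "V 1"] by (auto simp: nbh_def)
    have 2: "{U k, V k} \<subseteq> nbh H Wk'" if "{U k, Wk'} \<in> edges H \<or> {V k, Wk'} \<in> edges H"
      using that full[OF ends(2), of "U k"] full[OF ends(2), of "V k"] by (auto simp: nbh_def)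
    have e: "{c, a} \<in> edges H" using ca by (simp add: nbh_def)
    have "{flip c, flip a} \<in> edges H"
    proof -
      have fl: "{flip c, flip a} = flip ` {c, a}" by simp
      from L_prime_end_cases[OF nb'[OF ca] False] show ?thesis
      proof (elim disjE)
        assume a: "{c, a} = {U 1, W1'}"
        then have "V 1 \<in> nbh H W1'" using 1 e by auto
        then show ?thesis unfolding fl a by (simp add: nbh_def)
      next
        assume a: "{c, a} = {V 1, W1'}"
        then have "U 1 \<in> nbh H W1'" using 1 e by auto
        then show ?thesis unfolding fl a by (simp add: nbh_def)
      next
        assume a: "{c, a} = {U 1, V 1}"
        show ?thesis unfolding fl a using e unfolding a by (simp add: insert_commute)
      next
        assume a: "{c, a} = {U k, Wk'}"
        then have "V k \<in> nbh H Wk'" using 2 e by auto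
        then show ?thesis unfolding fl a by (simp add: nbh_def)
      next
        assume a: "{c, a} = {V k, Wk'}"
        then have "U k \<in> nbh H Wk'" using 2 e by auto
        then show ?thesis unfolding fl a by (simp add: nbh_def)
      next
        assume a: "{c, a} = {U k, V k}"
        show ?thesis unfolding fl a using e unfolding a by (simp add: insert_commute)
      qed
    qed
    then show ?thesis by (simp add: nbh_def)
  qed
  have "ladder_like H k"
  proof
    show "nbh H (W i) = {U i, V i}" if "1 \<le> i" "i \<le> k" for i
    proof
      show "nbh H (W i) \<subseteq> {U i, V i}" using L_prime_nbh(1)[OF nb'] by blast
      show "{U i, V i} \<subseteq> nbh H (W i)" using nb[OF col_edges(2)[OF that]] nb[OF col_edges(4)[OF that]] by simp
    qed
    show "U i \<notin> nbh H (U j)" if "odd i" "odd j" for i j using L_prime_nbh(4)[OF nb', of i j] that by auto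
    show "V i \<notin> nbh H (V j)" if "even i" "even j" for i j using L_prime_nbh(5)[OF nb', of i j] that by auto
    show "U i \<notin> nbh H (V j)" if "odd i" "even j" for i j using L_prime_nbh(6)[OF nb', of i j] that by auto
  qed (fact H(1) L L' flip ends k)+
  then show ?thesis ..
qed

lemma wrap_edges_simple: "1 \<le> k \<Longrightarrow> k \<noteq> 1 \<Longrightarrow> e \<in> wrap_edges k \<Longrightarrow> e \<subseteq> verts (L k) \<and> card e = 2"
  by (auto simp: wrap_edges_def verts_L split: if_splits)

lemma wrap_cases:
  assumes "{c, a} \<in> wrap_edges k"
  shows "{c, a} = {U 1, V k} \<and> odd k \<or> {c, a} = {V 1, U k} \<and> odd k \<or>
    {c, a} = {U 1, U k} \<and> even k \<or> {c, a} = {V 1, V k} \<and> even k"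
  using assms unfolding wrap_edges_def by (cases "odd k") (simp_all only: if_True if_False insert_iff empty_iff simp_thms)

lemma wrap_flip:
  assumes "{c, a} \<in> wrap_edges k" shows "{flip c, flip a} \<in> wrap_edges k"
proof -
  have fl: "{flip c, flip a} = flip ` {c, a}" by simp
  from wrap_cases[OF assms] show ?thesis unfolding fl
    by (elim disjE conjE) (simp_all add: wrap_edges_def)
qed

text \<open>The parity rule of \<open>B2\<close> keeps the alternating set independent: as 1 is odd,
  \<open>U 1\<close> belongs to it, and its new neighbour, \<open>U k\<close> for even
  \<open>k\<close> or \<open>V k\<close> for odd \<open>k\<close>, does not; neither does
  \<open>V 1\<close>.\<close>

lemma wrap_nbh:
  shows "{c, W i} \<notin> wrap_edges k" "{c, W1'} \<notin> wrap_edges k" "{c, Wk'} \<notin> wrap_edges k"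
    and "odd i \<Longrightarrow> odd j \<Longrightarrow> {U i, U j} \<notin> wrap_edges k"
    and "even i \<Longrightarrow> even j \<Longrightarrow> {V i, V j} \<notin> wrap_edges k"
    and "odd i \<Longrightarrow> even j \<Longrightarrow> {U i, V j} \<notin> wrap_edges k"
proof -
  show "{c, W i} \<notin> wrap_edges k" "{c, W1'} \<notin> wrap_edges k" "{c, Wk'} \<notin> wrap_edges k"
    by (rule notI, drule wrap_cases, elim disjE conjE; simp add: doubleton_eq_iff)+
  show "{U i, U j} \<notin> wrap_edges k" if "odd i" "odd j"
    by (rule notI, drule wrap_cases) (use that in \<open>elim disjE conjE; auto simp: doubleton_eq_iff\<close>)
  show "{V i, V j} \<notin> wrap_edges k" if "even i" "even j"
    by (rule notI, drule wrap_cases) (use that in \<open>elim disjE conjE; auto simp: doubleton_eq_iff\<close>)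
  show "{U i, V j} \<notin> wrap_edges k" if "odd i" "even j"
    by (rule notI, drule wrap_cases) (use that in \<open>elim disjE conjE; auto simp: doubleton_eq_iff\<close>)
qed

lemma simple_wrap:
  assumes "3 \<le> k" shows "simple_graph (add_edges (L k) (wrap_edges k))"
  unfolding simple_graph_def
proof (intro conjI ballI)
  show "finite (verts (add_edges (L k) (wrap_edges k)))" by (simp add: add_edges_def verts_L)
  fix e assume "e \<in> edges (add_edges (L k) (wrap_edges k))"
  then have "e \<in> edges (L k) \<or> e \<in> wrap_edges k" by (simp add: add_edges_def)
  then have "e \<subseteq> verts (L k) \<and> card e = 2"
    using simple_L[of k] wrap_edges_simple[of k e] assms unfolding simple_graph_def by auto
  then show "e \<subseteq> verts (add_edges (L k) (wrap_edges k))" "card e = 2" by (simp_all add: add_edges_def)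
qed

lemma wrap_ladder_like:
  assumes k: "3 \<le> k" shows "ladder_like (add_edges (L k) (wrap_edges k)) k"
proof -
  define H where "H = add_edges (L k) (wrap_edges k)"
  have nb: "c \<in> nbh H a \<longleftrightarrow> {c, a} \<in> edges (L k) \<or> {c, a} \<in> wrap_edges k" for a c
    by (simp add: H_def nbh_def add_edges_def)
  have "ladder_like H k"
  proof
    show "simple_graph H" unfolding H_def by (rule simple_wrap[OF k])
    show "verts (L k) \<subseteq> verts H" "verts H \<subseteq> verts (L_prime k)" "edges (L k) \<subseteq> edges H"
      by (auto simp: H_def add_edges_def L_prime_def)
    show "flip c \<in> nbh H (flip a)" if "c \<in> nbh H a" for a c
      using that L_flip[of c a k] wrap_flip[of c a k] unfolding nb by blast
    show "nbh H (W i) = {U i, V i}" if "1 \<le> i" "i \<le> k" for i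
    proof
      show "nbh H (W i) \<subseteq> {U i, V i}"
      proof
        fix c assume "c \<in> nbh H (W i)"
        then show "c \<in> {U i, V i}" using L_nbh(1)[of c i k] wrap_nbh(1)[of c i k] unfolding nb by simp
      qed
      show "{U i, V i} \<subseteq> nbh H (W i)" using col_edges(2,4)[OF that] by (simp add: nb)
    qed
    show "nbh H W1' \<subseteq> {U 1, V 1}" "nbh H Wk' \<subseteq> {U k, V k}"
      using L_nbh(2,3) wrap_nbh(2,3) nb by (simp_all add: subset_iff)
    show "1 \<le> k" using k by simp
    show "U i \<notin> nbh H (U j)" if "odd i" "odd j" for i j
      using L_nbh(4)[of i j k] wrap_nbh(4)[OF that, of k] that unfolding nb by auto
    show "V i \<notin> nbh H (V j)" if "even i" "even j" for i j
      using L_nbh(5)[of i j k] wrap_nbh(5)[OF that, of k] that unfolding nb by auto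
    show "U i \<notin> nbh H (V j)" if "odd i" "even j" for i j
      using L_nbh(6)[of i j k] wrap_nbh(6)[OF that, of k] unfolding nb by simp
  qed
  then show ?thesis by (simp add: H_def)
qed

section \<open>The characterization\<close>

lemma equal_imp_iso:
  fixes G :: "'a ugraph"
  assumes gr: "simple_graph G" "k_connected 2 G" "subcubic G" "21 \<le> card (verts G)" and eq: "nu_s G = nu_ur G"
  shows "\<exists>H\<in>B. graph_iso G H"
proof -
  obtain M where M: "induced_matching G M" "card M = nu_s G" using nu_s_witness[OF gr(1)] by blast
  interpret equal_numbers G M
    by unfold_locales (use gr(1) M eq in simp_all)
  interpret linked_graph "verts G" "verts G - \<Union>M" "\<Union>M" "nbh G" mt by (rule linked_graph[OF gr(2-4)])
  have adj: "{a, c} \<in> edges G \<longleftrightarrow> c \<in> nbh G a" for a c by (simp add: nbh_def insert_commute)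
  from ladder_structure show ?thesis unfolding open_ladder_def closed_ladder_def
  proof (elim disjE exE conjE)
    fix k T g
    assume k: "1 \<le> k" and T: "verts (L k) \<subseteq> T" "T \<subseteq> verts (L_prime k)" and g: "bij_betw g T (verts G)"
      and E: "\<forall>a\<in>T. \<forall>c\<in>T. ({a, c} \<in> edges (L k) \<longrightarrow> g c \<in> nbh G (g a)) \<and>
        (g c \<in> nbh G (g a) \<longrightarrow> {a, c} \<in> edges (L_prime k))"
    \<comment> \<open>\<open>G\<close> is pulled back along \<open>g\<close> to the ladder names;
      the optional edges present in \<open>G\<close> are thereby those of \<open>H\<close>.
      Connectivity and degree bound are then carried over by the isomorphism.\<close>
    define H where "H = \<lparr>verts = T, edges = {{a, c} |a c. a \<in> T \<and> c \<in> T \<and> g c \<in> nbh G (g a)}\<rparr>"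
    have vH: "verts H = T" by (simp add: H_def)
    have eH: "e \<in> edges H \<longleftrightarrow> (\<exists>a c. e = {a, c} \<and> a \<in> T \<and> c \<in> T \<and> g c \<in> nbh G (g a))" for e
      by (simp add: H_def)
    have eH2: "{a, c} \<in> edges H \<longleftrightarrow> g c \<in> nbh G (g a)" if "a \<in> T" "c \<in> T" for a c
    proof
      assume "{a, c} \<in> edges H"
      then obtain a' c' where ac: "{a, c} = {a', c'}" "g c' \<in> nbh G (g a')" unfolding eH by blast
      then have "a = a' \<and> c = c' \<or> a = c' \<and> c = a'" by (simp add: doubleton_eq_iff)
      then show "g c \<in> nbh G (g a)" using ac(2) nbh_sym[OF ac(2)] by (elim disjE) simp_all
    next
      assume "g c \<in> nbh G (g a)"
      then show "{a, c} \<in> edges H" unfolding eH using that by blast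
    qed
    have H: "simple_graph H" unfolding simple_graph_def
    proof (intro conjI ballI)
      show "finite (verts H)" using bij_betw_finite[OF g] fin by (simp add: vH)
      fix e assume "e \<in> edges H"
      then obtain a c where e: "e = {a, c}" "a \<in> T" "c \<in> T" "g c \<in> nbh G (g a)" unfolding eH by blast
      then have "a \<noteq> c" using nbh_irrefl[OF gr(1), of "g a"] by auto
      then show "e \<subseteq> verts H" "card e = 2" using e by (simp_all add: vH)
    qed
    have gm: "graph_map H G g"
    proof
      show "bij_betw g (verts H) (verts G)" using g by (simp add: vH)
      show "{x, y} \<in> edges H \<longleftrightarrow> {g x, g y} \<in> edges G" if "x \<in> verts H" "y \<in> verts H" for x y
        using eH2 that adj by (simp add: vH)
    qed (rule H gr(1))+
    note fm = graph_map.graph_map_inv[OF gm]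
    have "subgraph (L k) H" unfolding subgraph_def
    proof
      show "verts (L k) \<subseteq> verts H" using T by (simp add: vH)
      show "edges (L k) \<subseteq> edges H"
      proof
        fix e assume e: "e \<in> edges (L k)"
        then have "card e = 2" "e \<subseteq> verts (L k)" using simple_L[of k] unfolding simple_graph_def by auto
        then obtain a c where "e = {a, c}" "a \<in> T" "c \<in> T" using T(1) by (auto simp: card_2_iff)
        then show "e \<in> edges H" using E e eH2 by simp
      qed
    qed
    moreover have "subgraph H (L_prime k)" unfolding subgraph_def
    proof
      show "verts H \<subseteq> verts (L_prime k)" using T by (simp add: vH)
      show "edges H \<subseteq> edges (L_prime k)"
      proof
        fix e assume "e \<in> edges H"
        then obtain a c where "e = {a, c}" "a \<in> T" "c \<in> T" "g c \<in> nbh G (g a)" unfolding eH by blast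
        then show "e \<in> edges (L_prime k)" using E by simp
      qed
    qed
    ultimately have "H \<in> B1"
      unfolding B1_def using H k graph_map.k_connected_map[OF fm gr(2)] graph_map.subcubic_map[OF fm gr(3)] by blast
    moreover have "graph_iso G H" by (rule graph_map.iso[OF fm])
    ultimately show ?thesis unfolding B_def by blast
  next
    fix k g
    assume k: "3 \<le> k" and g: "bij_betw g (verts (L k)) (verts G)"
      and E: "\<forall>a\<in>verts (L k). \<forall>c\<in>verts (L k).
        ({a, c} \<in> edges (add_edges (L k) (wrap_edges k))) = (g c \<in> nbh G (g a))"
    let ?H = "add_edges (L k) (wrap_edges k)"
    have vH: "verts ?H = verts (L k)" by (simp add: add_edges_def)
    have gm: "graph_map ?H G g"
    proof
      show "bij_betw g (verts ?H) (verts G)" using g by (simp add: vH)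
      show "{x, y} \<in> edges ?H \<longleftrightarrow> {g x, g y} \<in> edges G" if "x \<in> verts ?H" "y \<in> verts ?H" for x y
        using E that adj by (simp add: vH)
    qed (rule simple_wrap[OF k] gr(1))+
    have "graph_iso G ?H" by (rule graph_map.iso[OF graph_map.graph_map_inv[OF gm]])
    moreover have "?H \<in> B2" unfolding B2_def wrap_edges_def using k by blast
    ultimately show ?thesis unfolding B_def by blast
  qed
qed

lemma nu_eq_if_B:
  assumes "H \<in> B" shows "simple_graph H" "nu_s H = nu_ur H"
proof -
  have "\<exists>k. ladder_like H k"
  proof (cases "H \<in> B1")
    case True then show ?thesis by (rule B1_ladder_like)
  next
    case False
    then have "H \<in> B2" using assms by (simp add: B_def)
    then obtain k where "3 \<le> k" "H = add_edges (L k) (wrap_edges k)" unfolding B2_def wrap_edges_def by blast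
    then show ?thesis using wrap_ladder_like by blast
  qed
  then obtain k where k: "ladder_like H k" ..
  show "simple_graph H" by (rule ladder_like.H[OF k])
  show "nu_s H = nu_ur H" by (rule ladder_like.nu_eq[OF k])
qed

theorem theorem1p1:
  fixes G :: "'a ugraph"
  assumes "simple_graph G"
    and "k_connected 2 G"
    and "subcubic G"
    and "card (verts G) \<ge> 21"
  shows "nu_s G = nu_ur G \<longleftrightarrow> (\<exists>H\<in>B. graph_iso G H)"
proof
  assume "nu_s G = nu_ur G"
  then show "\<exists>H\<in>B. graph_iso G H" by (rule equal_imp_iso[OF assms])
next
  assume "\<exists>H\<in>B. graph_iso G H"
  then obtain H where "H \<in> B" "graph_iso G H" by blast
  then show "nu_s G = nu_ur G"
    using graph_iso_nu[OF assms(1) nu_eq_if_B(1)] nu_eq_if_B(2) by simp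
qed

end
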